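(* Let $p\geq 5$ be a prime and $\nu=\tfrac12(1-(\tfrac{-2}{p}))$, $\delta=\tfrac12(1-(\tfrac{-3}{p}))$, $\varepsilon=\tfrac12(1-(\tfrac{-1}{p}))$. Then, in $\mathbb{F}_p[X]$, \[ ss_{p}(X)^{2} = (X -1728)^{\varepsilon } \sum_{n=0}^{(p-1+ 8\delta )/6} \binom{2 n}{n} \binom{3 n}{n} \binom{6 n}{3 n} X^{(p-1+ 8\delta )/6 -n} \pmod{p}, \] \[ ss_{p}^{(2* )}(X)^{2} = (X-256)^{\nu } \sum_{n=0}^{(p-1+ 6\varepsilon )/4 } \binom{2 n}{n}^{2} \binom{4 n}{2 n} X^{(p-1+ 6\varepsilon )/4 -n} \pmod{p}, \] \[ ss_{p}^{(3* )}(X)^{2} = X^{\delta } (X-108)^{\delta } \sum_{n=0}^{(p-1 +2\delta )/3} \binom{2 n}{n}^{2} \binom{3 n}{n} X^{(p-1 +2\delta )/3 -n} \pmod{p}. \]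
   Context: $(\tfrac{\cdot}{p})$ is the Legendre symbol. $ss_p(X)=\prod (X-j(E))\in\mathbb{F}_p[X]$, the product over the distinct $j$-invariants of supersingular elliptic curves over $\overline{\mathbb{F}}_p$ (curves with no nontrivial $p$-torsion); it is known (Deuring) that $ss_p(X)=X^{m+\delta}(X-1728)^{\varepsilon}{}_2F_1(-m,\tfrac5{12}-\tfrac{2\delta-3\varepsilon}{6};1;\tfrac{1728}{X})\bmod p$ with $m=[p/12]$. With $m_2=[p/8]$, $m_3=[p/6]$: $ss^{(2* )}_{p} (X) = X^{m_{2}+\varepsilon} (X-256)^{\nu } {}_{2}F_{1}( -m_{2} ,\tfrac{3}{8}-\tfrac{\varepsilon-2\nu}{4};1;\tfrac{256}{X} ) \bmod p$ and $ss^{(3* )}_{p} (X) = X^{m_{3}+\delta} (X-108)^{\delta } {}_{2}F_{1}( -m_{3} ,\tfrac{1}{3}+\tfrac{\delta}{3};1;\tfrac{108}{X} ) \bmod p$. Here ${}_2F_1(-m,\beta;1;x)=\sum_{n=0}^m\frac{(-m)_n(\beta)_n}{(n!)^2}x^n$ with Pochhammer symbols $(a)_n=a(a+1)\cdots(a+n-1)$, and "$\bmod p$" means reducing the $p$-integral rational coefficients into $\mathbb{F}_p$. *)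

theory Defs
  imports
    "HOL-Number_Theory.Number_Theory"
    "HOL-Algebra.Algebraic_Closure_Type"
    "Berlekamp_Zassenhaus.Finite_Field"
begin

(* The prime p is the cardinality of a type 'p of class prime_card; then 'p mod_ring is the
   field with p elements and 'p mod_ring alg_closure is an algebraic closure of it. *)

section \<open>Elliptic curves and supersingularity\<close>

text \<open>
  Generalised Weierstrass equations
  \<open>y^2 + a1 x y + a3 y = x^3 + a2 x^2 + a4 x + a6\<close> with the usual derived quantities
  and the chord-tangent group law in explicit coordinates (Silverman, The Arithmetic of
  Elliptic Curves, III.1 and III.2.3).  An elliptic curve over a field \<open>K\<close> is given
  by such an equation over \<open>K\<close> with nonzero discriminant.  The intercept of the chord or
  tangent is written \<open>y1 - l x1\<close> in both cases.
\<close>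

datatype 'a wcurve = WCurve (wa1: 'a) (wa2: 'a) (wa3: 'a) (wa4: 'a) (wa6: 'a)

definition wb2 :: "'a::field wcurve \<Rightarrow> 'a" where
  "wb2 E = wa1 E ^ 2 + 4 * wa2 E"

definition wb4 :: "'a::field wcurve \<Rightarrow> 'a" where
  "wb4 E = 2 * wa4 E + wa1 E * wa3 E"

definition wb6 :: "'a::field wcurve \<Rightarrow> 'a" where
  "wb6 E = wa3 E ^ 2 + 4 * wa6 E"

definition wb8 :: "'a::field wcurve \<Rightarrow> 'a" where
  "wb8 E = wa1 E ^ 2 * wa6 E + 4 * wa2 E * wa6 E - wa1 E * wa3 E * wa4 E
            + wa2 E * wa3 E ^ 2 - wa4 E ^ 2"

definition wc4 :: "'a::field wcurve \<Rightarrow> 'a" where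
  "wc4 E = wb2 E ^ 2 - 24 * wb4 E"

definition wdisc :: "'a::field wcurve \<Rightarrow> 'a" where
  "wdisc E = - (wb2 E ^ 2 * wb8 E) - 8 * wb4 E ^ 3 - 27 * wb6 E ^ 2 + 9 * wb2 E * wb4 E * wb6 E"

definition elliptic_curve :: "'a::field wcurve \<Rightarrow> bool" where
  "elliptic_curve E \<longleftrightarrow> wdisc E \<noteq> 0"

definition j_invariant :: "'a::field wcurve \<Rightarrow> 'a" where
  "j_invariant E = wc4 E ^ 3 / wdisc E"

datatype 'a point = Infinity | Affine 'a 'a

fun on_curve :: "'a::field wcurve \<Rightarrow> 'a point \<Rightarrow> bool" where
  "on_curve E Infinity \<longleftrightarrow> True"
| "on_curve E (Affine x y) \<longleftrightarrow>
     y ^ 2 + wa1 E * x * y + wa3 E * y = x ^ 3 + wa2 E * x ^ 2 + wa4 E * x + wa6 E"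

fun point_add :: "'a::field wcurve \<Rightarrow> 'a point \<Rightarrow> 'a point \<Rightarrow> 'a point" where
  "point_add E Infinity Q = Q"
| "point_add E P Infinity = P"
| "point_add E (Affine x1 y1) (Affine x2 y2) =
     (if x1 = x2 \<and> y1 + y2 + wa1 E * x2 + wa3 E = 0 then Infinity
      else
        let l = (if x1 = x2
                 then (3 * x1 ^ 2 + 2 * wa2 E * x1 + wa4 E - wa1 E * y1)
                        / (2 * y1 + wa1 E * x1 + wa3 E)
                 else (y2 - y1) / (x2 - x1));
            x3 = l ^ 2 + wa1 E * l - wa2 E - x1 - x2;
            y3 = - (l + wa1 E) * x3 - (y1 - l * x1) - wa3 E
        in Affine x3 y3)"

fun point_mult :: "'a::field wcurve \<Rightarrow> nat \<Rightarrow> 'a point \<Rightarrow> 'a point" where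
  "point_mult E 0 P = Infinity"
| "point_mult E (Suc n) P = point_add E (point_mult E n P) P"

(* Meant for fields K that are algebraically closed of characteristic p > 0, so that all
   geometric points have coordinates in K. *)
definition supersingular :: "'a::field wcurve \<Rightarrow> bool" where
  "supersingular E \<longleftrightarrow>
     (\<forall>P. on_curve E P \<and> point_mult E CHAR('a) P = Infinity \<longrightarrow> P = Infinity)"


section \<open>The supersingular polynomial\<close>

definition supersingular_j :: "'p::prime_card mod_ring alg_closure set" where
  "supersingular_j = {j_invariant E | E. elliptic_curve E \<and> supersingular E}"

definition ss_poly_ac :: "'p::prime_card mod_ring alg_closure poly" where
  "ss_poly_ac = (\<Prod>j\<in>supersingular_j. [:- j, 1:])"

(* of_ac is the partial inverse of the embedding to_ac of the field into its closure; that
   the coefficients of the product do lie in the prime field is ss_poly_descends below. *)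
definition ss_poly :: "'p::prime_card mod_ring poly" where
  "ss_poly = map_poly of_ac ss_poly_ac"

subsection \<open>The product has coefficients in the prime field\<close>

definition frob :: "'p::prime_card mod_ring alg_closure \<Rightarrow> 'p mod_ring alg_closure" where
  "frob x = x ^ CARD('p)"

lemma frob_add: "frob (x + y) = frob x + frob y"
  and frob_mult: "frob (x * y) = frob x * frob y"
  and frob_power: "frob (x ^ n) = frob x ^ n"
  and frob_divide: "frob (x / y) = frob x / frob y"
  and frob_0: "frob 0 = 0"
  and frob_1: "frob 1 = 1"
  for x y :: "'p::prime_card mod_ring alg_closure"
proof -
  show "frob (x + y) = frob x + frob y"
    unfolding frob_def by (intro freshmans_dream) (simp_all add: prime_card)
qed (simp_all add: frob_def power_mult_distrib power_divide power_mult[symmetric] mult.commute)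

lemma frob_minus: "frob (- x) = - frob x"
  using frob_add[of x "- x"] by (simp add: frob_0 eq_neg_iff_add_eq_0 add.commute)

lemma frob_diff: "frob (x - y) = frob x - frob y"
  using frob_add[of x "- y"] by (simp add: frob_minus)

lemma frob_sum: "frob (sum f A) = (\<Sum>x\<in>A. frob (f x))"
  by (induction A rule: infinite_finite_induct) (simp_all add: frob_0 frob_add)

lemma frob_of_nat: "frob (of_nat n) = of_nat n"
  by (induction n) (simp_all add: frob_0 frob_1 frob_add)

lemma frob_numeral: "frob (numeral n) = numeral n"
  using frob_of_nat[of "numeral n"] by simp

lemma frob_eq_0_iff: "frob x = 0 \<longleftrightarrow> x = 0"
  by (simp add: frob_def)

lemma frob_eq_iff: "frob x = frob y \<longleftrightarrow> x = y"
  using frob_eq_0_iff[of "x - y"] by (simp add: frob_diff)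

lemma frob_surj: "\<exists>y. frob y = x"
proof -
  have "0 < CARD('a)" by simp
  then obtain y where "y ^ CARD('a) = x"
    using nth_root_exists by blast
  then show ?thesis unfolding frob_def by blast
qed

lemma frob_fixed_imp_range:
  fixes x :: "'p::prime_card mod_ring alg_closure"
  assumes "frob x = x"
  shows "x \<in> range to_ac"
proof -
  define q :: "'p mod_ring alg_closure poly" where "q = monom 1 CARD('p) - monom 1 1"
  have p1: "CARD('p) > 1" using prime_card prime_gt_1_nat by blast
  have deg: "degree q \<le> CARD('p)"
    unfolding q_def by (rule degree_diff_le) (use p1 in \<open>auto simp: degree_monom_eq\<close>)
  have "coeff q CARD('p) = 1" using p1 by (simp add: q_def)
  then have "q \<noteq> 0" by auto
  then have fin: "finite {x. poly q x = 0}" and card: "card {x. poly q x = 0} \<le> CARD('p)"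
    using card_poly_roots_bound[of q] deg poly_roots_finite[of q] by auto
  have root: "poly q x = 0 \<longleftrightarrow> frob x = x" for x
    by (simp add: q_def poly_monom frob_def)
  have sub: "range (to_ac :: 'p mod_ring \<Rightarrow> _) \<subseteq> {x. poly q x = 0}"
  proof clarify
    fix y :: "'p mod_ring"
    have "y ^ CARD('p) = y"
      using finite_field_power_card_eq_same[of y] by simp
    then show "poly q (to_ac y) = 0"
      unfolding root frob_def by (metis to_ac_power)
  qed
  have "card (range (to_ac :: 'p mod_ring \<Rightarrow> _)) = CARD('p)"
    using card_image[OF inj_to_ac, where ?'a1 = "'p mod_ring"] by simp
  then have "range (to_ac :: 'p mod_ring \<Rightarrow> _) = {x. poly q x = 0}"
    using card_seteq[OF fin sub] card by simp
  then show ?thesis using assms root by blast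
qed

definition frob_curve where
  "frob_curve E = map_wcurve frob E"

lemma frob_curve_sel:
  "wa1 (frob_curve E) = frob (wa1 E)" "wa2 (frob_curve E) = frob (wa2 E)"
  "wa3 (frob_curve E) = frob (wa3 E)" "wa4 (frob_curve E) = frob (wa4 E)"
  "wa6 (frob_curve E) = frob (wa6 E)"
  by (simp_all add: frob_curve_def wcurve.map_sel)

lemmas frob_hom = frob_add frob_diff frob_minus frob_mult frob_power frob_divide
  frob_0 frob_1 frob_numeral

lemma frob_disc: "wdisc (frob_curve E) = frob (wdisc E)"
  by (simp add: wdisc_def wb2_def wb4_def wb6_def wb8_def frob_curve_sel frob_hom)

lemma frob_j: "j_invariant (frob_curve E) = frob (j_invariant E)"
  by (simp add: j_invariant_def frob_disc wc4_def wb2_def wb4_def frob_curve_sel frob_hom)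

lemma on_curve_frob: "on_curve (frob_curve E) (map_point frob P) \<longleftrightarrow> on_curve E P"
proof (cases P)
  case (Affine x y)
  have "on_curve (frob_curve E) (map_point frob P) \<longleftrightarrow>
          frob (y ^ 2 + wa1 E * x * y + wa3 E * y)
            = frob (x ^ 3 + wa2 E * x ^ 2 + wa4 E * x + wa6 E)"
    by (simp add: Affine frob_curve_sel frob_hom)
  then show ?thesis by (simp add: Affine frob_eq_iff)
qed simp

lemma point_add_frob:
  "point_add (frob_curve E) (map_point frob P) (map_point frob Q)
     = map_point frob (point_add E P Q)"
proof (cases "P = Infinity \<or> Q = Infinity")
  case True
  then show ?thesis by (cases P; cases Q) auto
next
  case False
  then obtain x1 y1 x2 y2 where PQ: "P = Affine x1 y1" "Q = Affine x2 y2"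
    by (metis point.exhaust)
  have "frob y1 + frob y2 + frob (wa1 E) * frob x2 + frob (wa3 E) = 0
          \<longleftrightarrow> frob (y1 + y2 + wa1 E * x2 + wa3 E) = 0"
    by (simp only: frob_hom)
  then have opp: "frob y1 + frob y2 + frob (wa1 E) * frob x2 + frob (wa3 E) = 0
          \<longleftrightarrow> y1 + y2 + wa1 E * x2 + wa3 E = 0"
    by (simp only: frob_eq_0_iff)
  show ?thesis
    by (simp add: PQ frob_curve_sel opp frob_eq_iff Let_def frob_hom)
qed

lemma point_mult_frob:
  "point_mult (frob_curve E) n (map_point frob P) = map_point frob (point_mult E n P)"
  by (induction n) (simp_all add: point_add_frob)

lemma supersingular_frob:
  assumes "supersingular E"
  shows "supersingular (frob_curve E)"
  unfolding supersingular_def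
proof (intro allI impI, elim conjE)
  fix Q
  assume Q: "on_curve (frob_curve E) Q"
    "point_mult (frob_curve E) CHAR('a mod_ring alg_closure) Q = Infinity"
  obtain P where P: "Q = map_point frob P"
  proof (cases Q)
    case Infinity
    then show ?thesis by (intro that[of Infinity]) simp
  next
    case (Affine x y)
    obtain x' y' where "frob x' = x" "frob y' = y" using frob_surj by metis
    then show ?thesis by (intro that[of "Affine x' y'"]) (simp add: Affine)
  qed
  have "R = Infinity" if "map_point frob R = Infinity" for R
    using that by (cases R) auto
  with Q have "on_curve E P" "point_mult E CHAR('a mod_ring alg_closure) P = Infinity"
    by (simp_all add: P on_curve_frob point_mult_frob del: CHAR_alg_closure)
  then have "P = Infinity" using assms unfolding supersingular_def by blast
  then show "Q = Infinity" by (simp add: P)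
qed

lemma supersingular_j_frob: "j \<in> supersingular_j \<Longrightarrow> frob j \<in> supersingular_j"
  unfolding supersingular_j_def elliptic_curve_def
  using frob_j frob_disc supersingular_frob frob_eq_0_iff by (smt (verit) mem_Collect_eq)

lemma map_poly_frob_mult: "map_poly frob (f * g) = map_poly frob f * map_poly frob g"
  by (rule poly_eqI) (simp add: coeff_map_poly coeff_mult frob_0 frob_sum frob_mult)

lemma map_poly_frob_prod: "map_poly frob (\<Prod>x\<in>A. f x) = (\<Prod>x\<in>A. map_poly frob (f x))"
  by (induction A rule: infinite_finite_induct)
     (simp_all add: map_poly_frob_mult frob_1 map_poly_1')

lemma ss_poly_ac_frob:
  "map_poly frob ss_poly_ac = (ss_poly_ac :: 'p::prime_card mod_ring alg_closure poly)"
proof (cases "finite (supersingular_j :: 'p mod_ring alg_closure set)")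
  case True
  let ?S = "supersingular_j :: 'p mod_ring alg_closure set"
  have inj: "inj_on frob ?S" by (auto simp: inj_on_def frob_eq_iff)
  have "frob ` ?S = ?S"
    by (rule endo_inj_surj[OF True _ inj]) (auto intro: supersingular_j_frob)
  then have "(\<Prod>j\<in>?S. [:- frob j, 1:]) = (\<Prod>j\<in>?S. [:- j, 1:])"
    by (metis (no_types, lifting) inj prod.reindex_cong)
  moreover have "map_poly frob [:- j, 1:] = [:- frob j, 1:]" for j :: "'p mod_ring alg_closure"
    by (simp add: map_poly_pCons frob_minus frob_0 frob_1)
  ultimately show ?thesis
    by (simp only: ss_poly_ac_def map_poly_frob_prod)
qed (simp add: ss_poly_ac_def frob_1 map_poly_1')

lemma ss_poly_descends:
  "map_poly to_ac (ss_poly :: 'p::prime_card mod_ring poly) = ss_poly_ac"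
proof (rule poly_eqI)
  fix n
  let ?c = "coeff (ss_poly_ac :: 'p mod_ring alg_closure poly) n"
  have "frob ?c = ?c"
    using arg_cong[OF ss_poly_ac_frob, of "\<lambda>f. coeff f n"]
    by (simp add: coeff_map_poly frob_0)
  then have "?c \<in> range to_ac" by (rule frob_fixed_imp_range)
  then show "coeff (map_poly to_ac (ss_poly :: 'p mod_ring poly)) n = ?c"
    by (simp add: ss_poly_def coeff_map_poly to_ac_of_ac)
qed


section \<open>The level 2 and level 3 analogues\<close>

definition eps :: "nat \<Rightarrow> nat" where
  "eps p = nat ((1 - Legendre (- 1) (int p)) div 2)"

definition delta :: "nat \<Rightarrow> nat" where
  "delta p = nat ((1 - Legendre (- 3) (int p)) div 2)"

definition nu :: "nat \<Rightarrow> nat" where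
  "nu p = nat ((1 - Legendre (- 2) (int p)) div 2)"

(* Reduction of a rational number modulo p; quotient_of gives the fraction in lowest terms.
   It is only meaningful for p-integral numbers: otherwise the denominator reduces to 0. *)
definition rat_mod :: "rat \<Rightarrow> 'p::prime_card mod_ring" where
  "rat_mod r = of_int (fst (quotient_of r)) / of_int (snd (quotient_of r))"

lemma rat_mod_divide:
  assumes "\<not> int CARD('p) dvd b"
  shows "(rat_mod (of_int a / of_int b) :: 'p::prime_card mod_ring) = of_int a / of_int b"
proof -
  obtain n d where nd: "quotient_of (of_int a / of_int b) = (n, d)" by fastforce
  have d0: "d > 0" and cop: "coprime n d"
    using quotient_of_denom_pos[OF nd] quotient_of_coprime[OF nd] by auto
  have b0: "b \<noteq> 0" using assms by auto
  have "(of_int a / of_int b :: rat) = of_int n / of_int d"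
    using quotient_of_div[OF nd] .
  then have "(of_int (a * d) :: rat) = of_int (n * b)"
    using b0 d0 by (simp add: field_simps)
  then have eq: "a * d = n * b" by (simp only: of_int_eq_iff)
  have "d dvd b"
    using eq cop by (metis coprime_commute coprime_dvd_mult_right_iff dvd_triv_right)
  then have "\<not> int CARD('p) dvd d" using assms dvd_trans by blast
  then have nz: "(of_int d :: 'p mod_ring) \<noteq> 0" "(of_int b :: 'p mod_ring) \<noteq> 0"
    using assms by (simp_all add: of_int_eq_0_iff_char_dvd)
  have "(of_int a * of_int d :: 'p mod_ring) = of_int n * of_int b"
    using eq by (metis of_int_mult)
  then show ?thesis
    using nz by (simp add: rat_mod_def nd field_simps)
qed

(* X^k * 2F1(-m, \<beta>; 1; c/X) as a polynomial over the rationals, for k \<ge> m; this is the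
   range in which the exponents k - n below are not truncated. *)
definition hyp_poly :: "nat \<Rightarrow> nat \<Rightarrow> rat \<Rightarrow> rat \<Rightarrow> rat poly" where
  "hyp_poly k m \<beta> c =
     (\<Sum>n=0..m. monom (pochhammer (- of_nat m) n * pochhammer \<beta> n / (fact n)^2 * c ^ n) (k - n))"

(* The factor (X - c)^e has integer coefficients, so the reduction is applied to the whole
   product over the rationals, here and for ss3_poly. *)
definition ss2_poly :: "'p::prime_card mod_ring poly" where
  "ss2_poly =
     (let p = CARD('p); m = p div 8; \<epsilon> = eps p; \<nu> = nu p in
        map_poly rat_mod
          ([:- 256, 1:] ^ \<nu>
            * hyp_poly (m + \<epsilon>) m (3 / 8 - (of_nat \<epsilon> - 2 * of_nat \<nu>) / 4) 256))"

definition ss3_poly :: "'p::prime_card mod_ring poly" where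
  "ss3_poly =
     (let p = CARD('p); m = p div 6; \<delta> = delta p in
        map_poly rat_mod
          ([:- 108, 1:] ^ \<delta>
            * hyp_poly (m + \<delta>) m (1 / 3 + of_nat \<delta> / 3) 108))"

end

theory Submission
  imports Defs
    "Jordan_Normal_Form.Char_Poly"
    "HOL-Computational_Algebra.Formal_Power_Series"
begin

text \<open>
  For \<open>E: y^2 = f(x)\<close> with \<open>f = x^3 + a x + b\<close>, a nontrivial \<open>p\<close>-torsion point \<open>(x0, y0)\<close>
  is the same as a function \<open>u + v y\<close> with \<open>u^2 - f v^2 = C (x - x0)^p\<close>. Differentiating this
  identity makes \<open>u\<close> an eigenvector of \<open>4 f D^2 + 2 f' D\<close> with nonzero eigenvalue, and
  conversely. Since the \<open>p\<close>-th iterate of \<open>y d/dx\<close> is a constant multiple of \<open>y d/dx\<close>, such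
  an eigenvector excludes an antiderivative of \<open>f^((p-1)/2)\<close>; if there is no antiderivative,
  linear algebra on polynomials of degree at most \<open>(p-1)/2\<close> produces one. So \<open>E\<close> is
  supersingular iff the coefficient of \<open>x^(p-1)\<close> in \<open>f^((p-1)/2)\<close> vanishes.

  As a function of \<open>1728/j\<close> this coefficient solves, up to trivial factors, a hypergeometric
  equation; polynomial solutions of degree less than \<open>p\<close> are unique up to scaling and have
  simple roots away from \<open>0\<close> and \<open>1\<close>. This identifies \<open>ss_p\<close>. All three squares are then
  instances of Clausen's identity, which holds modulo \<open>p\<close> because both sides are polynomials of
  degree less than \<open>p\<close> with the same third order differential equation.
\<close>

section \<open>Square roots of power series and the chord-tangent cubic\<close>

text \<open>Supersingularity is stated through iterated chord-tangent sums. Since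
  \<open>point_mult\<close> adds the same point at every step, a function with poles only at
  infinity can be carried along by one line per step; from there on only pairs \<open>(u, v)\<close>
  and norms \<open>u^2 - f v^2\<close> occur. Genus one enters as the fact that such a norm never
  has degree 1. Up to a monomial in \<open>a\<close> and \<open>b\<close>, the coefficient of
  \<open>x^(p-1)\<close> is a polynomial in \<open>w = - 27 b^2 / (4 a^3)\<close>, expanded at
  \<open>w = 0\<close>, that is \<open>j = 1728\<close>, where the hypergeometric \<open>c\<close>
  is 1/2 or 3/2. Clausen's identity is wanted at \<open>c = 1\<close>. As
  \<open>1728 / j = 1 - w\<close>, the reflection \<open>w -> 1 - w\<close> moves the expansion to
  \<open>j = infinity\<close>, where \<open>c = 1\<close>. Modulo \<open>p\<close> one parameter is
  a non-positive integer, so the series terminates; this is the origin of \<open>[p/12]\<close>,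
  \<open>[p/8]\<close> and \<open>[p/6]\<close>. The factors \<open>(X - 1728)^\<epsilon>\<close>,
  \<open>(X - 256)^\<nu>\<close>, \<open>(X - 108)^\<delta>\<close> reflect Euler's transformation:
  if \<open>A + B = 3/2\<close>, then \<open>F(A,B;1;z) = (1-z)^(-1/2) F(1-A,1-B;1;z)\<close>, and
  the new parameters have the sum 1/2 that Clausen's identity asks for.\<close>

fun fps_sqrt_coeff :: "(nat \<Rightarrow> 'a::field) \<Rightarrow> 'a \<Rightarrow> nat \<Rightarrow> 'a" where
  "fps_sqrt_coeff g c n =
     (if n = 0 then c
      else (g n - (\<Sum>i\<in>{1..<n}. fps_sqrt_coeff g c i * fps_sqrt_coeff g c (n - i))) / (2 * c))"

declare fps_sqrt_coeff.simps [simp del]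

text \<open>In the coefficient of \<open>X^n\<close> the unknown \<open>y n\<close> occurs only as
  \<open>2 * c * y n\<close>, so the recursion divides by \<open>2 * c\<close>. This supplies the
  expansion of y at a curve point with nonzero ordinate, where \<open>x - x0\<close> is a local
  parameter.\<close>

lemma fps_sqrt_exists:
  fixes g :: "'a::field fps"
  assumes two: "(2::'a) \<noteq> 0" and c: "c ^ 2 = fps_nth g 0" "c \<noteq> 0"
  shows "\<exists>Y. Y ^ 2 = g \<and> fps_nth Y 0 = c"
proof (intro exI conjI)
  define y where "y = fps_sqrt_coeff (fps_nth g) c"
  have y0: "y 0 = c" by (simp add: y_def fps_sqrt_coeff.simps)
  have yn: "y n = (fps_nth g n - (\<Sum>i\<in>{1..<n}. y i * y (n - i))) / (2 * c)" if "n > 0" for n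
    using that by (simp add: y_def fps_sqrt_coeff.simps[of _ _ n])
  show "fps_nth (Abs_fps y) 0 = c" by (simp add: y0)
  show "Abs_fps y ^ 2 = g"
  proof (rule fps_ext)
    fix n
    show "fps_nth (Abs_fps y ^ 2) n = fps_nth g n"
    proof (cases "n = 0")
      case True
      then show ?thesis using c by (simp add: power2_eq_square y0)
    next
      case False
      then have "{0..n} = insert 0 (insert n {1..<n})" by auto
      then have "fps_nth (Abs_fps y ^ 2) n = 2 * c * y n + (\<Sum>i\<in>{1..<n}. y i * y (n - i))"
        using False by (simp add: power2_eq_square fps_mult_nth y0)
      also have "\<dots> = fps_nth g n"
        using False yn[of n] two c by (simp add: field_simps)
      finally show ?thesis .
    qed
  qed
qed

text \<open>A line meets the cubic in three points: \<open>(l x + m)^2 - f\<close> has the roots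
  \<open>x1\<close>, \<open>x2\<close> and, by the sum of the roots, \<open>l^2 - x1 - x2\<close>.
  As a polynomial identity this treats chord and tangent alike.\<close>

lemma chord_tangent_cubic:
  fixes a b :: "'a::field"
  assumes two: "(2::'a) \<noteq> 0"
    and P: "y1 ^ 2 = x1 ^ 3 + a * x1 + b" and Q: "y2 ^ 2 = x2 ^ 3 + a * x2 + b"
    and ne: "\<not> (x1 = x2 \<and> y1 + y2 = 0)"
    and l: "l = (if x1 = x2 then (3 * x1 ^ 2 + a) / (2 * y1) else (y2 - y1) / (x2 - x1))"
    and m: "m = y1 - l * x1" and x3: "x3 = l ^ 2 - x1 - x2"
  shows "[:- m, - l:] ^ 2 - [:b, a, 0, 1:] = - ([:- x1, 1:] * [:- x2, 1:] * [:- x3, 1:])"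
    and "y2 = l * x2 + m"
proof -
  have y2: "y2 = l * x2 + m \<and> a - 2 * l * m = x1 * x2 + (x1 + x2) * x3
              \<and> m ^ 2 - b = x1 * x2 * x3"
  proof (cases "x1 = x2")
    case True
    have "(y1 - y2) * (y1 + y2) = 0" using P Q True by (simp add: algebra_simps power2_eq_square)
    then have y: "y2 = y1" using ne True by simp
    have y1: "y1 \<noteq> 0" using ne True y by auto
    have l': "2 * y1 * l = 3 * x1 ^ 2 + a" using l True two y1 by simp
    have a': "a = 2 * y1 * l - 3 * x1 ^ 2" using l' by simp
    have b': "b = y1 ^ 2 - x1 ^ 3 - a * x1" using P by simp
    show ?thesis unfolding m x3 b' unfolding a' using True y
      by (auto simp: algebra_simps power2_eq_square power3_eq_cube)
  next
    case False
    have l': "l * (x2 - x1) = y2 - y1" using l False by simp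
    then have y2: "y2 = l * x2 + m" by (simp add: m algebra_simps)
    have y1: "y1 = l * x1 + m" by (simp add: m)
    have b': "b = y1 ^ 2 - x1 ^ 3 - a * x1" using P by simp
    \<comment> \<open>With both points on the line, the difference of the two curve equations
      carries the factor \<open>x2 - x1\<close>.\<close>
    have "(x2 - x1) * (a - 2 * l * m - (x1 * x2 + (x1 + x2) * x3)) = 0"
      using Q b' unfolding x3 y2 y1 by Groebner_Basis.algebra
    then have "a - 2 * l * m - (x1 * x2 + (x1 + x2) * x3) = 0" using False by simp
    then have a': "a = 2 * l * m + (x1 * x2 + (x1 + x2) * x3)" by Groebner_Basis.algebra
    have "m ^ 2 - b = x1 * x2 * x3" unfolding b' y1 a' x3 by Groebner_Basis.algebra
    with y2 a' show ?thesis by simp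
  qed
  then show "y2 = l * x2 + m" by simp
  have "a = 2 * l * m + (x1 * x2 + (x1 + x2) * x3)" "b = m^2 - x1 * x2 * x3"
    using y2 by (simp_all add: algebra_simps)
  then show "[:- m, - l:] ^ 2 - [:b, a, 0, 1:] = - ([:- x1, 1:] * [:- x2, 1:] * [:- x3, 1:])"
    unfolding x3 by (simp only: power2_eq_square) (simp add: algebra_simps power2_eq_square)
qed

section \<open>Short Weierstrass curves and Miller functions\<close>

definition lin :: "'a::comm_ring_1 \<Rightarrow> 'a poly" where "lin x = [:- x, 1:]"

lemma poly_lin [simp]: "poly (lin x) y = y - x" by (simp add: lin_def)

lemma lin_nz [simp]: "lin (x::'a::idom) \<noteq> 0" by (simp add: lin_def)

lemma degree_lin [simp]: "degree (lin (x::'a::idom)) = 1" by (simp add: lin_def)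

lemma lin_dvd_iff: "lin (x::'a::idom) dvd u \<longleftrightarrow> poly u x = 0"
  by (simp add: lin_def poly_eq_0_iff_dvd)

locale short_curve =
  fixes a b :: "'a::alg_closed_field" and p :: nat
  assumes char: "CHAR('a) = p" and p_prime: "Factorial_Ring.prime p" and p_ge_5: "p \<ge> 5"
    and disc: "4 * a ^ 3 + 27 * b ^ 2 \<noteq> 0"
begin

definition "f = [:b, a, 0, 1:]"
definition "E = WCurve 0 0 0 a b"
text \<open>The norm of the function \<open>u + v y\<close> under \<open>y -> - y\<close>.\<close>

definition nrm :: "'a poly \<Rightarrow> 'a poly \<Rightarrow> 'a poly" where "nrm u v = u ^ 2 - f * v ^ 2"

lemma of_nat_nz: "0 < n \<Longrightarrow> n < p \<Longrightarrow> (of_nat n :: 'a) \<noteq> 0"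
  using char by (auto simp: of_nat_eq_0_iff_char_dvd dest: dvd_imp_le)

lemma two: "(2::'a) \<noteq> 0" using of_nat_nz[of 2] p_ge_5 by simp

lemma three: "(3::'a) \<noteq> 0" using of_nat_nz[of 3] p_ge_5 by simp

lemma p_odd: "odd p" using p_prime p_ge_5 prime_odd_nat[of p] by simp

lemma poly_f: "poly f x = x ^ 3 + a * x + b"
  by (simp add: f_def algebra_simps power3_eq_cube)

lemma degree_f: "degree f = 3" by (simp add: f_def)

lemma f_nz: "f \<noteq> 0" using degree_f by auto

lemma on_curve_E: "on_curve E (Affine x y) \<longleftrightarrow> y ^ 2 = poly f x"
  by (simp add: E_def poly_f)

lemma f_simple_root:
  assumes "poly f x = 0" shows "poly (pderiv f) x \<noteq> 0"
proof
  assume "poly (pderiv f) x = 0"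
  then have 1: "3 * x ^ 2 + a = 0" by (simp add: f_def pderiv_pCons algebra_simps power2_eq_square)
  have 2: "x ^ 3 + a * x + b = 0" using assms by (simp add: poly_f)
  have "4 * a ^ 3 + 27 * b ^ 2 = 0" using 1 2 by Groebner_Basis.algebra
  then show False using disc by simp
qed

text \<open>The arguments on the left are the components of \<open>(u + v y) (c + d y)\<close> after
  replacing \<open>y^2\<close> by \<open>f\<close>.\<close>

lemma nrm_mult: "nrm (u * c + v * d * f) (u * d + v * c) = nrm u v * nrm c d"
  unfolding nrm_def by (simp add: algebra_simps power2_eq_square)

lemma nrm_scale: "nrm (t * u) (t * v) = t ^ 2 * nrm u v"
  unfolding nrm_def by (simp only: power_mult_distrib) (simp only: algebra_simps)

text \<open>The two terms have degrees of different parity, so their leading terms cannot cancel.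
  The value is the pole order of \<open>u + v y\<close> at infinity.\<close>

lemma degree_nrm:
  shows "v \<noteq> 0 \<Longrightarrow> degree (nrm u v) = max (2 * degree u) (2 * degree v + 3)"
    and "degree (nrm u 0) = 2 * degree u"
proof -
  have du: "degree (u ^ 2) = 2 * degree u" by (cases "u = 0") (simp_all add: power2_eq_square degree_mult_eq)
  then show "degree (nrm u 0) = 2 * degree u" by (simp add: nrm_def)
  assume v: "v \<noteq> 0"
  then have dv: "degree (f * v ^ 2) = 2 * degree v + 3"
    by (simp add: degree_mult_eq f_nz degree_f power2_eq_square)
  show "degree (nrm u v) = max (2 * degree u) (2 * degree v + 3)"
  proof (cases "2 * degree u < 2 * degree v + 3")
    case True
    then have "degree (u ^ 2 + - (f * v ^ 2)) = degree (- (f * v ^ 2))"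
      using du dv by (intro degree_add_eq_right) simp
    then show ?thesis using True dv by (simp add: nrm_def)
  next
    case False
    then have "2 * degree u > 2 * degree v + 3" by presburger
    then have "degree (u ^ 2 + - (f * v ^ 2)) = degree (u ^ 2)"
      using du dv by (intro degree_add_eq_left) simp
    then show ?thesis using False du by (simp add: nrm_def)
  qed
qed

text \<open>No function has a single simple pole: this is how genus one is used, and it is the
  source of the contradictions below.\<close>

lemma degree_nrm_ne_1: "degree (nrm u v) \<noteq> 1"
proof (cases "v = 0")
  case True
  then show ?thesis using degree_nrm(2)[of u] by presburger
next
  case False
  then show ?thesis using degree_nrm(1)[of v u] by simp
qed

end

locale short_curve_point = short_curve +
  fixes x0 y0 :: 'a and Y :: "'a fps"
  assumes P: "y0 ^ 2 = poly f x0" and y0: "y0 \<noteq> 0"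
    and Y: "Y ^ 2 = fps_of_poly (pcompose f [:x0, 1:])" "fps_nth Y 0 = y0"
begin

text \<open>
  A function \<open>u + v y\<close> on the curve is represented by the pair \<open>(u, v)\<close>, and
  \<open>ser\<close> and \<open>expand\<close> are its expansion in the local parameter \<open>x - x0\<close>
  at \<open>(x0, y0)\<close>.
\<close>

definition ser :: "'a poly \<Rightarrow> 'a fps" where "ser u = fps_of_poly (pcompose u [:x0, 1:])"
definition expand :: "'a poly \<Rightarrow> 'a poly \<Rightarrow> 'a fps" where "expand u v = ser u + ser v * Y"

lemma ser_add: "ser (u + v) = ser u + ser v"
  and ser_diff: "ser (u - v) = ser u - ser v"
  and ser_minus: "ser (- u) = - ser u"
  and ser_mult: "ser (u * v) = ser u * ser v"
  and ser_power: "ser (u ^ n) = ser u ^ n"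
  and ser_smult: "ser (smult c u) = fps_const c * ser u"
  by (simp_all add: ser_def pcompose_add pcompose_diff pcompose_uminus pcompose_mult
      pcompose_hom.hom_power fps_of_poly_add fps_of_poly_diff fps_of_poly_uminus
      fps_of_poly_mult fps_of_poly_power pcompose_smult fps_of_poly_smult)

lemma ser_lin: "ser (lin x0) = fps_X"
  by (simp add: lin_def ser_def pcompose_pCons fps_of_poly_pCons)

lemma Y_sq: "Y * Y = ser f" using Y by (simp add: ser_def power2_eq_square)

lemma ser_nth_0: "fps_nth (ser u) 0 = poly u x0"
  by (simp add: ser_def coeff_pcompose_0)

lemma expand_mult: "expand (u * c + v * d * f) (u * d + v * c) = expand u v * expand c d"
proof -
  have "ser f = Y * Y" by (simp add: Y_sq)
  then show ?thesis by (simp add: expand_def ser_add ser_mult algebra_simps)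
qed

lemma expand_conj: "expand u v * expand u (- v) = ser (nrm u v)"
  using Y_sq by (simp add: expand_def nrm_def ser_minus ser_diff ser_mult power2_eq_square algebra_simps)

lemma expand_nth_0: "fps_nth (expand u v) 0 = poly u x0 + poly v x0 * y0"
  by (simp add: expand_def ser_nth_0 Y)

lemma X_power_dvd_ser:
  assumes "fps_X ^ n dvd ser u" shows "lin x0 ^ n dvd u"
proof -
  have "coeff (pcompose u [:x0, 1:]) i = 0" if "i < n" for i
  proof -
    obtain w where "ser u = fps_X ^ n * w" using assms by (auto elim: dvdE)
    then have "fps_nth (ser u) i = 0" using that by (simp add: fps_X_power_mult_nth)
    then show ?thesis by (simp add: ser_def)
  qed
  then have "monom 1 n dvd pcompose u [:x0, 1:]"
    by (simp add: monom_1_dvd_iff')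
  then obtain w where "pcompose u [:x0, 1:] = monom 1 n * w" by auto
  then have "pcompose (pcompose u [:x0, 1:]) [:- x0, 1:] = pcompose (monom 1 n * w) [:- x0, 1:]"
    by simp
  moreover have "pcompose (pcompose u [:x0, 1:]) [:- x0, 1:] = u"
    by (simp flip: pcompose_assoc add: pcompose_pCons)
  moreover have "pcompose (monom 1 n) [:- x0, 1:] = [:- x0, 1:] ^ n"
    by (simp add: monom_altdef pcompose_hom.hom_power pcompose_pCons)
  ultimately show ?thesis by (simp add: pcompose_mult lin_def)
qed

lemma dvd_unit_cancel:
  fixes A B C :: "'a fps"
  assumes "A * C = B" "fps_nth C 0 \<noteq> 0" "D dvd B" shows "D dvd A"
proof -
  have "C * inverse C = 1" using assms(2) by (rule inverse_mult_eq_1')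
  then have "A = B * inverse C" using assms(1) by (metis assms(1) mult.assoc mult.right_neutral)
  then show ?thesis using assms(3) by simp
qed

text \<open>
  Miller's functions: \<open>miller n Q\<close> provides a function with divisor
  \<open>n (P) + (- Q) - (n + 1) (O)\<close>, where \<open>P = (x0, y0)\<close>. It is used for \<open>Q = n P\<close>.
\<close>

definition miller :: "nat \<Rightarrow> 'a point \<Rightarrow> bool" where
  "miller n Q = (case Q of
       Infinity \<Rightarrow> \<exists>u v C. C \<noteq> 0 \<and> nrm u v = smult C (lin x0 ^ n) \<and> fps_X ^ n dvd expand u v
     | Affine x y \<Rightarrow> y ^ 2 = poly f x \<and>
         (\<exists>u v C. C \<noteq> 0 \<and> nrm u v = smult C (lin x0 ^ n * lin x)
            \<and> poly u x = y * poly v x \<and> fps_X ^ n dvd expand u v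
            \<and> (x = x0 \<and> y = - y0 \<longrightarrow> fps_X ^ Suc n dvd expand u v)))"

text \<open>The function is multiplied by the line through \<open>Q\<close> and \<open>P\<close>,
  with divisor \<open>(Q) + (P) + (-(Q+P)) - 3 (O)\<close>, and divided by the vertical
  \<open>x - x1\<close>, with divisor \<open>(Q) + (-Q) - 2 (O)\<close>. For \<open>Q = O\<close> it
  is multiplied by \<open>x - x0\<close>; for \<open>Q = -P\<close> it stays as it is, and the last
  clause of \<open>miller\<close> supplies the order of vanishing \<open>n + 1\<close>.\<close>

lemma miller_step:
  assumes "miller n Q" shows "miller (Suc n) (point_add E Q (Affine x0 y0))"
proof (cases Q)
  case Infinity
  then obtain u v C where uv: "C \<noteq> 0" "nrm u v = smult C (lin x0 ^ n)" "fps_X ^ n dvd expand u v"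
    using assms by (auto simp: miller_def)
  let ?t = "lin x0"
  have "nrm (?t * u) (?t * v) = smult C (?t ^ Suc n * ?t)"
    unfolding nrm_scale uv by (simp add: power2_eq_square ac_simps)
  moreover have "expand (?t * u) (?t * v) = fps_X * expand u v"
    unfolding expand_def ser_mult ser_lin by (simp only: algebra_simps)
  then have "fps_X ^ Suc n dvd expand (?t * u) (?t * v)" using uv by (simp add: mult_dvd_mono)
  \<comment> \<open>So the last clause of \<open>miller\<close> is vacuous for the new
    point.\<close>
  moreover have "y0 \<noteq> - y0" using y0 two by (metis add_eq_0_iff2 mult_2 mult_eq_0_iff)
  ultimately have "miller (Suc n) (Affine x0 y0)"
    using uv(1) P unfolding miller_def point.case
    by (intro conjI exI[of _ "?t * u"] exI[of _ "?t * v"] exI[of _ C]) auto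
  then show ?thesis by (simp add: Infinity)
next
  case (Affine x1 y1)
  then obtain u v C where Q: "y1 ^ 2 = poly f x1" and C: "C \<noteq> 0"
    and uv: "nrm u v = smult C (lin x0 ^ n * lin x1)" "poly u x1 = y1 * poly v x1"
    and ord: "fps_X ^ n dvd expand u v" "x1 = x0 \<and> y1 = - y0 \<Longrightarrow> fps_X ^ Suc n dvd expand u v"
    using assms by (auto simp: miller_def)
  show ?thesis
  proof (cases "x1 = x0 \<and> y1 + y0 = 0")
    case True
    then have "y1 = - y0" by (simp add: eq_neg_iff_add_eq_0)
    then have "miller (Suc n) Infinity"
      using True uv C ord unfolding miller_def point.case
      by (intro exI[of _ u] exI[of _ v] exI[of _ C]) (auto simp: mult.commute)
    moreover have "point_add E Q (Affine x0 y0) = Infinity" using True by (simp add: Affine E_def)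
    ultimately show ?thesis by simp
  next
    case False
    define l where "l = (if x1 = x0 then (3 * x1 ^ 2 + a) / (2 * y1) else (y0 - y1) / (x0 - x1))"
    define m where "m = y1 - l * x1"
    define x3 where "x3 = l ^ 2 - x1 - x0"
    define y3 where "y3 = - (l * x3 + m)"
    have sum: "point_add E Q (Affine x0 y0) = Affine x3 y3"
      unfolding Affine E_def using False
      by (simp add: Let_def x3_def y3_def m_def l_def del: times_divide_eq_left)
    \<comment> \<open>\<open>c + y\<close> is the line. The product \<open>(u + v y) (c + y)\<close>
      vanishes at both points above \<open>x1\<close>, so both of its components are divisible by
      \<open>x - x1\<close>.\<close>
    define c where "c = [:- m, - l:]"
    let ?t0 = "lin x0" and ?t1 = "lin x1" and ?t3 = "lin x3"
    have line: "c ^ 2 - f = - (?t1 * ?t0 * ?t3)" and y0': "y0 = l * x0 + m"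
      using chord_tangent_cubic[OF two Q[unfolded poly_f] P[unfolded poly_f] False l_def m_def x3_def]
      by (simp_all only: c_def f_def lin_def)
    have c1: "poly c x1 = - y1" by (simp add: c_def m_def algebra_simps)
    have "poly (u * c + v * f) x1 = 0" "poly (u + v * c) x1 = 0"
      using uv(2) Q c1 by (simp_all add: power2_eq_square)
    then obtain u' v' where u': "u * c + v * f = ?t1 * u'" and v': "u + v * c = ?t1 * v'"
      by (metis lin_dvd_iff dvdE)
    have t1: "?t1 \<noteq> 0" by simp
    have k2: "v' * c - u' = - (v * ?t0 * ?t3)"
    proof -
      have "?t1 * (v' * c - u') = ?t1 * (- (v * ?t0 * ?t3))"
        using u' v' line by Groebner_Basis.algebra
      then show ?thesis using t1 by (simp only: mult_cancel_left) simp
    qed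
    have k1: "u' * c - v' * f = - (u * ?t0 * ?t3)"
    proof -
      have "?t1 * (u' * c - v' * f) = ?t1 * (- (u * ?t0 * ?t3))"
        using u' v' line by Groebner_Basis.algebra
      then show ?thesis using t1 by (simp only: mult_cancel_left) simp
    qed
    have norm: "nrm u' v' = smult (- C) (?t0 ^ Suc n * ?t3)"
    proof -
      have "?t1 ^ 2 * nrm u' v' = (?t1 * u') ^ 2 - f * (?t1 * v') ^ 2"
        using nrm_scale by (simp add: nrm_def)
      also have "\<dots> = nrm u v * (c ^ 2 - f)"
        using nrm_mult[of u c v 1] unfolding u'[symmetric] v'[symmetric] by (simp add: nrm_def)
      also have "\<dots> = smult C (?t0 ^ n * ?t1) * - (?t1 * ?t0 * ?t3)" by (simp only: uv line)
      also have "\<dots> = ?t1 ^ 2 * smult (- C) (?t0 ^ Suc n * ?t3)"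
        by (simp add: power2_eq_square ac_simps)
      finally show ?thesis using t1 by (metis mult_cancel_left power_not_zero)
    qed
    have at3: "poly u' x3 = y3 * poly v' x3"
    proof -
      have "poly (v' * c - u') x3 = 0" unfolding k2 by simp
      moreover have "poly c x3 = y3" by (simp add: c_def y3_def)
      ultimately show ?thesis by (simp add: mult.commute)
    qed
    \<comment> \<open>Multiplying by the conjugate line \<open>c - y\<close>, whose value at
      \<open>P\<close> is \<open>- 2 y0\<close> and hence a unit, exhibits the gain of one order at
      \<open>P\<close>, or of two if \<open>x3 = x0\<close>.\<close>
    have prod: "expand u' v' * expand c (- 1) = - (expand u v * (fps_X * ser ?t3))"
    proof -
      have "expand u' v' * expand c (- 1) = expand (u' * c - v' * f) (v' * c - u')"
        using expand_mult[of u' c v' "- 1"] by (simp add: algebra_simps)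
      also have "\<dots> = - (expand u v * (fps_X * ser ?t3))"
        unfolding k1 k2 expand_def ser_minus ser_mult ser_lin by (simp add: algebra_simps)
      finally show ?thesis .
    qed
    have unit: "fps_nth (expand c (- 1)) 0 \<noteq> 0"
    proof -
      have "fps_nth (expand c (- 1)) 0 = - (2 * y0)"
        unfolding expand_nth_0 by (simp add: c_def y0' algebra_simps)
      then show ?thesis using two y0 by simp
    qed
    have o1: "fps_X ^ Suc n dvd expand u' v'"
      by (rule dvd_unit_cancel[OF prod unit])
         (use ord(1) in \<open>simp add: mult.commute[of fps_X] mult.assoc[symmetric] mult_dvd_mono\<close>)
    have o2: "fps_X ^ Suc (Suc n) dvd expand u' v'" if "x3 = x0"
      by (rule dvd_unit_cancel[OF prod unit])
         (use ord(1) that in \<open>simp add: ser_lin mult.assoc[symmetric] mult_dvd_mono mult.commute\<close>)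
    have "poly (c ^ 2 - f) x3 = 0" unfolding line by simp
    moreover have "poly c x3 = y3" by (simp add: c_def y3_def)
    ultimately have on3: "y3 ^ 2 = poly f x3" by simp
    have "- C \<noteq> 0" using C by simp
    then show ?thesis unfolding sum miller_def point.case using on3 norm at3 o1 o2 by blast
  qed
qed

lemma miller_mult: "miller n (point_mult E n (Affine x0 y0))"
proof (induction n)
  case 0
  have "nrm 1 0 = smult 1 (lin x0 ^ 0)" by (simp add: nrm_def)
  then show ?case unfolding miller_def point_mult.simps point.case
    by (intro exI[of _ 1] exI[of _ 0]) auto
qed (simp add: miller_step)

text \<open>The hypotheses say that \<open>u + v y\<close> has divisor \<open>n (P) - n (O)\<close>:
  it vanishes at \<open>P\<close> but not at \<open>-P\<close>. Were \<open>n P\<close> affine,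
  dividing the Miller function by it would leave a polynomial pair whose norm is linear, against
  \<open>degree_nrm_ne_1\<close>.\<close>

lemma point_mult_eq_InfinityI:
  assumes C: "C \<noteq> 0" and uv: "nrm u v = smult C (lin x0 ^ n)"
    and at: "poly u x0 = - (y0 * poly v x0)" "poly v x0 \<noteq> 0"
  shows "point_mult E n (Affine x0 y0) = Infinity"
proof (rule ccontr)
  assume "point_mult E n (Affine x0 y0) \<noteq> Infinity"
  then obtain x y where "point_mult E n (Affine x0 y0) = Affine x y" by (metis point.exhaust)
  then obtain c d C' where C': "C' \<noteq> 0" and cd: "nrm c d = smult C' (lin x0 ^ n * lin x)"
    and ord_cd: "fps_X ^ n dvd expand c d"
    using miller_mult[of n] by (auto simp: miller_def)
  let ?t = "lin x0 ^ n"
  have ord_uv: "fps_X ^ n dvd expand u v"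
  proof (rule dvd_unit_cancel[OF expand_conj])
    have "fps_nth (expand u (- v)) 0 = - (2 * (y0 * poly v x0))"
      unfolding expand_nth_0 using at by simp
    then show "fps_nth (expand u (- v)) 0 \<noteq> 0" using two y0 at by simp
    show "fps_X ^ n dvd ser (nrm u v)"
      unfolding uv ser_smult ser_power ser_lin by simp
  qed
  \<comment> \<open>The components of \<open>(u + v y) (c - d y)\<close> are combinations of two
    series divisible by \<open>X^n\<close>, so \<open>(x - x0)^n\<close> can be divided out of the
    polynomials themselves.\<close>
  have 1: "ser (u * c - v * d * f) = expand c d * ser u - expand u v * (ser d * Y)"
    unfolding expand_def ser_diff ser_mult Y_sq[symmetric] by (simp only: algebra_simps)
  have 2: "ser (v * c - u * d) = expand c d * ser v - expand u v * ser d"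
    unfolding expand_def ser_diff ser_mult Y_sq[symmetric] by (simp only: algebra_simps)
  have "?t dvd u * c - v * d * f"
    by (rule X_power_dvd_ser, unfold 1) (intro dvd_diff dvd_mult2 ord_cd ord_uv)
  moreover have "?t dvd v * c - u * d"
    by (rule X_power_dvd_ser, unfold 2) (intro dvd_diff dvd_mult2 ord_cd ord_uv)
  ultimately obtain r s where r: "u * c - v * d * f = ?t * r" and s: "v * c - u * d = ?t * s"
    by (auto elim!: dvdE)
  have "?t ^ 2 * nrm r s = nrm (u * c + v * (- d) * f) (u * (- d) + v * c)"
  proof -
    have "u * c + v * (- d) * f = ?t * r" "u * (- d) + v * c = ?t * s"
      using r s by (simp_all add: algebra_simps)
    then show ?thesis by (simp only: nrm_scale)
  qed
  also have "\<dots> = nrm u v * nrm c d" unfolding nrm_mult by (simp add: nrm_def)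
  also have "\<dots> = ?t ^ 2 * smult (C * C') (lin x)"
    unfolding uv cd power2_eq_square by (simp only: mult_smult_left mult_smult_right smult_smult ac_simps)
  finally have "nrm r s = smult (C * C') (lin x)"
    by (metis mult_cancel_left power_not_zero lin_nz)
  then have "degree (nrm r s) = 1" using C C' by simp
  then show False using degree_nrm_ne_1 by blast
qed

end

lemma smult_numeral: "smult (numeral n) u = numeral n * (u :: 'a::comm_ring_1 poly)"
  by (simp add: numeral_poly)

text \<open>Coprimality is expressed through roots, so the roots of \<open>v\<close> can be removed
  one at a time.\<close>

lemma alg_closed_dvd_cancel:
  fixes u v w :: "'a::alg_closed_field poly"
  assumes "v dvd u * w" "\<And>e. poly v e = 0 \<Longrightarrow> poly u e \<noteq> 0" "v \<noteq> 0"
  shows "v dvd w"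
  using assms
proof (induction "degree v" arbitrary: v w)
  case 0
  then show ?case by (metis degree_eq_zeroE is_unit_iff_degree unit_imp_dvd)
next
  case (Suc n)
  then obtain e where e: "poly v e = 0" using alg_closed_imp_poly_has_root[of v] by auto
  then have "lin e dvd u * w" using Suc.prems(1) lin_dvd_iff dvd_trans by metis
  then have "poly w e = 0" using Suc.prems(2)[OF e] by (simp add: lin_dvd_iff)
  then obtain v' w' where *: "v = lin e * v'" "w = lin e * w'" using e by (metis lin_dvd_iff dvdE)
  have "lin e * v' dvd lin e * (u * w')" using Suc.prems(1) by (simp add: * ac_simps)
  then have "v' dvd u * w'" by simp
  moreover have "v' \<noteq> 0" using Suc.prems(3) * by auto
  moreover have "n = degree v'" using Suc.hyps(2) \<open>v' \<noteq> 0\<close> by (simp add: * degree_mult_eq)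
  ultimately have "v' dvd w'" using Suc.hyps(1)[of v' w'] Suc.prems(2) by (simp add: *)
  then show ?case by (simp add: *)
qed

context short_curve_point
begin

lemma point_mult_add:
  assumes "point_mult E n P = Infinity"
  shows "point_mult E (n + k) P = point_mult E k P"
  by (induction k) (simp_all add: assms)

lemma point_mult_times:
  assumes "point_mult E n P = Infinity"
  shows "point_mult E (n * k) P = Infinity"
  by (induction k) (simp_all add: point_mult_add[OF assms])

text \<open>If \<open>0 < m < p\<close>, Bezout gives \<open>m x = p y + 1\<close>, and the point
  itself would be \<open>Infinity\<close>.\<close>

lemma point_mult_p_minimal:
  assumes "point_mult E p (Affine x0 y0) = Infinity" "point_mult E m (Affine x0 y0) = Infinity"
    and "0 < m" "m \<le> p"
  shows "m = p"
proof (rule ccontr)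
  assume "m \<noteq> p"
  then have "\<not> p dvd m" using assms by (auto dest: dvd_imp_le)
  then have "coprime m p" using p_prime by (metis prime_imp_coprime_nat coprime_commute)
  then obtain x y where "m * x = p * y + 1"
    using coprime_bezout_strong[of m p] p_ge_5 by auto
  then have "point_mult E (p * y + 1) (Affine x0 y0) = Infinity"
    using point_mult_times[OF assms(2), of x] by simp
  then show False using point_mult_add[OF point_mult_times[OF assms(1)], of y 1] by simp
qed

end

section \<open>Norm equations and points of order p\<close>

context short_curve
begin

text \<open>Dividing by \<open>x - x0\<close> removes pairs \<open>(P) + (-P)\<close> from the
  divisor. Oddness of \<open>n\<close> is preserved and \<open>n = 1\<close> cannot occur while
  \<open>v\<close> vanishes at \<open>x0\<close>, so the process stops with all zeros at only one of
  the two points above \<open>x0\<close>.\<close>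

lemma nrm_reduce:
  assumes "C \<noteq> 0" "nrm u v = smult C (lin x0 ^ n)" "odd n"
  obtains j m u1 v1 where "n = m + 2 * j" "odd m" "u = lin x0 ^ j * u1" "v = lin x0 ^ j * v1"
    "nrm u1 v1 = smult C (lin x0 ^ m)" "poly v1 x0 \<noteq> 0"
proof -
  have "\<exists>j m u1 v1. n = m + 2 * j \<and> odd m \<and> u = lin x0 ^ j * u1 \<and> v = lin x0 ^ j * v1
      \<and> nrm u1 v1 = smult C (lin x0 ^ m) \<and> poly v1 x0 \<noteq> 0"
    using assms
  proof (induction n arbitrary: u v rule: less_induct)
    case (less n)
    show ?case
    proof (cases "poly v x0 = 0")
      case False
      then show ?thesis using less.prems
        by (intro exI[of _ 0] exI[of _ n] exI[of _ u] exI[of _ v]) simp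
    next
      case True
      have "n \<noteq> 0" using less.prems by (cases n) auto
      then have "poly (nrm u v) x0 = 0" using less.prems by (simp add: poly_power)
      then have "poly u x0 = 0" using True by (simp add: nrm_def)
      then obtain u2 v2 where uv: "u = lin x0 * u2" "v = lin x0 * v2"
        using True by (metis lin_dvd_iff dvdE)
      have eq: "lin x0 ^ 2 * nrm u2 v2 = smult C (lin x0 ^ n)"
        using less.prems by (simp only: uv nrm_scale)
      have "n \<noteq> 1"
        using degree_nrm_ne_1[of u v] less.prems by auto
      then obtain k where k: "n = k + 2" "odd k" using less.prems(3) \<open>n \<noteq> 0\<close>
        by (metis add_2_eq_Suc' even_Suc nat.exhaust One_nat_def)
      have "lin x0 ^ 2 * nrm u2 v2 = lin x0 ^ 2 * smult C (lin x0 ^ k)"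
        using eq by (simp add: k power_add power2_eq_square ac_simps)
      then have "nrm u2 v2 = smult C (lin x0 ^ k)" by (metis lin_nz mult_cancel_left power_not_zero)
      then obtain j m u1 v1 where "k = m + 2 * j" "odd m" "u2 = lin x0 ^ j * u1"
        "v2 = lin x0 ^ j * v1" "nrm u1 v1 = smult C (lin x0 ^ m)" "poly v1 x0 \<noteq> 0"
        using less.IH[of k u2 v2] k assms(1) by auto
      then show ?thesis
        by (intro exI[of _ "Suc j"] exI[of _ m] exI[of _ u1] exI[of _ v1])
           (simp add: k uv mult.assoc)
    qed
  qed
  then show ?thesis using that by blast
qed

text \<open>The second claim says that the point above \<open>x0\<close> is not 2-torsion: if
  \<open>u\<close> and hence \<open>f\<close> vanished at \<open>x0\<close>, the norm would have the
  derivative \<open>- f'(x0) v(x0)^2\<close>, which is nonzero, although its order there is at least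
  2.\<close>

lemma nrm_root:
  assumes "nrm u v = smult C (lin x0 ^ n)" "odd n" "poly v x0 \<noteq> 0"
  shows "poly u x0 ^ 2 = poly f x0 * poly v x0 ^ 2" "poly u x0 \<noteq> 0"
proof -
  have "n \<noteq> 0" using assms by (cases n) auto
  then have 0: "poly (nrm u v) x0 = 0" using assms by (simp add: poly_power)
  then show 1: "poly u x0 ^ 2 = poly f x0 * poly v x0 ^ 2" by (simp add: nrm_def)
  show "poly u x0 \<noteq> 0"
  proof
    assume u0: "poly u x0 = 0"
    then have f0: "poly f x0 = 0" using 1 assms by simp
    have "n \<noteq> 1"
    proof
      assume "n = 1"
      show False
      proof (cases "C = 0")
        case True
        then have "nrm u v = 0" using assms by simp
        then have "degree (nrm u v) = 0" by simp
        moreover have "v \<noteq> 0" using assms by auto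
        ultimately show False using degree_nrm(1)[of v u] by simp
      next
        case False
        then show False using degree_nrm_ne_1[of u v] assms \<open>n = 1\<close> by simp
      qed
    qed
    then obtain k where k: "n = Suc (Suc k)" using \<open>n \<noteq> 0\<close> by (metis nat.exhaust One_nat_def)
    have "poly (pderiv (nrm u v)) x0 = 0"
      unfolding assms(1) k by (simp add: pderiv_smult pderiv_mult)
    moreover have "poly (pderiv (nrm u v)) x0 = - (poly (pderiv f) x0 * poly v x0 ^ 2)"
      unfolding nrm_def power2_eq_square by (simp add: pderiv_diff pderiv_mult u0 f0)
    ultimately show False using f_simple_root[OF f0] assms by simp
  qed
qed

lemma curve_point:
  assumes "y0 ^ 2 = poly f x0" "y0 \<noteq> 0"
  obtains Y where "short_curve_point a b p x0 y0 Y"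
proof -
  have "\<exists>Y. Y ^ 2 = fps_of_poly (pcompose f [:x0, 1:]) \<and> fps_nth Y 0 = y0"
    by (rule fps_sqrt_exists[OF two]) (simp_all add: assms coeff_pcompose_0)
  then show ?thesis using that assms short_curve_axioms
    by (auto simp: short_curve_point_def short_curve_point_axioms_def)
qed

text \<open>The sign in \<open>y0\<close> selects the point above \<open>x0\<close> at which
  \<open>u + v y\<close> vanishes.\<close>

lemma nrm_imp_torsion:
  assumes "C \<noteq> 0" "nrm u v = smult C (lin x0 ^ n)" "odd n" "poly v x0 \<noteq> 0"
  defines "y0 \<equiv> - poly u x0 / poly v x0"
  shows "on_curve E (Affine x0 y0)" "point_mult E n (Affine x0 y0) = Infinity"
proof -
  note r = nrm_root[OF assms(2-4)]
  have y: "y0 ^ 2 = poly f x0" using r assms(4) by (simp add: y0_def field_simps)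
  then show "on_curve E (Affine x0 y0)" by (simp only: on_curve_E)
  have y0: "y0 \<noteq> 0" using r assms(4) by (simp add: y0_def)
  obtain Y where "short_curve_point a b p x0 y0 Y" using curve_point[OF y y0] .
  then interpret short_curve_point a b p x0 y0 Y .
  show "point_mult E n (Affine x0 y0) = Infinity"
    by (rule point_mult_eq_InfinityI[OF assms(1,2)]) (use assms(4) in \<open>simp_all add: y0_def\<close>)
qed

lemma torsion_imp_nrm:
  assumes "on_curve E P" "P \<noteq> Infinity" "point_mult E p P = Infinity"
  shows "\<exists>x0 u v C. C \<noteq> 0 \<and> nrm u v = smult C (lin x0 ^ p) \<and> poly v x0 \<noteq> 0"
proof -
  obtain x0 y0 where Pxy: "P = Affine x0 y0" using assms(2) by (cases P) auto
  then have y: "y0 ^ 2 = poly f x0" using assms(1) by (simp only: Pxy on_curve_E)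
  have y0: "y0 \<noteq> 0"
  proof
    assume "y0 = 0"
    \<comment> \<open>A point with \<open>y0 = 0\<close> has order two, so its odd multiple
      \<open>p P\<close> would be \<open>P\<close> again.\<close>
    then have "point_add E P P = Infinity" by (simp add: Pxy E_def)
    then have "point_mult E (2 * k) P = Infinity \<and> point_mult E (Suc (2 * k)) P = P" for k
      by (induction k) simp_all
    then show False using p_odd assms(2,3) by (metis oddE Suc_eq_plus1)
  qed
  obtain Y where "short_curve_point a b p x0 y0 Y" using curve_point[OF y y0] .
  then interpret short_curve_point a b p x0 y0 Y .
  obtain u v C where C: "C \<noteq> 0" and uv: "nrm u v = smult C (lin x0 ^ p)"
    and ord: "fps_X ^ p dvd expand u v"
    using miller_mult[of p] assms(3)[unfolded Pxy] by (auto simp: miller_def)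
  obtain j m u1 v1 where r: "p = m + 2 * j" "odd m" "u = lin x0 ^ j * u1" "v = lin x0 ^ j * v1"
    "nrm u1 v1 = smult C (lin x0 ^ m)" "poly v1 x0 \<noteq> 0"
    using nrm_reduce[OF C uv p_odd] .
  have "expand u v = fps_X ^ j * expand u1 v1"
    by (simp add: expand_def r ser_mult ser_power ser_lin algebra_simps)
  \<comment> \<open>As \<open>p = m + 2 j\<close> with \<open>m\<close> odd, a zero of order
    \<open>p\<close> leaves at least one zero at \<open>P\<close> after dividing by
    \<open>(x - x0)^j\<close>. Then \<open>m P = O\<close>, and minimality of \<open>p\<close>
    forces \<open>m = p\<close>.\<close>
  moreover have "fps_X ^ j * fps_X dvd (fps_X ^ p :: 'a fps)"
    unfolding r power_Suc2[symmetric] by (rule le_imp_power_dvd) (use r in presburger)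
  ultimately have "fps_X ^ j * fps_X dvd fps_X ^ j * expand u1 v1" using ord dvd_trans by metis
  then have "fps_X dvd expand u1 v1" by simp
  then have "fps_nth (expand u1 v1) 0 = 0" by (auto elim!: dvdE)
  then have "poly u1 x0 = - (y0 * poly v1 x0)"
    by (simp add: expand_nth_0 eq_neg_iff_add_eq_0 mult.commute)
  then have "point_mult E m (Affine x0 y0) = Infinity"
    using point_mult_eq_InfinityI[OF C r(5) _ r(6)] by simp
  then have "m = p"
    using point_mult_p_minimal[of m] assms(3)[unfolded Pxy] r(1,2) by (cases m) auto
  then show ?thesis using C r by blast
qed

text \<open>Four times the square of the derivation \<open>y d/dx\<close> on functions of x
  alone.\<close>

definition opM :: "'a poly \<Rightarrow> 'a poly" where
  "opM u = smult 4 (f * pderiv (pderiv u)) + smult 2 (pderiv f * pderiv u)"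

lemma of_nat_p [simp]: "(of_nat p :: 'a) = 0"
  using char by (simp add: of_nat_eq_0_iff_char_dvd)

lemma frobenius_diff: "(x - y) ^ p = x ^ p - (y::'a) ^ p"
proof -
  have "(x - y + y) ^ p = (x - y) ^ p + y ^ p"
    by (rule freshmans_dream) (use char p_prime in auto)
  then show ?thesis by simp
qed

text \<open>Only exponents divisible by \<open>p\<close> survive, and below \<open>2 * p\<close>
  these are 0 and \<open>p\<close>.\<close>

lemma pderiv_0_imp:
  fixes G :: "'a poly"
  assumes "pderiv G = 0" "degree G < 2 * p"
  shows "G = [:coeff G 0:] + monom (coeff G p) p"
proof (rule poly_eqI)
  fix n
  have "coeff G n = 0" if "0 < n" "n \<noteq> p"
  proof (cases "n < 2 * p")
    case True
    have "\<not> p dvd n"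
    proof
      assume "p dvd n"
      then obtain k where "n = p * k" by auto
      then show False using that True by (cases k; cases "k - 1") auto
    qed
    then have "(of_nat n :: 'a) \<noteq> 0" using char by (simp add: of_nat_eq_0_iff_char_dvd)
    moreover have "coeff (pderiv G) (n - 1) = of_nat n * coeff G n"
      using that by (simp add: coeff_pderiv)
    ultimately show ?thesis using assms by simp
  qed (use assms in \<open>simp add: coeff_eq_0\<close>)
  then show "coeff G n = coeff ([:coeff G 0:] + monom (coeff G p) p) n"
    using p_ge_5 by (auto simp: coeff_pCons split: nat.splits)
qed

lemma f_two_roots: obtains e1 e2 where "poly f e1 = 0" "poly f e2 = 0" "e1 \<noteq> e2"
proof -
  obtain e1 where e1: "poly f e1 = 0" using alg_closed_imp_poly_has_root[of f] degree_f by auto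
  then obtain g where g: "f = lin e1 * g" by (metis lin_dvd_iff dvdE)
  then have "degree g = 2" using degree_f f_nz by (auto simp: degree_mult_eq)
  then obtain e2 where e2: "poly g e2 = 0" using alg_closed_imp_poly_has_root[of g] by auto
  have "e1 \<noteq> e2"
  proof
    assume "e1 = e2"
    then have "poly (pderiv f) e1 = 0" using e2 by (simp add: g pderiv_mult)
    then show False using f_simple_root e1 by blast
  qed
  then show ?thesis using that[of e1 e2] e1 e2 by (simp add: g)
qed

text \<open>By the degree bound \<open>f * w^2\<close> would have the form
  \<open>C0 + C1 x^p\<close>, which by the Frobenius identity has at most one root unless it is
  zero; but \<open>f\<close> has two distinct roots.\<close>

lemma pderiv_f_square_0_imp:
  assumes "pderiv (f * w ^ 2) = 0" "2 * degree w + 3 \<le> p" shows "w = 0"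
proof (rule ccontr)
  assume w: "w \<noteq> 0"
  let ?G = "f * w ^ 2"
  have "degree ?G = 2 * degree w + 3"
    using w by (simp add: degree_mult_eq f_nz degree_f power2_eq_square)
  then have G: "?G = [:coeff ?G 0:] + monom (coeff ?G p) p"
    using assms p_ge_5 by (intro pderiv_0_imp) auto
  obtain e1 e2 where e: "poly f e1 = 0" "poly f e2 = 0" "e1 \<noteq> e2" by (rule f_two_roots)
  have ev: "poly ?G e = coeff ?G 0 + coeff ?G p * e ^ p" for e
    by (subst G) (simp add: poly_monom)
  have 1: "coeff ?G 0 + coeff ?G p * e1 ^ p = 0" "coeff ?G 0 + coeff ?G p * e2 ^ p = 0"
    using ev[of e1] ev[of e2] e by simp_all
  then have "coeff ?G p * e1 ^ p = coeff ?G p * e2 ^ p" by (metis add_left_cancel)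
  then have "coeff ?G p * (e1 - e2) ^ p = 0" unfolding frobenius_diff by (simp add: right_diff_distrib)
  then have "coeff ?G p = 0" using e by simp
  then have "?G = 0" using 1 G by simp
  then show False using w f_nz by simp
qed

text \<open>Differentiating the norm gives \<open>2 u u' = v (f' v + 2 f v')\<close>. Since
  \<open>v\<close> is coprime to \<open>u\<close>, it divides \<open>u'\<close>, and the degrees
  (\<open>2 deg v + 3 = p\<close>, \<open>2 deg u < p\<close>) make the quotient a constant
  \<open>q\<close>. Substituting back gives the eigenvalue \<open>4 q^2\<close>;
  \<open>q = 0\<close> would make \<open>f v^2\<close> a polynomial with zero derivative.\<close>

lemma nrm_imp_eigenvector:
  assumes C: "C \<noteq> 0" and uv: "nrm u v = smult C (lin x0 ^ p)" and v0: "poly v x0 \<noteq> 0"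
  shows "\<exists>l. l \<noteq> 0 \<and> u \<noteq> 0 \<and> opM u = smult l u"
proof -
  have v: "v \<noteq> 0" using v0 by auto
  have "degree (nrm u v) = p" using C by (simp add: uv degree_power_eq)
  then have deg: "2 * degree v + 3 = p" "2 * degree u < p"
    using degree_nrm(1)[OF v, of u] p_odd unfolding max_def by presburger+
  have cop: "poly u e \<noteq> 0" if "poly v e = 0" for e
  proof
    assume "poly u e = 0"
    then have "C * (e - x0) ^ p = 0"
      using that arg_cong[OF uv, of "\<lambda>g. poly g e"] by (simp add: nrm_def poly_power)
    then show False using C v0 that by auto
  qed
  have "pderiv (nrm u v) = 0"
    by (simp add: uv pderiv_smult pderiv_power)
  then have d: "smult 2 (u * pderiv u) = v * (pderiv f * v + smult 2 (f * pderiv v))"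
    unfolding nrm_def power2_eq_square smult_numeral
    by (simp add: pderiv_diff pderiv_mult algebra_simps)
  then have "v dvd u * pderiv u" using two by (metis dvd_triv_left dvd_smult_cancel)
  then have "v dvd pderiv u" using alg_closed_dvd_cancel[OF _ cop v] by blast
  then obtain w where w: "pderiv u = v * w" by (rule dvdE)
  have "degree w = 0"
  proof (cases "pderiv u = 0")
    case True
    then show ?thesis using w v by simp
  next
    case False
    then have "degree (pderiv u) = degree v + degree w" using w by (auto simp: degree_mult_eq)
    moreover have "degree (pderiv u) \<le> degree u - 1" by (rule degree_pderiv_le)
    ultimately show ?thesis using deg by linarith
  qed
  then obtain q where q: "w = [:q:]" by (metis degree_eq_zeroE)
  have u': "pderiv u = smult q v" using w q by simp
  have "v * smult (2 * q) u = v * (pderiv f * v + smult 2 (f * pderiv v))"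
    using d by (simp add: u' ac_simps)
  then have main: "pderiv f * v + smult 2 (f * pderiv v) = smult (2 * q) u"
    using v by (metis mult_cancel_left)
  have "opM u = smult (2 * q) (pderiv f * v + smult 2 (f * pderiv v))"
    unfolding opM_def u' by (simp add: pderiv_smult smult_add_right ac_simps)
  then have eig: "opM u = smult (4 * q ^ 2) u" unfolding main by (simp add: power2_eq_square)
  have "q \<noteq> 0"
  proof
    assume "q = 0"
    then have "pderiv f * v + smult 2 (f * pderiv v) = 0" using main by simp
    then have "v * (pderiv f * v + smult 2 (f * pderiv v)) = 0" by simp
    then have "pderiv (f * v ^ 2) = 0"
      by (simp add: pderiv_mult power2_eq_square smult_numeral algebra_simps)
    then show False using pderiv_f_square_0_imp v deg by simp
  qed
  moreover have "u \<noteq> 0" using nrm_root(2)[OF uv p_odd v0] by auto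
  moreover have "(4::'a) \<noteq> 0" using of_nat_nz[of 4] p_ge_5 by simp
  ultimately show ?thesis using eig by (intro exI[of _ "4 * q ^ 2"]) simp
qed

end

section \<open>The invariant derivation in characteristic p\<close>

lemma derivation_funpow_mult:
  fixes d :: "'r::comm_ring_1 \<Rightarrow> 'r"
  assumes add: "\<And>x y. d (x + y) = d x + d y" and mult: "\<And>x y. d (x * y) = d x * y + x * d y"
  shows "(d ^^ n) (x * y) = (\<Sum>k\<le>n. of_nat (n choose k) * (d ^^ k) x * (d ^^ (n - k)) y)"
proof (induction n)
  case (Suc n)
  have d0: "d 0 = 0" using add[of 0 0] by simp
  have dsum: "d (sum g A) = (\<Sum>i\<in>A. d (g i))" for g :: "nat \<Rightarrow> 'r" and A
    by (induction A rule: infinite_finite_induct) (simp_all add: d0 add)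
  have d1: "d 1 = 0" using mult[of 1 1] by simp
  have dn: "d (of_nat m) = 0" for m by (induction m) (simp_all add: d0 d1 add)
  let ?A = "\<lambda>k. (d ^^ k) x" and ?B = "\<lambda>k. (d ^^ k) y"
  have "(d ^^ Suc n) (x * y)
      = (\<Sum>k\<le>n. of_nat (n choose k) * ?A (Suc k) * ?B (n - k))
        + (\<Sum>k\<le>n. of_nat (n choose k) * ?A k * ?B (Suc (n - k)))"
    by (simp add: Suc.IH dsum mult dn algebra_simps sum.distrib)
  also have "(\<Sum>k\<le>n. of_nat (n choose k) * ?A k * ?B (Suc (n - k)))
      = (\<Sum>k\<le>Suc n. of_nat (n choose k) * ?A k * ?B (Suc n - k))"
    by (simp add: Suc_diff_le binomial_eq_0)
  also have "\<dots> = ?A 0 * ?B (Suc n) + (\<Sum>k\<le>n. of_nat (n choose Suc k) * ?A (Suc k) * ?B (n - k))"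
    by (subst sum.atMost_Suc_shift) simp
  also have "(\<Sum>k\<le>n. of_nat (n choose k) * ?A (Suc k) * ?B (n - k)) + \<dots>
      = ?A 0 * ?B (Suc n) + (\<Sum>k\<le>n. of_nat (Suc n choose Suc k) * ?A (Suc k) * ?B (n - k))"
    by (simp add: algebra_simps sum.distrib)
  also have "\<dots> = (\<Sum>k\<le>Suc n. of_nat (Suc n choose k) * ?A k * ?B (Suc n - k))"
    by (subst sum.atMost_Suc_shift) simp
  finally show ?case .
qed simp

context short_curve
begin

definition "N = (p - 1) div 2"

lemma p_N: "p = 2 * N + 1" using p_odd by (auto simp: N_def elim!: oddE)

lemma N_ge_2: "N \<ge> 2" using p_N p_ge_5 by simp

lemma of_nat_N: "2 * (of_nat N :: 'a) + 1 = 0"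
proof -
  have "(of_nat (2 * N + 1) :: 'a) = 0" by (simp only: p_N[symmetric] of_nat_p)
  then show ?thesis by (simp add: add.commute)
qed

end

context short_curve_point
begin

text \<open>
  \<open>dlt\<close> is the invariant derivation \<open>y d/dx\<close>. In characteristic \<open>p\<close> its \<open>p\<close>-th
  iterate is again an invariant derivation, hence a constant multiple of \<open>dlt\<close>.
\<close>

definition dlt :: "'a fps \<Rightarrow> 'a fps" where "dlt A = Y * fps_deriv A"

lemma fps_deriv_ser: "fps_deriv (ser u) = ser (pderiv u)"
  by (simp add: ser_def fps_of_poly_pderiv[symmetric] pderiv_pcompose pderiv_pCons)

lemma ser_const: "ser [:c:] = fps_const c"
  by (simp add: ser_def fps_of_poly_const)

lemma ser_eq_0_iff: "ser u = 0 \<longleftrightarrow> u = 0"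
proof
  assume *: "ser u = 0"
  have "coeff (pcompose u [:x0, 1:]) n = 0" for n
    using arg_cong[OF *, of "\<lambda>A. fps_nth A n"] by (simp add: ser_def)
  then have "pcompose u [:x0, 1:] = 0" by (simp add: poly_eqI)
  then show "u = 0" by (rule pcompose_eq_0) simp
qed (simp add: ser_def)

lemma dlt_ser: "dlt (ser u) = Y * ser (pderiv u)"
  by (simp add: dlt_def fps_deriv_ser)

lemma Y_nz: "Y \<noteq> 0" using Y y0 by auto

lemma two_Y_deriv: "2 * (Y * fps_deriv Y) = ser (pderiv f)"
  using arg_cong[OF Y_sq, of fps_deriv] by (simp add: fps_deriv_ser algebra_simps)

lemma half: "fps_const (1/2) * (2 * A) = (A :: 'a fps)"
proof -
  have "fps_const (1/2) * (2 * A) = fps_const (1/2 * 2) * A"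
    unfolding fps_const_mult[symmetric] by (simp add: mult.assoc fps_numeral_fps_const)
  then show ?thesis using two by simp
qed

lemma dlt_Y_mult: "dlt (Y * ser u) = ser (smult (1/2) (pderiv f * u) + f * pderiv u)"
proof -
  have "dlt (Y * ser u) = (Y * fps_deriv Y) * ser u + (Y * Y) * ser (pderiv u)"
    by (simp add: dlt_def fps_deriv_ser algebra_simps)
  moreover have "Y * fps_deriv Y = fps_const (1/2) * ser (pderiv f)"
    using half[of "Y * fps_deriv Y"] by (simp only: two_Y_deriv)
  ultimately show ?thesis by (simp add: Y_sq ser_add ser_smult ser_mult mult.assoc)
qed

lemma dlt_dlt_ser: "dlt (dlt (ser u)) = fps_const (1/4) * ser (opM u)"
proof -
  have four: "(4::'a) \<noteq> 0" using of_nat_nz[of 4] p_ge_5 by simp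
  have "smult (1/4) (opM u) = smult (1/2) (pderiv f * pderiv u) + f * pderiv (pderiv u)"
  proof -
    have e: "1 / 4 * 4 = (1::'a)" "1 / 4 * 2 = (1 / 2 :: 'a)"
      using four two by (simp_all add: field_simps)
    show ?thesis unfolding opM_def smult_add_right smult_smult e by (simp add: add.commute)
  qed
  then show ?thesis by (simp add: dlt_ser dlt_Y_mult flip: ser_smult)
qed

lemma dlt_dlt_Y_mult:
  "dlt (dlt (Y * ser u)) = Y * ser (pderiv (smult (1/2) (pderiv f * u) + f * pderiv u))"
  by (simp only: dlt_Y_mult dlt_ser)

lemma dlt_add: "dlt (A + B) = dlt A + dlt B"
  by (simp add: dlt_def algebra_simps)

lemma dlt_mult: "dlt (A * B) = dlt A * B + A * dlt B"
  by (simp add: dlt_def algebra_simps)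

lemma dlt_const_mult: "dlt (fps_const c * A) = fps_const c * dlt A"
  by (simp add: dlt_def algebra_simps)

text \<open>In Leibniz's formula the inner binomial coefficients are divisible by \<open>p\<close>:
  the \<open>p\<close>-th iterate is again a derivation.\<close>

lemma dlt_p_mult: "(dlt ^^ p) (A * B) = (dlt ^^ p) A * B + A * (dlt ^^ p) B"
proof -
  have z: "(of_nat (p choose k) :: 'a fps) = 0" if "0 < k" "k < p" for k
  proof -
    have "p dvd (p choose k)" using that p_prime by (intro dvd_choose_prime) auto
    then have "(of_nat (p choose k) :: 'a) = 0" using char by (simp add: of_nat_eq_0_iff_char_dvd)
    then show ?thesis by (metis fps_const_0_eq_0 fps_of_nat)
  qed
  have "(dlt ^^ p) (A * B) = (\<Sum>k\<le>p. of_nat (p choose k) * (dlt ^^ k) A * (dlt ^^ (p - k)) B)"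
    by (rule derivation_funpow_mult) (simp_all add: dlt_add dlt_mult)
  also have "\<dots> = (\<Sum>k\<in>{0,p}. of_nat (p choose k) * (dlt ^^ k) A * (dlt ^^ (p - k)) B)"
    by (rule sum.mono_neutral_right) (auto simp: z)
  also have "\<dots> = (dlt ^^ p) A * B + A * (dlt ^^ p) B" using p_ge_5 by simp
  finally show ?thesis .
qed

lemma dlt_p_add: "(dlt ^^ n) (A + B) = (dlt ^^ n) A + (dlt ^^ n) B"
  by (induction n) (simp_all add: dlt_add)

lemma dlt_p_const: "(dlt ^^ p) (fps_const c) = 0"
proof -
  have z: "(dlt ^^ n) 0 = 0" for n by (induction n) (simp_all add: dlt_def)
  have "(dlt ^^ Suc n) (fps_const c) = 0" for n
    unfolding funpow_Suc_right by (simp add: dlt_def[of "fps_const c"] z)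
  from this[of "p - 1"] show ?thesis using p_ge_5 by simp
qed

text \<open>A derivation on polynomials is determined by its value at x, here the polynomial
  \<open>[:0, 1:]\<close>.\<close>

lemma dlt_p_ser: "(dlt ^^ p) (ser u) = ser (pderiv u) * (dlt ^^ p) (ser [:0, 1:])"
proof (induction u)
  case 0
  then show ?case using dlt_p_const[of 0] by (simp add: ser_def)
next
  case (pCons c u)
  have "pCons c u = [:c:] + [:0, 1:] * u" by simp
  then have "ser (pCons c u) = fps_const c + ser [:0, 1:] * ser u"
    by (simp only: ser_add ser_mult ser_const)
  moreover have "ser (pderiv (pCons c u)) = ser u + ser [:0, 1:] * ser (pderiv u)"
    by (simp add: pderiv_pCons ser_add flip: ser_mult)
  ultimately show ?case
    by (simp add: dlt_p_add dlt_p_const dlt_p_mult pCons.IH algebra_simps)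
qed

lemma dlt_p_eq: "\<exists>h. \<forall>u. (dlt ^^ Suc p) (ser u) = fps_const h * dlt (dlt (ser u))"
proof -
  \<comment> \<open>The square of \<open>dlt\<close> sends \<open>y u\<close> to
    \<open>y (L u)\<close> and \<open>L\<close> raises the degree by at most one. Starting from
    \<open>dlt x = y\<close>, the \<open>p\<close>-th iterate of x is thus \<open>y r\<close> with
    \<open>degree r\<close> at most \<open>N < p\<close>.\<close>
  define L where "L u = pderiv (smult (1/2) (pderiv f * u) + f * pderiv u)" for u
  have df: "degree (pderiv f) \<le> 2" using degree_pderiv_le[of f] degree_f by simp
  have degL: "degree (L u) \<le> degree u + 1" for u
  proof -
    have "degree (smult (1/2) (pderiv f * u)) \<le> degree u + 2"
      using degree_mult_le[of "pderiv f" u] degree_smult_le[of "1/2" "pderiv f * u"] df by linarith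
    moreover have "degree (f * pderiv u) \<le> degree u + 2"
    proof (cases "pderiv u = 0")
      case False
      then have "degree u \<noteq> 0" by (metis degree_eq_zeroE pderiv_0 pderiv_pCons pderiv_singleton)
      then show ?thesis
        using degree_mult_le[of f "pderiv u"] degree_pderiv_le[of u] degree_f by linarith
    qed simp
    ultimately have "degree (smult (1/2) (pderiv f * u) + f * pderiv u) \<le> degree u + 2"
      by (rule degree_add_le)
    then show ?thesis unfolding L_def
      using degree_pderiv_le[of "smult (1/2) (pderiv f * u) + f * pderiv u"] by linarith
  qed
  define r where "r = (L ^^ N) 1"
  have LL: "dlt (dlt (Y * ser u)) = Y * ser (L u)" for u by (simp only: L_def dlt_dlt_Y_mult)
  have Lk: "(dlt ^^ (2 * k)) Y = Y * ser ((L ^^ k) 1) \<and> degree ((L ^^ k) 1) \<le> k" for k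
  proof (induction k)
    case (Suc k)
    then show ?case using degL[of "(L ^^ k) 1"] by (simp add: LL)
  qed (simp add: ser_def)
  have x: "dlt (ser [:0, 1:]) = Y" by (simp add: dlt_ser pderiv_pCons ser_const)
  have "(dlt ^^ p) (ser [:0, 1:]) = (dlt ^^ (2 * N)) (dlt (ser [:0, 1:]))"
  proof -
    have "Suc (2 * N) = p" using p_N by simp
    then have "(dlt ^^ p) A = (dlt ^^ Suc (2 * N)) A" for A by (rule subst) (rule refl)
    then show ?thesis by (simp only: funpow_Suc_right o_apply)
  qed
  then have Px: "(dlt ^^ p) (ser [:0, 1:]) = ser r * Y"
    using Lk[of N] by (simp add: x r_def mult.commute)
  have Pser: "(dlt ^^ p) (ser u) = ser r * dlt (ser u)" for u
    unfolding dlt_p_ser[of u] Px dlt_ser by (simp add: ac_simps)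
  \<comment> \<open>The action of the derivation on y is read off from
    \<open>y^2 = f\<close>.\<close>
  have "2 * Y * (dlt ^^ p) Y = (dlt ^^ p) (ser f)"
    by (simp add: dlt_p_mult flip: Y_sq)
  also have "\<dots> = ser r * dlt (Y * Y)" by (simp add: Pser Y_sq)
  also have "\<dots> = 2 * Y * (ser r * dlt Y)" by (simp add: dlt_mult)
  finally have YY: "2 * Y * (dlt ^^ p) Y = 2 * Y * (ser r * dlt Y)" .
  then have PY: "(dlt ^^ p) Y = ser r * dlt Y"
  proof -
    have "(2::'a fps) \<noteq> 0" using half[of 1] by auto
    then have "2 * Y \<noteq> 0" using Y_nz by simp
    then show ?thesis using YY unfolding mult_cancel_left by blast
  qed
  \<comment> \<open>The iterate commutes with \<open>dlt\<close>; evaluating both orders at x forces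
    \<open>dlt r = 0\<close>, so the low degree of \<open>r\<close> makes it constant.\<close>
  have "dlt (ser r * Y) = ser r * dlt Y"
    using PY funpow_swap1[of dlt p "ser [:0, 1:]"] by (simp add: x Px)
  then have "dlt (ser r) * Y = 0" by (simp add: dlt_mult)
  then have r': "pderiv r = 0" using Y_nz by (simp add: dlt_ser ser_eq_0_iff)
  have dr: "degree r < p" using Lk[of N] p_N by (simp add: r_def)
  then have "r = [:coeff r 0:]"
    using pderiv_0_imp[OF r'] by (simp add: coeff_eq_0)
  then obtain h where r: "r = [:h:]" by blast
  have "(dlt ^^ Suc p) (ser u) = fps_const h * dlt (dlt (ser u))" for u
    by (simp add: Pser r ser_const dlt_const_mult)
  then show ?thesis by blast
qed

lemma dlt_Suc_p: "(dlt ^^ Suc p) A = ((dlt \<circ> dlt) ^^ Suc N) A"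
proof -
  have "Suc p = 2 * Suc N" using p_N by simp
  moreover have "(dlt ^^ (2 * k)) A = ((dlt \<circ> dlt) ^^ k) A" for k
    by (induction k) simp_all
  ultimately show ?thesis by (simp only:)
qed

text \<open>The hypothesis on \<open>g\<close> reads \<open>dlt g = y f^N = y^p\<close>, a constant
  of the derivation, whence \<open>dlt (dlt (g^2)) = 2 f^p\<close>, which \<open>dlt\<close> kills.
  Applying \<open>dlt^(p+1) = h dlt^2\<close> to \<open>g^2\<close> yields \<open>h = 0\<close>. So
  \<open>dlt^(p+1)\<close> is zero on polynomials, whereas it multiplies an eigenvector by
  \<open>(l/4)^(N+1)\<close>.\<close>

lemma exact_no_eigenvector_aux:
  assumes "pderiv g = f ^ N" "opM u = smult l u" "u \<noteq> 0" shows "l = 0"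
proof (rule ccontr)
  assume l: "l \<noteq> 0"
  have four: "(4::'a) \<noteq> 0" using of_nat_nz[of 4] p_ge_5 by simp
  obtain h where h: "\<And>u. (dlt ^^ Suc p) (ser u) = fps_const h * dlt (dlt (ser u))"
    using dlt_p_eq by blast
  have "opM (g ^ 2) = smult 8 (f ^ p)"
  proof -
    have "f * pderiv (f ^ N) = smult (of_nat N) (f ^ N * pderiv f)"
    proof -
      have "f * pderiv (f ^ Suc k) = smult (of_nat (Suc k)) (f ^ Suc k * pderiv f)" for k
        unfolding pderiv_power_Suc by (simp add: ac_simps)
      from this[of "N - 1"] show ?thesis using N_ge_2 by simp
    qed
    then have 1: "f * pderiv (pderiv g) = smult (of_nat N) (f ^ N * pderiv f)" by (simp only: assms)
    have "opM (g ^ 2) = 8 * f * (f ^ N * f ^ N) + 8 * g * (f * pderiv (pderiv g)) + 4 * (pderiv f * g * f ^ N)"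
      unfolding opM_def smult_numeral power2_eq_square
      by (simp add: pderiv_mult pderiv_add assms algebra_simps)
    also have "8 * g * (f * pderiv (pderiv g)) = smult (4 * (2 * of_nat N)) (pderiv f * g * f ^ N)"
      unfolding 1 by (simp add: numeral_poly ac_simps)
    also have "4 * (2 * of_nat N) = (- 4 :: 'a)" using of_nat_N by Groebner_Basis.algebra
    also have "8 * f * (f ^ N * f ^ N) = 8 * f ^ p"
      unfolding arg_cong[OF p_N, of "(^) f"] mult_2 power_add by (simp add: ac_simps)
    finally show ?thesis by (simp add: numeral_poly)
  qed
  then have G: "dlt (dlt (ser (g ^ 2))) = fps_const 2 * ser (f ^ p)"
    using four by (simp add: dlt_dlt_ser ser_smult flip: mult.assoc)
  have "dlt (ser (f ^ p)) = 0" by (simp add: dlt_ser pderiv_power ser_eq_0_iff)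
  then have z: "dlt (fps_const 2 * ser (f ^ p)) = 0" by (simp add: dlt_const_mult)
  have z0: "dlt 0 = 0" by (simp add: dlt_def)
  have "((dlt \<circ> dlt) ^^ Suc k) (fps_const 2 * ser (f ^ p)) = 0" for k
    by (induction k) (simp_all add: z z0)
  from this[of "N - 1"] have "((dlt \<circ> dlt) ^^ Suc N) (ser (g ^ 2)) = 0"
    using N_ge_2 G by (simp add: funpow_Suc_right del: funpow.simps)
  then have "fps_const h * (fps_const 2 * ser (f ^ p)) = 0"
    using h[of "g ^ 2"] G dlt_Suc_p by simp
  then have "h = 0" using two f_nz by (simp add: ser_eq_0_iff)
  have e: "(dlt \<circ> dlt) (fps_const c * ser u) = fps_const (c * (l / 4)) * ser u" for c
  proof -
    have "(dlt \<circ> dlt) (fps_const c * ser u) = fps_const c * (fps_const (1/4) * (fps_const l * ser u))"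
      by (simp only: o_apply dlt_const_mult dlt_dlt_ser assms(2) ser_smult)
    also have "\<dots> = fps_const (c * (l / 4)) * ser u" by (simp add: mult.assoc[symmetric])
    finally show ?thesis .
  qed
  have "((dlt \<circ> dlt) ^^ k) (ser u) = fps_const ((l / 4) ^ k) * ser u" for k
  proof (induction k)
    case (Suc k)
    have "((dlt \<circ> dlt) ^^ Suc k) (ser u) = (dlt \<circ> dlt) (fps_const ((l / 4) ^ k) * ser u)"
      by (simp only: funpow.simps o_apply[of _ "_ ^^ _"] Suc.IH)
    then show ?case by (simp only: e power_Suc2)
  qed simp
  from this[of "Suc N"] have "fps_const ((l / 4) ^ Suc N) * ser u = 0"
    using h[of u] \<open>h = 0\<close> dlt_Suc_p by simp
  then show False using l four assms by (simp add: ser_eq_0_iff)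
qed

end

lemma lin_power_CHAR:
  fixes x :: "'a::idom"
  assumes "Factorial_Ring.prime CHAR('a)"
  shows "lin x ^ CHAR('a) = monom 1 CHAR('a) - [:x ^ CHAR('a):]"
proof -
  have "(lin x + [:x:]) ^ CHAR('a) = lin x ^ CHAR('a) + [:x:] ^ CHAR('a)"
    using assms by (intro freshmans_dream) simp_all
  moreover have "lin x + [:x:] = monom 1 1" by (simp add: lin_def monom_altdef)
  ultimately show ?thesis by (simp add: monom_power poly_const_pow algebra_simps)
qed

section \<open>The eigenvalue problem in degree at most \<open>N\<close>\<close>

context short_curve
begin

lemma exact_no_eigenvector:
  assumes "pderiv g = f ^ N" "opM u = smult l u" "u \<noteq> 0" shows "l = 0"
proof -
  \<comment> \<open>Any point with nonzero ordinate serves as centre of the expansions; one with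
    ordinate 1 exists.\<close>
  have "degree (f - 1) = 3" by (simp add: f_def one_pCons)
  then obtain r where "poly (f - 1) r = 0" using alg_closed_imp_poly_has_root[of "f - 1"] by auto
  then have "1 ^ 2 = poly f r" by simp
  then obtain Y where "short_curve_point a b p r 1 Y" by (rule curve_point) simp
  then interpret short_curve_point a b p r 1 Y .
  show ?thesis using exact_no_eigenvector_aux assms by blast
qed

lemma opM_add: "opM (u + v) = opM u + opM v"
  by (simp add: opM_def pderiv_add smult_add_right algebra_simps)

lemma opM_smult: "opM (smult c u) = smult c (opM u)"
  by (simp add: opM_def pderiv_smult smult_add_right mult.commute)

lemma opM_const: "opM [:c:] = 0"
  by (simp add: opM_def pderiv_pCons)

lemma opM_sum: "opM (sum g A) = (\<Sum>i\<in>A. opM (g i))"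
  using opM_const[of 0] by (induction A rule: infinite_finite_induct) (simp_all add: opM_add)

text \<open>\<open>opM\<close> raises the degree \<open>d\<close> by one and multiplies the leading
  coefficient by \<open>2 d (2 d + 1)\<close>. For \<open>d = N\<close> this is 0 because
  \<open>2 N + 1 = p\<close>, so polynomials of degree at most \<open>N\<close> form an invariant
  space.\<close>

lemma coeff_opM_high:
  assumes "\<And>k. k \<ge> n \<Longrightarrow> coeff w k = 0" "n \<ge> 1"
  shows "coeff (opM w) n = of_nat (2 * (n - 1) * (2 * n - 1)) * coeff w (n - 1)"
proof -
  have pf: "pderiv f = [:a, 0, 3:]" by (simp add: f_def pderiv_pCons)
  consider "n = Suc 0" | "n = Suc (Suc 0)" | k where "n = Suc (Suc (Suc k))"
    using assms(2) by (metis not0_implies_Suc not_one_le_zero)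
  then show ?thesis
  proof cases
    case 3
    then show ?thesis using assms(1)
      by (simp add: opM_def pf) (simp add: f_def coeff_pderiv algebra_simps)
  next
    case 1
    then show ?thesis using assms(1)
      by (simp add: opM_def pf) (simp add: f_def coeff_pderiv algebra_simps)
  next
    case 2
    then show ?thesis using assms(1)
      by (simp add: opM_def pf) (simp add: f_def coeff_pderiv algebra_simps)
  qed
qed

lemma no_exact_imp_eigenvector:
  assumes "\<nexists>g. pderiv g = f ^ N"
  shows "\<exists>u l. u \<noteq> 0 \<and> l \<noteq> 0 \<and> degree u \<le> N \<and> opM u = smult l u"
proof -
  \<comment> \<open>The matrix of \<open>opM\<close> on \<open>x, ..., x^N\<close> modulo constants.
    Removing the constants, which \<open>opM\<close> kills, keeps the eigenvector from being a
    constant.\<close>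
  define A where "A = mat N N (\<lambda>(i, j). coeff (opM (monom 1 (Suc j))) (Suc i))"
  have A: "A \<in> carrier_mat N N" by (simp add: A_def)
  have "degree (char_poly A) = N" using degree_monic_char_poly[OF A] by simp
  then obtain l where "poly (char_poly A) l = 0"
    using alg_closed_imp_poly_has_root[of "char_poly A"] N_ge_2 by auto
  then obtain w where "eigenvector A w l" using eigenvalue_root_char_poly[OF A] by (auto simp: eigenvalue_def)
  then have w: "w \<in> carrier_vec N" "w \<noteq> 0\<^sub>v N" "A *\<^sub>v w = l \<cdot>\<^sub>v w"
    using A by (auto simp: eigenvector_def)
  define u where "u = (\<Sum>j<N. smult (w $ j) (monom 1 (Suc j)))"
  have cu: "coeff u n = (if 1 \<le> n \<and> n \<le> N then w $ (n - 1) else 0)" for n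
  proof -
    have "coeff u n = (\<Sum>j<N. if j = n - 1 \<and> 1 \<le> n then w $ j else 0)"
      unfolding u_def coeff_sum by (intro sum.cong) auto
    also have "\<dots> = (\<Sum>j\<in>{..<N} \<inter> {j. j = n - 1 \<and> 1 \<le> n}. w $ j)"
      by (simp add: sum.inter_restrict)
    also have "{..<N} \<inter> {j. j = n - 1 \<and> 1 \<le> n} = (if 1 \<le> n \<and> n \<le> N then {n - 1} else {})" by auto
    finally show ?thesis by simp
  qed
  obtain i where i: "i < N" "w $ i \<noteq> 0" using w(1,2) by (metis carrier_vecD eq_vecI index_zero_vec)
  then have u0: "coeff u (Suc i) \<noteq> 0" by (simp add: cu)
  have du: "degree u \<le> N" by (rule degree_le) (simp add: cu)
  have "opM u = smult l u + [:coeff (opM u) 0:]"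
  proof (rule poly_eqI)
    fix n
    consider "n = 0" | k where "n = Suc k" "k < N" | "n = N + 1" | "n > N + 1"
      by (metis Suc_eq_plus1 linorder_neqE_nat not0_implies_Suc not_less_eq)
    then show "coeff (opM u) n = coeff (smult l u + [:coeff (opM u) 0:]) n"
    proof cases
      case 2
      have "coeff (opM u) n = (\<Sum>j<N. A $$ (k, j) * w $ j)"
        unfolding u_def opM_sum coeff_sum opM_smult using 2 by (simp add: A_def mult.commute)
      also have "\<dots> = (A *\<^sub>v w) $ k"
        using 2 A w(1) by (simp add: scalar_prod_def lessThan_atLeast0)
      also have "\<dots> = l * w $ k" using 2 w by simp
      finally show ?thesis using 2 by (simp add: cu)
    next
      case 3
      have "coeff (opM u) n = of_nat (2 * N * (2 * N + 1)) * coeff u N"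
        using coeff_opM_high[of n u] 3 by (simp add: cu)
      also have "of_nat (2 * N * (2 * N + 1)) = (0::'a)"
        by (simp only: of_nat_mult of_nat_add of_nat_numeral of_nat_1 of_nat_N mult_zero_right)
      finally show ?thesis using 3 by (simp add: cu)
    next
      case 4
      then show ?thesis using coeff_opM_high[of n u] by (simp add: cu coeff_pCons split: nat.splits)
    qed (simp add: cu)
  qed
  then obtain m where m: "opM u = smult l u + [:m:]" by blast
  have l: "l \<noteq> 0"
  proof
    assume "l = 0"
    then have M: "opM u = [:m:]" using m by simp
    have "m = 0"
    proof (rule ccontr)
      assume m0: "m \<noteq> 0"
      \<comment> \<open>Since \<open>4 (N + 1) = 2\<close> modulo \<open>p\<close>,
        \<open>4 f^(N+1) u'\<close> is an antiderivative of \<open>f^N * opM u\<close>; with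
        \<open>opM u\<close> a nonzero constant this would integrate \<open>f^N\<close>.\<close>
      have "pderiv (f ^ Suc N * pderiv u)
          = f ^ N * (smult (of_nat (Suc N)) (pderiv f * pderiv u) + f * pderiv (pderiv u))"
        unfolding pderiv_mult pderiv_power_Suc by (simp add: algebra_simps)
      then have "pderiv (smult 4 (f ^ Suc N * pderiv u))
          = f ^ N * (smult (4 * of_nat (Suc N)) (pderiv f * pderiv u) + smult 4 (f * pderiv (pderiv u)))"
        by (simp only: pderiv_smult) (simp only: mult_smult_right[symmetric] smult_add_right smult_smult)
      also have "4 * of_nat (Suc N) = (2::'a)" using of_nat_N by (simp, Groebner_Basis.algebra)
      finally have "pderiv (smult 4 (f ^ Suc N * pderiv u)) = f ^ N * opM u"
        by (simp only: opM_def add.commute)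
      then have "pderiv (smult (1 / m) (smult 4 (f ^ Suc N * pderiv u))) = f ^ N"
        using m0 by (simp only: pderiv_smult M) simp
      then show False using assms by blast
    qed
    then have "opM u = 0" using M by simp
    then have "smult 2 (pderiv (f * pderiv u ^ 2)) = 0"
    proof -
      have "smult 2 (pderiv (f * pderiv u ^ 2)) = pderiv u * opM u"
        unfolding opM_def smult_numeral power2_eq_square by (simp add: pderiv_mult algebra_simps)
      then show ?thesis using \<open>opM u = 0\<close> by simp
    qed
    then have "pderiv (f * pderiv u ^ 2) = 0" using two by simp
    moreover have "2 * degree (pderiv u) + 3 \<le> p"
      using degree_pderiv_le[of u] du p_N N_ge_2 by linarith
    ultimately have "pderiv u = 0" by (rule pderiv_f_square_0_imp)
    then have "of_nat (Suc i) * coeff u (Suc i) = 0" by (metis coeff_pderiv coeff_0 Suc_eq_plus1)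
    moreover have "(of_nat (Suc i) :: 'a) \<noteq> 0" using i p_N by (intro of_nat_nz) auto
    ultimately show False using u0 by simp
  qed
  \<comment> \<open>The constant defect \<open>m\<close> is absorbed by a shift, possible as
    \<open>l\<close> is nonzero.\<close>
  define u' where "u' = u + [:m / l:]"
  have "opM u' = smult l u'" using l m by (simp add: u'_def opM_add opM_const smult_add_right)
  moreover have "coeff u' (Suc i) \<noteq> 0" using u0 by (simp add: u'_def)
  then have "u' \<noteq> 0" by auto
  moreover have "degree u' \<le> N" unfolding u'_def using du by (intro degree_add_le) simp_all
  ultimately show ?thesis using l by blast
qed

text \<open>The computation of \<open>nrm_imp_eigenvector\<close> run backwards: with
  \<open>c^2 = l\<close> and \<open>v = (2/c) u'\<close> the norm has zero derivative and degree
  \<open>p\<close>, hence is \<open>C (x^p - x0^p) = C (x - x0)^p\<close>.\<close>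

lemma eigenvector_imp_torsion:
  assumes u: "u \<noteq> 0" and l: "l \<noteq> 0" and du: "degree u \<le> N" and eig: "opM u = smult l u"
  shows "\<exists>P. on_curve E P \<and> P \<noteq> Infinity \<and> point_mult E p P = Infinity"
proof -
  \<comment> \<open>The top coefficient of \<open>opM u\<close> requires \<open>p\<close> to divide
    \<open>2 d (2 d + 1)\<close>. For \<open>d < N\<close> this leaves only \<open>d = 0\<close>,
    and constants have eigenvalue 0.\<close>
  have dN: "degree u = N"
  proof (rule ccontr)
    assume d: "degree u \<noteq> N"
    let ?d = "degree u"
    have "coeff (opM u) (Suc ?d) = of_nat (2 * ?d * (2 * ?d + 1)) * coeff u ?d"
      using coeff_opM_high[of "Suc ?d" u] by (simp add: coeff_eq_0)
    then have "of_nat (2 * ?d * (2 * ?d + 1)) * lead_coeff u = 0"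
      by (simp add: eig coeff_eq_0)
    then have "(of_nat (2 * ?d * (2 * ?d + 1)) :: 'a) = 0" using u by (simp del: of_nat_mult of_nat_add)
    then have "p dvd 2 * ?d * (2 * ?d + 1)" using char by (simp only: of_nat_eq_0_iff_char_dvd)
    then have "p dvd 2 \<or> p dvd ?d \<or> p dvd 2 * ?d + 1" using p_prime by (simp only: prime_dvd_mult_iff) blast
    moreover have "2 * ?d + 1 < p" "?d < p" using d du p_N by auto
    ultimately have "?d = 0" using p_ge_5 by (auto dest: dvd_imp_le)
    then obtain c where "u = [:c:]" by (metis degree_eq_zeroE)
    then show False using eig l u by (simp add: opM_const)
  qed
  obtain c where c: "c ^ 2 = l" using nth_root_exists[of 2 l] by auto
  then have c0: "c \<noteq> 0" using l by auto
  define v where "v = smult (2 / c) (pderiv u)"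
  have du': "degree (pderiv u) = N - 1"
  proof (rule antisym)
    show "degree (pderiv u) \<le> N - 1" using degree_pderiv_le[of u] dN by simp
    have "coeff (pderiv u) (N - 1) = of_nat N * lead_coeff u" using N_ge_2 dN by (simp add: coeff_pderiv)
    moreover have "(of_nat N :: 'a) \<noteq> 0" using p_N N_ge_2 by (intro of_nat_nz) auto
    ultimately have "coeff (pderiv u) (N - 1) \<noteq> 0" using u by simp
    then show "N - 1 \<le> degree (pderiv u)" by (rule le_degree)
  qed
  have v: "v \<noteq> 0" "degree v = N - 1"
  proof -
    have "pderiv u \<noteq> 0"
    proof
      assume "pderiv u = 0"
      then have "degree u < p \<Longrightarrow> u = [:coeff u 0:]" using pderiv_0_imp[of u] by (simp add: coeff_eq_0)
      then show False using dN p_N N_ge_2 by (metis degree_pCons_0 less_add_Suc1 mult_2 not_numeral_le_zero Suc_eq_plus1 add.assoc)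
    qed
    then show "v \<noteq> 0" "degree v = N - 1" using c0 two du' by (simp_all add: v_def)
  qed
  have dn: "degree (nrm u v) = p"
    using degree_nrm(1)[OF v(1), of u] dN v(2) N_ge_2 p_N by simp
  have "pderiv (nrm u v) = 0"
  proof -
    have v2: "v ^ 2 = smult (4 / l) (pderiv u ^ 2)"
      by (simp add: v_def power2_eq_square c[symmetric])
    have "pderiv (f * pderiv u ^ 2) = pderiv u * smult (1 / 2) (opM u)"
    proof -
      have "smult 2 (pderiv (f * pderiv u ^ 2)) = pderiv u * opM u"
        unfolding opM_def smult_numeral power2_eq_square by (simp add: pderiv_mult algebra_simps)
      then have "smult (1/2) (smult 2 (pderiv (f * pderiv u ^ 2))) = smult (1/2) (pderiv u * opM u)" by (simp only:)
      then show ?thesis using two by simp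
    qed
    then have "pderiv (f * v ^ 2) = smult (4 / l * (1 / 2 * l)) (pderiv u * u)"
      unfolding v2 mult_smult_right pderiv_smult by (simp add: eig)
    also have "4 / l * (1 / 2 * l) = 2" using l two by (simp add: field_simps)
    finally show ?thesis unfolding nrm_def pderiv_diff
      by (simp add: power2_eq_square pderiv_mult smult_numeral)
  qed
  then have n: "nrm u v = [:coeff (nrm u v) 0:] + monom (coeff (nrm u v) p) p"
    using dn p_ge_5 by (intro pderiv_0_imp) auto
  define C where "C = coeff (nrm u v) p"
  have C: "C \<noteq> 0" using dn v degree_0 p_ge_5 by (metis C_def leading_coeff_0_iff not_numeral_le_zero)
  obtain x0 where x0: "x0 ^ p = - coeff (nrm u v) 0 / C"
    using nth_root_exists[of p "- coeff (nrm u v) 0 / C"] p_ge_5 by auto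
  have "nrm u v = smult C (monom 1 p - [:x0 ^ p:])"
    by (subst n) (use C in \<open>simp add: C_def[symmetric] x0 smult_diff_right smult_monom\<close>)
  then have uv: "nrm u v = smult C (lin x0 ^ p)"
    using lin_power_CHAR[of x0] char p_prime by simp
  obtain j m u1 v1 where r: "p = m + 2 * j" "odd m" "u = lin x0 ^ j * u1" "v = lin x0 ^ j * v1"
    "nrm u1 v1 = smult C (lin x0 ^ m)" "poly v1 x0 \<noteq> 0"
    using nrm_reduce[OF C uv p_odd] .
  \<comment> \<open>A common factor \<open>(x - x0)^j\<close> of \<open>u\<close> and of
    \<open>v\<close>, a multiple of \<open>u'\<close>, is impossible for \<open>j > 0\<close>: the
    order of \<open>u\<close> at \<open>x0\<close> is exactly \<open>j < p\<close>, so that of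
    \<open>u'\<close> is \<open>j - 1\<close>.\<close>
  have "j = 0"
  proof (rule ccontr)
    assume "j \<noteq> 0"
    then obtain k where k: "j = Suc k" by (metis not0_implies_Suc)
    have "pderiv u = smult (c / 2) v" using c0 two by (simp add: v_def)
    then have "lin x0 ^ k * (smult (of_nat j) (pderiv (lin x0) * u1) + lin x0 * pderiv u1)
        = lin x0 ^ k * (lin x0 * smult (c / 2) v1)"
      unfolding r(3,4) k pderiv_mult pderiv_power_Suc by (simp add: algebra_simps)
    then have "smult (of_nat j) (pderiv (lin x0) * u1) + lin x0 * pderiv u1 = lin x0 * smult (c / 2) v1"
      by (metis lin_nz mult_cancel_left power_not_zero)
    then have "poly (smult (of_nat j) (pderiv (lin x0) * u1) + lin x0 * pderiv u1) x0
        = poly (lin x0 * smult (c / 2) v1) x0" by (simp only:)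
    then have "of_nat j * poly u1 x0 = 0" by (simp add: lin_def pderiv_pCons)
    moreover have "(of_nat j :: 'a) \<noteq> 0" using r(1) \<open>j \<noteq> 0\<close> by (intro of_nat_nz) auto
    ultimately show False using nrm_root(2)[OF r(5,2,6)] by simp
  qed
  then have "poly v x0 \<noteq> 0" using r by simp
  then show ?thesis using nrm_imp_torsion[OF C uv p_odd] by blast
qed

theorem supersingular_iff_exact: "supersingular E \<longleftrightarrow> (\<exists>g. pderiv g = f ^ N)"
proof
  assume "supersingular E"
  then show "\<exists>g. pderiv g = f ^ N"
    using no_exact_imp_eigenvector eigenvector_imp_torsion
    unfolding supersingular_def char by blast
next
  assume "\<exists>g. pderiv g = f ^ N"
  then show "supersingular E"
    using torsion_imp_nrm nrm_imp_eigenvector exact_no_eigenvector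
    unfolding supersingular_def char by metis
qed

end

section \<open>Reduction to short Weierstrass form\<close>

fun to_short_point :: "'a::field \<Rightarrow> 'a \<Rightarrow> 'a \<Rightarrow> 'a point \<Rightarrow> 'a point" where
  "to_short_point r s t Infinity = Infinity"
| "to_short_point r s t (Affine x y) = Affine (x + r) (y + s * x + t)"

lemma to_short_point_eq_Infinity_iff [simp]: "to_short_point r s t P = Infinity \<longleftrightarrow> P = Infinity"
  by (cases P) auto

text \<open>The third intersection point of the line is a root of the cubic of
  \<open>chord_tangent_cubic\<close>.\<close>

lemma on_curve_point_add_short:
  fixes a b :: "'a::field"
  assumes two: "(2::'a) \<noteq> 0"
    and P: "on_curve (WCurve 0 0 0 a b) P" and Q: "on_curve (WCurve 0 0 0 a b) Q"
  shows "on_curve (WCurve 0 0 0 a b) (point_add (WCurve 0 0 0 a b) P Q)"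
proof (cases "P = Infinity \<or> Q = Infinity")
  case True
  then show ?thesis using P Q by (cases P; cases Q) auto
next
  case False
  then obtain x1 y1 x2 y2 where PQ: "P = Affine x1 y1" "Q = Affine x2 y2" by (metis point.exhaust)
  show ?thesis
  proof (cases "x1 = x2 \<and> y1 + y2 = 0")
    case True
    then show ?thesis by (simp add: PQ)
  next
    case ne: False
    define l where "l = (if x1 = x2 then (3 * x1 ^ 2 + a) / (2 * y1) else (y2 - y1) / (x2 - x1))"
    define m where "m = y1 - l * x1"
    define x3 where "x3 = l ^ 2 - x1 - x2"
    have "y1 ^ 2 = x1 ^ 3 + a * x1 + b" "y2 ^ 2 = x2 ^ 3 + a * x2 + b" using P Q by (simp_all add: PQ)
    note c = chord_tangent_cubic(1)[OF two this ne l_def m_def x3_def]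
    have "poly ([:- m, - l:] ^ 2 - [:b, a, 0, 1:]) x3 = 0" unfolding c by (simp del: mult_pCons_left mult_pCons_right)
    moreover have "poly ([:- m, - l:] ^ 2 - [:b, a, 0, 1:]) x3
        = (- (l * x3) - m) ^ 2 - (x3 ^ 3 + a * x3 + b)"
      by (simp add: power2_eq_square power3_eq_cube algebra_simps)
    ultimately have "(- (l * x3) - m) ^ 2 = x3 ^ 3 + a * x3 + b" by simp
    moreover have "point_add (WCurve 0 0 0 a b) P Q = Affine x3 (- (l * x3) - m)"
      using ne by (simp add: PQ Let_def x3_def m_def l_def)
    ultimately show ?thesis by simp
  qed
qed

context
  fixes r s t a4 a6 :: "'a::field"
  assumes two: "(2::'a) \<noteq> 0"
begin

text \<open>The coefficients \<open>a1\<close>, \<open>a2\<close>, \<open>a3\<close> are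
  parametrised so that the substitution \<open>(x + r, y + s x + t)\<close>, completing square and
  cube, reaches the short form without divisions.\<close>

definition "E0 = WCurve (2 * s) (3 * r - s ^ 2) (2 * t) a4 a6"
definition "sa = a4 + 2 * s * t - 3 * r ^ 2"
definition "sb = a6 + t ^ 2 - r ^ 3 - sa * r"
abbreviation "E1 \<equiv> WCurve 0 0 0 sa sb"
abbreviation "\<phi> \<equiv> to_short_point r s t"

lemma on_curve_to_short: "on_curve E1 (\<phi> P) \<longleftrightarrow> on_curve E0 P"
proof (cases P)
  case (Affine x y)
  have "(y + s * x + t) ^ 2 - ((x + r) ^ 3 + sa * (x + r) + sb)
     = y ^ 2 + 2 * s * x * y + 2 * t * y - (x ^ 3 + (3 * r - s ^ 2) * x ^ 2 + a4 * x + a6)"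
    unfolding sb_def sa_def by Groebner_Basis.algebra
  then have "(y + s * x + t) ^ 2 = (x + r) ^ 3 + sa * (x + r) + sb \<longleftrightarrow>
      y ^ 2 + 2 * s * x * y + 2 * t * y = x ^ 3 + (3 * r - s ^ 2) * x ^ 2 + a4 * x + a6"
    by (metis eq_iff_diff_eq_0)
  then show ?thesis by (simp add: Affine E0_def)
qed simp

lemma point_add_to_short:
  assumes P: "on_curve E0 P" and Q: "on_curve E0 Q"
  shows "point_add E1 (\<phi> P) (\<phi> Q) = \<phi> (point_add E0 P Q)"
proof (cases "P = Infinity \<or> Q = Infinity")
  case True
  then show ?thesis by (cases P; cases Q) auto
next
  case False
  then obtain x1 y1 x2 y2 where PQ: "P = Affine x1 y1" "Q = Affine x2 y2" by (metis point.exhaust)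
  define d where "d = y1 + y2 + 2 * s * x2 + 2 * t"
  have opp: "x1 + r = x2 + r \<and> (y1 + s * x1 + t) + (y2 + s * x2 + t) = 0 \<longleftrightarrow> x1 = x2 \<and> d = 0"
    unfolding d_def by (auto simp: algebra_simps)
  show ?thesis
  proof (cases "x1 = x2 \<and> d = 0")
    case True
    then have "point_add E0 P Q = Infinity" by (simp add: PQ E0_def d_def)
    moreover have "point_add E1 (\<phi> P) (\<phi> Q) = Infinity" using True opp by (simp add: PQ)
    ultimately show ?thesis by simp
  next
    case ne: False
    define l where "l = (if x1 = x2
                 then (3 * x1 ^ 2 + 2 * (3 * r - s ^ 2) * x1 + a4 - 2 * s * y1)
                        / (2 * y1 + 2 * s * x1 + 2 * t)
                 else (y2 - y1) / (x2 - x1))"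
    define l' where "l' = (if x1 + r = x2 + r
                 then (3 * (x1 + r) ^ 2 + sa) / (2 * (y1 + s * x1 + t))
                 else ((y2 + s * x2 + t) - (y1 + s * x1 + t)) / ((x2 + r) - (x1 + r)))"
    \<comment> \<open>The shear \<open>y + s x\<close> adds \<open>s\<close> to every slope, of
      chords and tangents alike.\<close>
    have l': "l' = l + s"
    proof (cases "x1 = x2")
      case False
      then show ?thesis by (simp add: l'_def l_def divide_simps) (simp add: algebra_simps)
    next
      case True
      \<comment> \<open>Over one abscissa, points that are not opposite coincide, so
        \<open>d\<close> is the denominator of the tangent slope.\<close>
      have "(y1 - y2) * d = 0"
        using P Q unfolding PQ E0_def d_def True by (simp, Groebner_Basis.algebra)
      then have "d = 2 * y1 + 2 * s * x1 + 2 * t" using ne True by (simp add: d_def)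
      then have nz: "2 * y1 + 2 * s * x1 + 2 * t \<noteq> 0" using ne True by auto
      have e: "2 * (y1 + s * x1 + t) = 2 * y1 + 2 * s * x1 + 2 * t" by (simp add: algebra_simps)
      have "l' = (3 * (x1 + r) ^ 2 + sa) / (2 * y1 + 2 * s * x1 + 2 * t)"
        using True unfolding l'_def e by simp
      then have "l' * (2 * y1 + 2 * s * x1 + 2 * t) = 3 * (x1 + r) ^ 2 + sa"
        using nz by (metis nonzero_eq_divide_eq)
      moreover have "l * (2 * y1 + 2 * s * x1 + 2 * t)
          = 3 * x1 ^ 2 + 2 * (3 * r - s ^ 2) * x1 + a4 - 2 * s * y1"
        using True nz by (simp add: l_def)
      ultimately have "(l' - (l + s)) * (2 * y1 + 2 * s * x1 + 2 * t) = 0"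
        unfolding sa_def by Groebner_Basis.algebra
      then show ?thesis using nz by simp
    qed
    define x3 where "x3 = l ^ 2 + 2 * s * l - (3 * r - s ^ 2) - x1 - x2"
    have "point_add E0 P Q = Affine x3 (- (l + 2 * s) * x3 - (y1 - l * x1) - 2 * t)"
      using ne by (simp add: PQ E0_def d_def x3_def Let_def l_def)
    moreover have "point_add E1 (\<phi> P) (\<phi> Q) = Affine (l' ^ 2 - (x1 + r) - (x2 + r))
        (- (l' * (l' ^ 2 - (x1 + r) - (x2 + r))) - (y1 + s * x1 + t - l' * (x1 + r)))"
      using ne[folded opp] unfolding PQ to_short_point.simps point_add.simps wcurve.sel
      by (simp add: Let_def l'_def)
    ultimately show ?thesis
      by (simp add: l' x3_def) (simp add: power2_eq_square algebra_simps)
  qed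
qed

text \<open>Both claims go through one induction: transport of a sum requires the summands to lie on
  the curve, and closure under addition is pulled back from the short model.\<close>

lemma point_mult_to_short:
  assumes "on_curve E0 P" shows "point_mult E1 n (\<phi> P) = \<phi> (point_mult E0 n P) \<and> on_curve E0 (point_mult E0 n P)"
proof (induction n)
  case (Suc n)
  then have "point_mult E1 (Suc n) (\<phi> P) = \<phi> (point_mult E0 (Suc n) P)"
    using assms by (simp add: point_add_to_short)
  moreover have "on_curve E1 (point_mult E1 (Suc n) (\<phi> P))"
    using Suc assms on_curve_point_add_short[OF two] by (simp add: on_curve_to_short)
  ultimately show ?case by (simp add: on_curve_to_short del: point_mult.simps)
qed simp

lemma supersingular_to_short: "supersingular E0 \<longleftrightarrow> supersingular E1"
proof
  assume ss: "supersingular E0"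
  show "supersingular E1"
    unfolding supersingular_def
  proof (intro allI impI, elim conjE)
    fix Q assume Q: "on_curve E1 Q" "point_mult E1 CHAR('a) Q = Infinity"
    obtain P where P: "Q = \<phi> P"
    proof (cases Q)
      case (Affine x y)
      then show ?thesis by (intro that[of "Affine (x - r) (y - s * (x - r) - t)"]) simp
    qed (use that[of Infinity] in simp)
    then have "P = Infinity"
      using Q ss point_mult_to_short[of P] unfolding supersingular_def by (auto simp: on_curve_to_short)
    then show "Q = Infinity" by (simp add: P)
  qed
next
  assume ss: "supersingular E1"
  show "supersingular E0"
    unfolding supersingular_def
  proof (intro allI impI, elim conjE)
    fix P assume P: "on_curve E0 P" "point_mult E0 CHAR('a) P = Infinity"
    then have "on_curve E1 (\<phi> P)" "point_mult E1 CHAR('a) (\<phi> P) = Infinity"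
      using point_mult_to_short[of P] by (simp_all add: on_curve_to_short)
    then have "\<phi> P = Infinity" using ss unfolding supersingular_def by blast
    then show "P = Infinity" by simp
  qed
qed

lemma wdisc_E0: "wdisc E0 = - 16 * (4 * sa ^ 3 + 27 * sb ^ 2)"
proof -
  have b2: "wb2 E0 = 12 * r" unfolding wb2_def E0_def wcurve.sel by Groebner_Basis.algebra
  have b4: "wb4 E0 = 2 * (sa + 3 * r ^ 2)"
    unfolding wb4_def E0_def wcurve.sel sa_def by Groebner_Basis.algebra
  have b6: "wb6 E0 = 4 * (sb + r ^ 3 + sa * r)"
    unfolding wb6_def E0_def wcurve.sel sb_def by Groebner_Basis.algebra
  have b8: "4 * wb8 E0 = wb2 E0 * wb6 E0 - wb4 E0 ^ 2"
    unfolding wb2_def wb4_def wb6_def wb8_def E0_def wcurve.sel by Groebner_Basis.algebra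
  have "4 * (wdisc E0 + 16 * (4 * sa ^ 3 + 27 * sb ^ 2)) = 0"
    using b8 unfolding wdisc_def b2 b4 b6 by Groebner_Basis.algebra
  moreover have "(2::'a) * 2 \<noteq> 0" by (rule no_zero_divisors[OF two two])
  then have "(4::'a) \<noteq> 0" by simp
  ultimately have "wdisc E0 + 16 * (4 * sa ^ 3 + 27 * sb ^ 2) = 0"
    by (metis mult_eq_0_iff)
  then show ?thesis by (metis eq_neg_iff_add_eq_0 mult_minus_left)
qed

lemma wc4_E0: "wc4 E0 = - 48 * sa"
  unfolding wc4_def wb2_def wb4_def E0_def wcurve.sel sa_def by Groebner_Basis.algebra

end

lemma weierstrass_to_short:
  fixes E :: "'a::field wcurve"
  assumes two: "(2::'a) \<noteq> 0" and three: "(3::'a) \<noteq> 0"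
  obtains a b where "supersingular E \<longleftrightarrow> supersingular (WCurve 0 0 0 a b)"
    "wdisc E = - 16 * (4 * a ^ 3 + 27 * b ^ 2)" "wc4 E = - 48 * a"
proof -
  obtain a1 a2 a3 a4 a6 where E: "E = WCurve a1 a2 a3 a4 a6" by (cases E)
  define s where "s = a1 / 2"
  define t where "t = a3 / 2"
  define r where "r = (a2 + s ^ 2) / 3"
  have "a1 = 2 * s" "a3 = 2 * t" using two by (simp_all add: s_def t_def)
  moreover have "r * 3 = a2 + s ^ 2" unfolding r_def using three by (metis nonzero_eq_divide_eq)
  then have "a2 = 3 * r - s ^ 2" by (simp add: mult.commute)
  ultimately have E: "E = E0 r s t a4 a6" by (simp only: E E0_def[OF two])
  show ?thesis
    by (rule that[of "sa r s t a4" "sb r s t a4 a6"], unfold E)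
       (rule supersingular_to_short[OF two] wdisc_E0[OF two] wc4_E0[OF two])+
qed

section \<open>Hypergeometric polynomials and Clausen's identity\<close>

definition hyp_ode :: "'a::field \<Rightarrow> 'a \<Rightarrow> 'a \<Rightarrow> 'a poly \<Rightarrow> bool" where
  "hyp_ode A B c F \<longleftrightarrow>
     [:0, 1, -1:] * pderiv (pderiv F) + [:c, - (A + B + 1):] * pderiv F - smult (A * B) F = 0"

lemma hyp_ode_iff:
  "hyp_ode A B c F \<longleftrightarrow>
     (\<forall>n. of_nat (Suc n) * (of_nat n + c) * coeff F (Suc n) = (of_nat n + A) * (of_nat n + B) * coeff F n)"
proof -
  have "coeff ([:0, 1, -1:] * pderiv (pderiv F) + [:c, - (A + B + 1):] * pderiv F - smult (A * B) F) n
      = of_nat (Suc n) * (of_nat n + c) * coeff F (Suc n) - (of_nat n + A) * (of_nat n + B) * coeff F n" for n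
  proof -
    consider "n = 0" | "n = Suc 0" | k where "n = Suc (Suc k)" by (metis not0_implies_Suc)
    then show ?thesis by cases (simp_all add: coeff_pderiv algebra_simps)
  qed
  then show ?thesis unfolding hyp_ode_def poly_eq_iff by simp
qed

text \<open>The recurrence determines all coefficients from the constant one as long as its leading
  factor is nonzero. In characteristic \<open>p\<close> this limits the degree and is the uniqueness
  statement used later.\<close>

lemma hyp_ode_eq_0I:
  assumes "hyp_ode A B c F" "coeff F 0 = 0"
    and "\<And>n. n < degree F \<Longrightarrow> of_nat (Suc n) * (of_nat n + c) \<noteq> 0"
  shows "F = 0"
proof -
  have "coeff F n = 0" if "n \<le> degree F" for n
    using that
  proof (induction n)
    case (Suc n)
    then have "of_nat (Suc n) * (of_nat n + c) * coeff F (Suc n) = 0"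
      using assms(1) unfolding hyp_ode_iff by simp
    then show ?case using assms(3)[of n] Suc.prems by (metis Suc_le_eq mult_eq_0_iff)
  qed (use assms in simp)
  then show ?thesis by (metis leading_coeff_0_iff order_refl)
qed

lemma hyp_ode_diff:
  assumes "hyp_ode A B c F" "hyp_ode A B c G"
  shows "hyp_ode A B c (smult s F - smult t G)"
  unfolding hyp_ode_iff
proof
  fix n
  have "of_nat (Suc n) * (of_nat n + c) * coeff F (Suc n) = (of_nat n + A) * (of_nat n + B) * coeff F n"
    "of_nat (Suc n) * (of_nat n + c) * coeff G (Suc n) = (of_nat n + A) * (of_nat n + B) * coeff G n"
    using assms unfolding hyp_ode_iff by blast+
  then show "of_nat (Suc n) * (of_nat n + c) * coeff (smult s F - smult t G) (Suc n)
      = (of_nat n + A) * (of_nat n + B) * coeff (smult s F - smult t G) n"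
    unfolding coeff_diff coeff_smult by Groebner_Basis.algebra
qed

text \<open>The substitution exchanges the singular points 0 and 1, and with them the exponent data
  \<open>c\<close> and \<open>A + B + 1 - c\<close>.\<close>

lemma hyp_ode_reflect:
  assumes "hyp_ode A B c F"
  shows "hyp_ode A B (A + B + 1 - c) (pcompose F [:1, -1:])"
proof -
  let ?r = "\<lambda>G. pcompose G [:1, -1 :: 'a:]"
  have d: "pderiv (?r G) = - ?r (pderiv G)" for G :: "'a poly"
    by (simp add: pderiv_pcompose pderiv_pCons)
  have dd: "pderiv (pderiv (?r F)) = ?r (pderiv (pderiv F))" by (simp add: d pderiv_minus)
  have "?r [:0, 1, -1:] * ?r (pderiv (pderiv F)) + ?r [:c, - (A + B + 1):] * ?r (pderiv F)
      - smult (A * B) (?r F) = 0"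
    using arg_cong[OF assms[unfolded hyp_ode_def], of ?r]
    by (simp only: pcompose_add pcompose_diff pcompose_mult pcompose_smult pcompose_0)
  moreover have "?r [:0, 1, -1:] = [:0, 1, -1:]" by (simp add: pcompose_pCons)
  moreover have "?r [:c, - (A + B + 1):] = - [:A + B + 1 - c, - (A + B + 1):]"
    by (simp add: pcompose_pCons)
  ultimately show ?thesis unfolding hyp_ode_def dd by (simp only: d minus_mult_minus mult_minus_left mult_minus_right)
qed

text \<open>After recentring at the regular point \<open>z\<close>, the recurrence gives coefficient
  \<open>n + 2\<close> from the two before it, with leading factor
  \<open>z (1 - z) (n + 2) (n + 1)\<close>. A double root starts it with two zeros.\<close>

lemma hyp_ode_simple_root:
  fixes F :: "'a::field poly"
  assumes ode: "hyp_ode A B c F" and z: "z \<noteq> 0" "z \<noteq> 1"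
    and deg: "\<And>n. 0 < n \<Longrightarrow> n \<le> degree F \<Longrightarrow> (of_nat n :: 'a) \<noteq> 0"
    and root: "poly F z = 0" "poly (pderiv F) z = 0"
  shows "F = 0"
proof -
  let ?r = "\<lambda>G. pcompose G [:z, 1:]"
  define R where "R = ?r F"
  have d: "pderiv (?r G) = ?r (pderiv G)" for G :: "'a poly"
    by (simp add: pderiv_pcompose pderiv_pCons)
  have R0: "coeff R 0 = 0" using root by (simp add: R_def coeff_pcompose_0)
  have "coeff (pderiv R) 0 = 0" using root by (simp add: R_def d coeff_pcompose_0)
  then have R1: "coeff R (Suc 0) = 0" by (simp add: coeff_pderiv)
  have "?r [:0, 1, -1:] * pderiv (pderiv R) + ?r [:c, - (A + B + 1):] * pderiv R - smult (A * B) R = 0"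
    using arg_cong[OF ode[unfolded hyp_ode_def], of ?r] unfolding R_def d
    by (simp only: pcompose_add pcompose_diff pcompose_mult pcompose_smult pcompose_0)
  moreover have "?r [:0, 1, -1:] = [:z * (1 - z), 1 - 2 * z, -1:]"
    by (simp add: pcompose_pCons algebra_simps)
  moreover have "?r [:c, - (A + B + 1):] = [:c - (A + B + 1) * z, - (A + B + 1):]"
    by (simp add: pcompose_pCons algebra_simps)
  ultimately have eq: "[:z * (1 - z), 1 - 2 * z, -1:] * pderiv (pderiv R)
      + [:c - (A + B + 1) * z, - (A + B + 1):] * pderiv R - smult (A * B) R = 0" by (simp only:)
  have degR: "degree R = degree F" by (simp add: R_def degree_pcompose)
  have step: "coeff R (Suc (Suc n)) = 0"
    if 0: "coeff R n = 0" "coeff R (Suc n) = 0" for n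
  proof (cases "Suc (Suc n) \<le> degree F")
    case True
    have "z * (1 - z) * (of_nat (Suc (Suc n)) * of_nat (Suc n) * coeff R (Suc (Suc n))) = 0"
    proof -
      consider "n = 0" | "n = Suc 0" | k where "n = Suc (Suc k)" by (metis not0_implies_Suc)
      then show ?thesis
        using arg_cong[OF eq, of "\<lambda>G. coeff G n"] 0
        by cases (simp_all add: coeff_pderiv algebra_simps)
    qed
    then show ?thesis using z deg[OF _ True] deg[of "Suc n"] True by simp
  next
    case False
    then show ?thesis by (simp add: degR coeff_eq_0)
  qed
  have "coeff R n = 0 \<and> coeff R (Suc n) = 0" for n
    by (induction n) (use R0 R1 step in auto)
  then have "R = 0" by (simp add: poly_eqI)
  then show ?thesis unfolding R_def by (rule pcompose_eq_0) simp
qed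

text \<open>
  Clausen's identity: the square of a solution of the hypergeometric equation with
  \<open>c = 1\<close>, \<open>A + B = 1/2 + e\<close> (times \<open>1 - z\<close> if \<open>e = 1\<close>) satisfies the equation of a
  \<open>3F2\<close>. In each case twice the third order equation is a combination of the second order
  one and its derivative.
\<close>

lemma clausen_recurrence:
  fixes F :: "'a::field poly"
  assumes two: "(2::'a) \<noteq> 0" and ode: "hyp_ode A B 1 F" and AB: "A + B = 1/2 + of_nat e" and e: "e \<le> 1"
    and Q: "Q = [:1, -1:] ^ e * F ^ 2" and k: "k = (2 * A - of_nat e) * (2 * B - of_nat e)"
  shows "2 * of_nat (Suc n) ^ 3 * coeff Q (Suc n)
           = (of_nat n ^ 2 + of_nat n + k) * (2 * of_nat n + 1) * coeff Q n"
proof -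
  define z where "z = [:0, 1 :: 'a:]"
  define K where "K = [:A * B:]"
  define F1 where "F1 = pderiv F"
  define F2 where "F2 = pderiv F1"
  define F3 where "F3 = pderiv F2"
  define Q1 where "Q1 = pderiv Q"
  define Q2 where "Q2 = pderiv Q1"
  define Q3 where "Q3 = pderiv Q2"
  note defs = F1_def[symmetric] F2_def[symmetric] F3_def[symmetric] Q1_def[symmetric] Q2_def[symmetric] Q3_def[symmetric]
  have dz: "pderiv z = 1" by (simp add: z_def pderiv_pCons)
  have dK: "pderiv K = 0" by (simp add: K_def pderiv_pCons)
  have zc: "[:0, 1, -1:] = z * (1 - z)" by (simp add: z_def one_pCons)
  define E where "E = (of_nat e :: 'a poly)"
  have E: "E = 0 \<or> E = 1" using e by (cases e) (auto simp: E_def)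
  have dE: "pderiv E = 0" using E by auto
  \<comment> \<open>The equation is doubled to clear the 1/2 in \<open>A + B\<close>.\<close>
  have O1: "2 * z * (1 - z) * F2 + (2 - (3 + 2 * E) * z) * F1 - 2 * K * F = 0"
  proof -
    have "2 * (A + B + 1) = 3 + 2 * of_nat e" using AB two by (simp add: field_simps)
    moreover have "smult 2 [:1, - (A + B + 1):] = [:2, - (2 * (A + B + 1)):]" by simp
    ultimately have "smult 2 [:1, - (A + B + 1):] = 2 - (3 + 2 * E) * z"
      by (simp add: z_def E_def of_nat_poly numeral_poly mult.commute)
    moreover have "smult 2 ([:0, 1, -1:] * F2 + [:1, - (A + B + 1):] * F1 - smult (A * B) F) = 0"
      using ode unfolding hyp_ode_def defs by simp
    moreover have "smult 2 (smult (A * B) F) = 2 * K * F"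
      by (simp add: K_def numeral_poly mult.commute)
    moreover have "smult 2 (z * (1 - z)) = 2 * z * (1 - z)" by (simp add: smult_numeral mult.assoc)
    ultimately show ?thesis
      by (simp only: smult_diff_right smult_add_right mult_smult_left[symmetric] zc)
  qed
  have O2: "2 * z * (1 - z) * F3 + 2 * (1 - 2 * z) * F2 + (2 - (3 + 2 * E) * z) * F2
      - (3 + 2 * E) * F1 - 2 * K * F1 = 0"
    using arg_cong[OF O1, of pderiv]
    by (simp add: pderiv_add pderiv_diff pderiv_mult dz dK dE defs algebra_simps)
  define k' where "k' = [:k:]"
  \<comment> \<open>\<open>k\<close> is \<open>4 A B\<close> for \<open>e = 0\<close>, and
    \<open>4 (1-A) (1-B) = 4 A B - 2\<close> for \<open>e = 1\<close>, in accordance with Euler's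
    transformation.\<close>
  have k': "k' = 4 * K - 2 * E"
  proof -
    have "k = 4 * (A * B) - 2 * of_nat e * (A + B) + of_nat e ^ 2"
      unfolding k by Groebner_Basis.algebra
    also have "\<dots> = 4 * (A * B) - 2 * of_nat e"
      using e two by (cases e) (simp_all add: AB algebra_simps)
    finally show ?thesis by (simp add: k'_def K_def E_def of_nat_poly numeral_poly)
  qed
  \<comment> \<open>In terms of \<open>\<theta> = z d/dz\<close> this is \<open>2 \<theta>^3 - z
    (\<theta>^2 + \<theta> + k) (2 \<theta> + 1)\<close> divided by \<open>z\<close>, so its
    coefficients give the claimed recurrence.\<close>
  have O3: "2 * z ^ 2 * (1 - z) * Q3 + (6 * z - 9 * z ^ 2) * Q2 + (2 - (6 + 2 * k') * z) * Q1 - k' * Q = 0"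
  proof (cases "e = 0")
    case True
    then have Qe: "Q = F * F" by (simp add: Q power2_eq_square)
    have q1: "Q1 = 2 * F * F1" unfolding Q1_def Qe by (simp add: pderiv_mult defs)
    moreover have q2: "Q2 = 2 * F1 * F1 + 2 * F * F2" unfolding Q2_def q1 by (simp add: pderiv_mult defs algebra_simps)
    moreover have "Q3 = 6 * F1 * F2 + 2 * F * F3"
      unfolding Q3_def q2 by (simp add: pderiv_mult pderiv_add defs algebra_simps)
    moreover have "E = 0" using True by (simp add: E_def)
    ultimately show ?thesis using Qe O1 O2 k' by Groebner_Basis.algebra
  next
    case False
    then have e1: "e = 1" using e by simp
    have "[:1, -1:] = 1 - z" by (simp add: z_def one_pCons)
    then have Qe: "Q = (1 - z) * (F * F)" by (simp add: Q e1 power2_eq_square)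
    have q1: "Q1 = 2 * (1 - z) * F * F1 - F * F" unfolding Q1_def Qe
      by (simp add: pderiv_mult pderiv_diff dz defs algebra_simps)
    moreover have q2: "Q2 = 2 * (1 - z) * (F1 * F1 + F * F2) - 4 * F * F1"
      unfolding Q2_def q1 by (simp add: pderiv_mult pderiv_diff pderiv_add dz defs algebra_simps)
    moreover have "Q3 = 2 * (1 - z) * (3 * F1 * F2 + F * F3) - 6 * (F1 * F1 + F * F2)"
      unfolding Q3_def q2 by (simp add: pderiv_mult pderiv_diff pderiv_add dz defs algebra_simps)
    moreover have "E = 1" using e1 by (simp add: E_def)
    ultimately show ?thesis using Qe O1 O2 k' by Groebner_Basis.algebra
  qed
  have "2 * z ^ 2 * (1 - z) * Q3 + (6 * z - 9 * z ^ 2) * Q2 + (2 - (6 + 2 * k') * z) * Q1 - k' * Q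
      = [:0, 0, 2, -2:] * Q3 + [:0, 6, -9:] * Q2 + [:2, - (6 + 2 * k):] * Q1 - smult k Q"
    by (simp add: z_def k'_def numeral_poly power2_eq_square one_pCons mult.commute)
  then have "coeff ([:0, 0, 2, -2:] * Q3 + [:0, 6, -9:] * Q2 + [:2, - (6 + 2 * k):] * Q1 - smult k Q) n = 0"
    using O3 by simp
  moreover have "coeff ([:0, 0, 2, -2:] * Q3 + [:0, 6, -9:] * Q2 + [:2, - (6 + 2 * k):] * Q1 - smult k Q) n
      = 2 * of_nat (Suc n) ^ 3 * coeff Q (Suc n)
           - (of_nat n ^ 2 + of_nat n + k) * (2 * of_nat n + 1) * coeff Q n"
  proof -
    consider "n = 0" | "n = Suc 0" | "n = Suc (Suc 0)" | k where "n = Suc (Suc (Suc k))"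
      by (metis not0_implies_Suc)
    then show ?thesis
      by cases (simp_all add: Q3_def Q2_def Q1_def coeff_pderiv algebra_simps power2_eq_square power3_eq_cube)
  qed
  ultimately show ?thesis by simp
qed

text \<open>\<open>X^k F(c/X)\<close>, for \<open>degree F \<le> k\<close>.\<close>

definition homog :: "nat \<Rightarrow> 'a::field \<Rightarrow> 'a poly \<Rightarrow> 'a poly" where
  "homog k c F = (\<Sum>n=0..k. monom (coeff F n * c ^ n) (k - n))"

lemma homog_sum: "homog k c (sum g S) = (\<Sum>i\<in>S. homog k c (g i))"
  unfolding homog_def coeff_sum sum_distrib_right monom_hom.hom_sum
  by (rule sum.swap)

lemma homog_monom:
  assumes "i \<le> k" shows "homog k c (monom a i) = monom (a * c ^ i) (k - i)"
proof -
  have "homog k c (monom a i) = (\<Sum>n\<in>{i}. monom (coeff (monom a i) n * c ^ n) (k - n))"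
    unfolding homog_def by (rule sum.mono_neutral_right) (use assms in auto)
  then show ?thesis by simp
qed

lemma homog_mult:
  assumes "degree F \<le> k" "degree G \<le> l"
  shows "homog (k + l) c (F * G) = homog k c F * homog l c G"
proof -
  have F: "F = (\<Sum>i\<le>k. monom (coeff F i) i)" and G: "G = (\<Sum>i\<le>l. monom (coeff G i) i)"
    using assms by (simp_all add: poly_as_sum_of_monoms')
  have "homog (k + l) c (F * G)
      = homog (k + l) c (\<Sum>i\<le>k. \<Sum>j\<le>l. monom (coeff F i * coeff G j) (i + j))"
    by (subst F, subst G) (simp only: sum_product mult_monom)
  also have "\<dots> = (\<Sum>i\<le>k. \<Sum>j\<le>l. monom (coeff F i * c ^ i) (k - i) * monom (coeff G j * c ^ j) (l - j))"
    unfolding homog_sum by (intro sum.cong refl) (simp add: homog_monom mult_monom power_add ac_simps)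
  also have "\<dots> = homog k c F * homog l c G"
    unfolding homog_def by (simp add: sum_product atMost_atLeast0)
  finally show ?thesis .
qed

lemma homog_1: "homog k c 1 = monom 1 k"
  using homog_monom[of 0 k c 1] by simp

lemma homog_add:
  assumes "degree F \<le> k" shows "homog (k + l) c F = homog k c F * monom 1 l"
  using homog_mult[of F k 1 l c] assms by (simp add: homog_1)

lemma homog_lin_power: "homog e c ([:1, -1:] ^ e) = [:- c, 1:] ^ e"
proof (induction e)
  case 0
  then show ?case by (simp add: homog_1)
next
  case (Suc e)
  have "homog 1 c [:1, -1:] = [:- c, 1:]"
    by (simp add: homog_def monom_altdef)
  then show ?case
    using homog_mult[of "[:1, -1:]" 1 "[:1, -1 :: 'a:] ^ e" e c] Suc.IH
      degree_power_le[of "[:1, -1 :: 'a:]" e] by simp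
qed

lemma poly_homog:
  assumes "x \<noteq> 0" "degree F \<le> k" shows "poly (homog k c F) x = x ^ k * poly F (c / x)"
proof -
  have pF: "poly F (c / x) = (\<Sum>n\<le>k. coeff F n * (c / x) ^ n)"
    using assms(2) by (subst poly_as_sum_of_monoms'[symmetric]) (simp_all add: poly_sum poly_monom)
  then have "x ^ k * poly F (c / x) = (\<Sum>n=0..k. coeff F n * c ^ n * x ^ (k - n))"
    using assms(1) unfolding pF sum_distrib_left atMost_atLeast0
    by (auto intro!: sum.cong simp: power_diff power_divide)
  then show ?thesis by (simp add: homog_def poly_sum poly_monom)
qed

lemma coeff_homog: "i \<le> k \<Longrightarrow> coeff (homog k c F) i = coeff F (k - i) * c ^ (k - i)"
proof -
  assume i: "i \<le> k"
  have "coeff (homog k c F) i = (\<Sum>n\<in>{k - i}. coeff F n * c ^ n)"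
    unfolding homog_def coeff_sum coeff_monom by (rule sum.mono_neutral_cong_right) (use i in auto)
  then show ?thesis by simp
qed

lemma degree_homog: "degree (homog k c F) \<le> k"
  unfolding homog_def by (intro degree_sum_le) (auto intro: order_trans[OF degree_monom_le])

text \<open>For \<open>z = c / X\<close> the operator \<open>X d/dX\<close> is
  \<open>- z d/dz\<close>, and the factor \<open>X^k\<close> contributes \<open>k\<close>.\<close>

lemma pderiv_homog:
  assumes "degree F \<le> k"
  shows "[:0, 1:] * pderiv (homog k c F) = smult (of_nat k) (homog k c F) - homog k c ([:0, 1:] * pderiv F)"
proof (rule poly_eqI)
  fix i
  show "coeff ([:0, 1:] * pderiv (homog k c F)) i
      = coeff (smult (of_nat k) (homog k c F) - homog k c ([:0, 1:] * pderiv F)) i"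
  proof (cases "i \<le> k")
    case True
    have cz: "coeff ([:0, 1:] * pderiv G) n = of_nat n * coeff G n" for G :: "'a poly" and n
      by (cases n) (simp_all add: coeff_pderiv)
    show ?thesis using True
      by (simp only: coeff_diff coeff_smult cz coeff_homog diff_le_self)
         (simp add: of_nat_diff algebra_simps)
  next
    case False
    then have z: "coeff (homog k c G) i = 0" for G
      using degree_homog[of k c G] by (simp add: coeff_eq_0)
    have "coeff ([:0, 1:] * pderiv (homog k c F)) i = of_nat i * coeff (homog k c F) i"
      by (cases i) (simp_all add: coeff_pderiv)
    then show ?thesis by (simp add: z)
  qed
qed

text \<open>The scaled coefficients of \<open>(1-z)^e F^2\<close> and the sequence \<open>a\<close>
  satisfy the same recurrence, whose leading factor \<open>2 (n+1)^3\<close> is invertible below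
  \<open>p\<close>. Since \<open>D < p\<close>, this covers the whole square. \<open>r\<close> is
  the surplus power of \<open>X\<close> when \<open>2 k + e\<close> exceeds
  \<open>D\<close>.\<close>

lemma clausen_square:
  fixes F :: "'a::field poly" and a :: "nat \<Rightarrow> 'a"
  assumes char: "CHAR('a) = p" "p \<ge> 5"
    and ode: "hyp_ode A B 1 F" "coeff F 0 = 1" and AB: "A + B = 1/2 + of_nat e" "e \<le> 1"
    and deg: "degree F \<le> k" "2 * degree F + e \<le> D" "D < p" "D + r = 2 * k + e"
    and a0: "a 0 = 1"
    and a: "\<And>n. 2 * of_nat (Suc n) ^ 3 * a (Suc n)
        = c * (of_nat n ^ 2 + of_nat n + (2 * A - of_nat e) * (2 * B - of_nat e)) * (2 * of_nat n + 1) * a n"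
  shows "([:- c, 1:] ^ e * homog k c F) ^ 2
       = [:- c, 1:] ^ e * (monom 1 r * (\<Sum>n=0..D. monom (a n) (D - n)))"
proof -
  have nz: "(of_nat n :: 'a) \<noteq> 0" if "0 < n" "n < p" for n
    using that char by (auto simp: of_nat_eq_0_iff_char_dvd dest: dvd_imp_le)
  have two: "(2::'a) \<noteq> 0" using nz[of 2] char by simp
  define Q where "Q = [:1, -1:] ^ e * F ^ 2"
  have degF2: "degree (F ^ 2) \<le> 2 * degree F" using degree_power_le[of F 2] by (simp add: mult.commute)
  have dege: "degree ([:1, -1 :: 'a:] ^ e) \<le> e" using degree_power_le[of "[:1, -1 :: 'a:]" e] by simp
  have degQ: "degree Q \<le> D"
    using degree_mult_le[of "[:1, -1:] ^ e" "F ^ 2"] degF2 dege deg unfolding Q_def by linarith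
  have "poly.coeff Q n * c ^ n = a n" if "n < p" for n
    using that
  proof (induction n)
    case 0
    then show ?case using ode a0 by (simp add: Q_def coeff_mult_0 coeff_0_power)
  next
    case (Suc n)
    have "2 * of_nat (Suc n) ^ 3 * (coeff Q (Suc n) * c ^ Suc n)
        = (2 * of_nat (Suc n) ^ 3 * coeff Q (Suc n)) * c ^ Suc n" by (simp only: mult.assoc)
    also have "\<dots> = c * (of_nat n ^ 2 + of_nat n + (2 * A - of_nat e) * (2 * B - of_nat e))
        * (2 * of_nat n + 1) * (coeff Q n * c ^ n)"
      unfolding clausen_recurrence[OF two ode(1) AB Q_def refl] power_Suc by (simp only: ac_simps)
    also have "\<dots> = 2 * of_nat (Suc n) ^ 3 * a (Suc n)"
      using Suc.IH Suc.prems by (simp only: a Suc_lessD)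
    finally have "2 * of_nat (Suc n) ^ 3 * (coeff Q (Suc n) * c ^ Suc n) = 2 * of_nat (Suc n) ^ 3 * a (Suc n)" .
    moreover have "2 * (of_nat (Suc n) :: 'a) ^ 3 \<noteq> 0" using nz[of "Suc n"] Suc.prems two by simp
    ultimately show ?case by (metis mult_cancel_left)
  qed
  then have "homog D c Q = (\<Sum>n=0..D. monom (a n) (D - n))"
    unfolding homog_def using deg(3) by (intro sum.cong refl) auto
  moreover have "homog (D + r) c Q = [:- c, 1:] ^ e * homog k c F ^ 2"
  proof -
    have "homog (e + (k + k)) c ([:1, -1:] ^ e * (F * F)) = [:- c, 1:] ^ e * (homog k c F * homog k c F)"
      using degree_mult_le[of F F] deg(1) dege
      by (subst homog_mult) (auto simp: homog_mult homog_lin_power)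
    moreover have "e + (k + k) = D + r" using deg(4) by simp
    ultimately show ?thesis by (simp add: Q_def power2_eq_square)
  qed
  ultimately have "[:- c, 1:] ^ e * homog k c F ^ 2 = monom 1 r * (\<Sum>n=0..D. monom (a n) (D - n))"
    using homog_add[OF degQ, of r c] by (simp add: mult.commute)
  then show ?thesis by (metis power2_eq_square power_mult_distrib mult.assoc)
qed

section \<open>Terminating hypergeometric series in characteristic p\<close>

definition hyp_trunc :: "nat \<Rightarrow> 'a::field \<Rightarrow> 'a poly" where
  "hyp_trunc m B = (\<Sum>n=0..m. monom (pochhammer (- of_nat m) n * pochhammer B n / of_nat (fact n) ^ 2) n)"

lemma coeff_hyp_trunc:
  "coeff (hyp_trunc m B) n = (if n \<le> m then pochhammer (- of_nat m) n * pochhammer B n / of_nat (fact n) ^ 2 else 0)"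
  by (simp add: hyp_trunc_def coeff_sum)

lemma degree_hyp_trunc: "degree (hyp_trunc m B) \<le> m"
  by (rule degree_le) (simp add: coeff_hyp_trunc)

lemma coeff_hyp_trunc_0: "coeff (hyp_trunc m B) 0 = 1"
  by (simp add: coeff_hyp_trunc)

text \<open>The cutoff is compatible with the recurrence because its factor \<open>n - m\<close>
  vanishes at \<open>n = m\<close>; below it, \<open>m < CHAR('a)\<close> makes the new denominators
  \<open>n + 1\<close> invertible.\<close>

lemma hyp_trunc_ode:
  fixes B :: "'a::field"
  assumes "m < CHAR('a)"
  shows "hyp_ode (- of_nat m) B 1 (hyp_trunc m B)"
  unfolding hyp_ode_iff
proof
  fix n
  show "of_nat (Suc n) * (of_nat n + 1) * coeff (hyp_trunc m B) (Suc n)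
      = (of_nat n + - of_nat m) * (of_nat n + B) * coeff (hyp_trunc m B) n"
  proof (cases "n < m")
    case True
    then have "(of_nat (Suc n) :: 'a) \<noteq> 0"
      using assms by (auto simp: of_nat_eq_0_iff_char_dvd dest!: dvd_imp_le simp del: of_nat_Suc)
    then have "of_nat (Suc n) * of_nat (Suc n) * (x / (of_nat (Suc n) * y) ^ 2) = x / y ^ 2" for x y :: 'a
      by (simp add: power_mult_distrib power2_eq_square del: of_nat_Suc)
    from this[of "pochhammer (- of_nat m) (Suc n) * pochhammer B (Suc n)" "of_nat (fact n)"]
    show ?thesis using True
      by (simp only: coeff_hyp_trunc fact_Suc of_nat_mult of_nat_id of_nat_Suc[of n, symmetric]
          Suc_le_eq less_imp_le if_True mult.assoc add.commute[of _ 1] flip: of_nat_Suc)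
         (simp add: pochhammer_Suc ac_simps)
  qed (simp add: coeff_hyp_trunc)
qed

lemma lead_coeff_hyp_trunc:
  fixes B :: "'a::field"
  assumes "m < CHAR('a)" "\<And>i. i < m \<Longrightarrow> B + of_nat i \<noteq> 0" "Factorial_Ring.prime CHAR('a)"
  shows "coeff (hyp_trunc m B) m \<noteq> 0"
proof -
  have nz: "(of_nat n :: 'a) \<noteq> 0" if "0 < n" "n \<le> m" for n
    using that assms by (auto simp: of_nat_eq_0_iff_char_dvd dest: dvd_imp_le)
  have "(of_nat (fact n) :: 'a) \<noteq> 0" if "n \<le> m" for n
    using that
  proof (induction n)
    case (Suc n)
    then show ?case using nz[of "Suc n"] by (simp only: fact_Suc of_nat_mult of_nat_id) simp
  qed simp
  moreover have "pochhammer B n \<noteq> 0" if "n \<le> m" for n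
    using that assms(2) by (induction n) (auto simp: pochhammer_Suc)
  moreover have "pochhammer (- of_nat m :: 'a) n \<noteq> 0" if "n \<le> m" for n
    using that
  proof (induction n)
    case (Suc n)
    have "- of_nat m + of_nat n = - (of_nat (m - n) :: 'a)" using Suc.prems by (simp add: of_nat_diff)
    then show ?case using Suc nz[of "m - n"] by (simp add: pochhammer_Suc)
  qed simp
  ultimately show ?thesis by (simp add: coeff_hyp_trunc)
qed

section \<open>The Hasse invariant as a hypergeometric polynomial\<close>

lemma coeff_linear_binomial_power:
  "coeff ([:b, a:] ^ M) j = of_nat (M choose j) * a ^ j * (b::'a::comm_ring_1) ^ (M - j)"
proof -
  have "[:b, a:] = monom a 1 + [:b:]" by (simp add: monom_altdef)
  then have "[:b, a:] ^ M = (\<Sum>k\<le>M. of_nat (M choose k) * monom a 1 ^ k * [:b:] ^ (M - k))"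
    by (simp only: binomial_ring)
  also have "\<dots> = (\<Sum>k\<le>M. monom (of_nat (M choose k) * a ^ k * b ^ (M - k)) k)"
    by (intro sum.cong refl)
       (simp add: monom_power poly_const_pow of_nat_poly smult_monom mult.commute)
  finally have "coeff ([:b, a:] ^ M) j
      = (\<Sum>k\<le>M. if k = j then of_nat (M choose k) * a ^ k * b ^ (M - k) else 0)"
    by (simp add: coeff_sum)
  then show ?thesis by (auto simp: binomial_eq_0)
qed

context short_curve
begin

text \<open>Integration fails only at exponents congruent to -1 modulo \<open>p\<close>, and
  \<open>p - 1\<close> is the only one below \<open>2 * p - 1\<close>.\<close>

lemma exact_iff_coeff:
  fixes W :: "'a poly"
  assumes "degree W < 2 * p - 1"
  shows "(\<exists>g. pderiv g = W) \<longleftrightarrow> coeff W (p - 1) = 0"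
proof
  assume "\<exists>g. pderiv g = W"
  then obtain g where "pderiv g = W" by blast
  then have "coeff W (p - 1) = of_nat p * coeff g p" using p_ge_5 by (auto simp: coeff_pderiv)
  then show "coeff W (p - 1) = 0" by simp
next
  assume W: "coeff W (p - 1) = 0"
  define g where "g = (\<Sum>k\<le>degree W. monom (coeff W k / of_nat (Suc k)) (Suc k))"
  have "pderiv g = W"
  proof (rule poly_eqI)
    fix n
    have "coeff g (Suc n) = (\<Sum>k\<le>degree W. if k = n then coeff W k / of_nat (Suc k) else 0)"
      unfolding g_def coeff_sum coeff_monom by simp
    also have "\<dots> = coeff W n / of_nat (Suc n)" by (simp add: coeff_eq_0)
    finally have 1: "coeff (pderiv g) n = of_nat (Suc n) * (coeff W n / of_nat (Suc n))"
      by (simp add: coeff_pderiv)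
    show "coeff (pderiv g) n = coeff W n"
    proof (cases "(of_nat (Suc n) :: 'a) = 0")
      case True
      then have "p dvd Suc n" using char by (simp only: of_nat_eq_0_iff_char_dvd)
      then obtain q where q: "Suc n = p * q" by auto
      have "coeff W n = 0"
      proof (cases "n \<le> degree W")
        case True
        then have "p * q < p * 2" using assms q by linarith
        then have "q = 1" using q by (cases q) auto
        then have "n = p - 1" using q by simp
        then show ?thesis using W by simp
      qed (simp add: coeff_eq_0)
      then show ?thesis using 1 by simp
    next
      case False
      then show ?thesis using 1 by (simp del: of_nat_Suc)
    qed
  qed
  then show "\<exists>g. pderiv g = W" by blast
qed

text \<open>The multinomial coefficient of \<open>(x^3)^i (a x)^(2N-3i) b^(2i-N)\<close> in
  \<open>f^N\<close>. The guard excludes truncated subtraction; for \<open>2 i < N\<close> the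
  second binomial is 0.\<close>

definition hc :: "nat \<Rightarrow> nat" where
  "hc i = (if 3 * i \<le> 2 * N then (N choose i) * ((N - i) choose (2 * N - 3 * i)) else 0)"

lemma hasse_coeff:
  "coeff (f ^ N) (p - 1) = (\<Sum>i\<le>N. of_nat (hc i) * a ^ (2 * N - 3 * i) * b ^ (2 * i - N))"
proof -
  have "f = monom 1 3 + [:b, a:]" by (simp add: f_def monom_altdef numeral_3_eq_3)
  then have "f ^ N = (\<Sum>i\<le>N. of_nat (N choose i) * monom 1 3 ^ i * [:b, a:] ^ (N - i))"
    by (simp only: binomial_ring)
  also have "\<dots> = (\<Sum>i\<le>N. smult (of_nat (N choose i)) (monom 1 (3 * i) * [:b, a:] ^ (N - i)))"
    by (intro sum.cong refl) (simp add: monom_power of_nat_poly)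
  finally have "coeff (f ^ N) (2 * N)
      = (\<Sum>i\<le>N. of_nat (N choose i) * coeff (monom 1 (3 * i) * [:b, a:] ^ (N - i)) (2 * N))"
    by (simp only: coeff_sum coeff_smult)
  also have "\<dots> = (\<Sum>i\<le>N. of_nat (hc i) * a ^ (2 * N - 3 * i) * b ^ (2 * i - N))"
  proof (intro sum.cong refl)
    fix i assume "i \<in> {..N}"
    have "N - i - (2 * N - 3 * i) = 2 * i - N" if "3 * i \<le> 2 * N" using that by auto
    then show "of_nat (N choose i) * coeff (monom 1 (3 * i) * [:b, a:] ^ (N - i)) (2 * N)
        = of_nat (hc i) * a ^ (2 * N - 3 * i) * b ^ (2 * i - N)"
      by (simp add: coeff_monom_mult coeff_linear_binomial_power hc_def)
  qed
  finally have "coeff (f ^ N) (2 * N) = (\<Sum>i\<le>N. of_nat (hc i) * a ^ (2 * N - 3 * i) * b ^ (2 * i - N))" .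
  moreover have "p - 1 = 2 * N" using p_N by simp
  ultimately show ?thesis by (simp only:)
qed

lemma hc_nz:
  assumes "3 * i \<le> 2 * N" "N \<le> 2 * i" shows "(of_nat (hc i) :: 'a) \<noteq> 0"
proof -
  have "\<not> p dvd n choose k" if "k \<le> n" "n < p" for n k
  proof
    assume "p dvd n choose k"
    then have "p dvd fact n" using binomial_fact_lemma[OF that(1)] by (metis dvd_mult dvd_mult2 mult.commute)
    then show False using that p_prime by (simp add: prime_dvd_fact_iff)
  qed
  then have "\<not> p dvd hc i" using assms p_N p_prime by (simp add: hc_def prime_dvd_mult_iff)
  then show ?thesis using char by (simp add: of_nat_eq_0_iff_char_dvd)
qed

lemma hc_fact:
  assumes "3 * i \<le> 2 * N" "N \<le> 2 * i"
  shows "hc i * fact i * fact (2 * N - 3 * i) * fact (2 * i - N) = fact N"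
proof -
  have "N - i - (2 * N - 3 * i) = 2 * i - N" using assms by simp
  then have "fact (2 * N - 3 * i) * fact (2 * i - N) * ((N - i) choose (2 * N - 3 * i)) = fact (N - i)"
    using binomial_fact_lemma[of "2 * N - 3 * i" "N - i"] assms by simp
  moreover have "fact i * fact (N - i) * (N choose i) = fact N"
    using binomial_fact_lemma[of i N] assms by simp
  ultimately show ?thesis using assms by (simp add: hc_def ac_simps)
qed

text \<open>In the interior this is a quotient of factorials, with \<open>M = 2N - 3(i+1)\<close>
  equal to \<open>- (4 + 3 i)\<close> modulo \<open>p\<close>. At the end \<open>hc (Suc i)\<close>
  is 0 and the right side must vanish too: \<open>3 i = 2 N\<close> means
  \<open>3 i + 1 = p\<close>, \<open>3 i + 1 = 2 N\<close> means \<open>3 i + 2 = p\<close>, and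
  \<open>3 i + 2 = 2 N\<close> would make 3 divide \<open>p\<close>.\<close>

lemma hc_rec:
  assumes i: "N \<le> 2 * i"
  shows "(of_nat (2 * i - N) + 1) * (of_nat (2 * i - N) + 2) * (of_nat (hc (Suc i)) :: 'a)
       = - 3 * (3 * of_nat i + 1) * (3 * of_nat i + 2) * of_nat (hc i)"
proof -
  consider "3 * i > 2 * N" | "3 * i = 2 * N" | "3 * i + 1 = 2 * N" | "3 * i + 2 = 2 * N" | "3 * Suc i \<le> 2 * N"
  proof -
    have "3 * i > 2 * N \<or> 3 * i = 2 * N \<or> 3 * i + 1 = 2 * N \<or> 3 * i + 2 = 2 * N \<or> 3 * Suc i \<le> 2 * N"
      by presburger
    then show thesis using that by blast
  qed
  then show ?thesis
  proof cases
    case 1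
    then show ?thesis by (simp add: hc_def)
  next
    case 2
    then have "(of_nat (3 * i + 1) :: 'a) = of_nat (2 * N + 1)" by simp
    then have "3 * (of_nat i :: 'a) + 1 = 0" using of_nat_N by simp
    then show ?thesis using 2 by (simp add: hc_def)
  next
    case 3
    then have "3 * i + 2 = p" using p_N by simp
    then have "(of_nat (3 * i + 2) :: 'a) = 0" by (simp only: of_nat_p)
    then have "3 * (of_nat i :: 'a) + 2 = 0" by (simp add: add.commute)
    then show ?thesis using 3 by (simp add: hc_def)
  next
    case 4
    then have "p = 3 * Suc i" using p_N by simp
    then have "3 dvd p" by simp
    then have "p = 3" using p_prime by (metis prime_nat_iff numeral_eq_one_iff num.distinct(3))
    then show ?thesis using p_ge_5 by simp
  next
    case 5
    define M where "M = 2 * N - 3 * Suc i"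
    have M: "2 * N - 3 * i = Suc (Suc (Suc M))" "2 * N - 3 * Suc i = M" "2 * N = 3 * i + M + 3"
      using 5 unfolding M_def by presburger+
    define J where "J = 2 * i - N"
    have J: "2 * Suc i - N = Suc (Suc J)" using i by (simp add: J_def)
    have "hc i * fact i * fact (2 * N - 3 * i) * fact (2 * i - N) = fact N"
      by (rule hc_fact) (use 5 i in auto)
    moreover have "hc (Suc i) * fact (Suc i) * fact (2 * N - 3 * Suc i) * fact (2 * Suc i - N) = fact N"
      by (rule hc_fact) (use 5 i in auto)
    ultimately have "hc (Suc i) * fact (Suc i) * fact M * fact (Suc (Suc J))
        = hc i * fact i * fact (Suc (Suc (Suc M))) * fact J"
      unfolding M(1,2) J J_def[symmetric] by (simp only:)
    then have "(fact i * fact M * fact J) * (hc (Suc i) * Suc i * (Suc (Suc J) * Suc J))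
        = (fact i * fact M * fact J) * (hc i * (Suc (Suc (Suc M)) * Suc (Suc M) * Suc M))"
      by (simp only: fact_Suc of_nat_id ac_simps)
    then have "hc (Suc i) * Suc i * (Suc (Suc J) * Suc J) = hc i * (Suc (Suc (Suc M)) * Suc (Suc M) * Suc M)"
      by simp
    then have "of_nat (hc (Suc i)) * of_nat (Suc i) * (of_nat (Suc (Suc J)) * of_nat (Suc J))
        = (of_nat (hc i) * (of_nat (Suc (Suc (Suc M))) * of_nat (Suc (Suc M)) * of_nat (Suc M)) :: 'a)"
      by (simp only: of_nat_mult[symmetric])
    then have eq: "of_nat (hc (Suc i)) * (of_nat i + 1) * ((of_nat J + 2) * (of_nat J + 1))
        = (of_nat (hc i) * ((of_nat M + 3) * (of_nat M + 2) * (of_nat M + 1)) :: 'a)"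
      by (simp add: add.commute)
    have "2 * of_nat N = 3 * of_nat i + of_nat M + (3::'a)"
      using arg_cong[OF M(3), of "of_nat :: nat \<Rightarrow> 'a"] by simp
    then have Mf: "of_nat M = - (4 + 3 * of_nat i :: 'a)" using of_nat_N by Groebner_Basis.algebra
    have "(of_nat i + 1) * ((of_nat J + 1) * (of_nat J + 2) * of_nat (hc (Suc i))
        - (- 3 * (3 * of_nat i + 1) * (3 * of_nat i + 2) * of_nat (hc i))) = (0 :: 'a)"
      using eq unfolding Mf by Groebner_Basis.algebra
    moreover have "(of_nat i + 1 :: 'a) \<noteq> 0"
      using of_nat_nz[of "Suc i"] 5 p_N by (simp add: add.commute)
    ultimately show ?thesis unfolding J_def by simp
  qed
qed

text \<open>\<open>i0\<close> is the first index with \<open>2 i >= N\<close>. The term there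
  contributes \<open>a^M0 b^e\<close>, with \<open>b^e\<close> common to all terms and
  \<open>a^M0\<close> split off when \<open>a\<close> is nonzero.\<close>

definition "e = N mod 2"
definition "i0 = (N + e) div 2"
definition "M0 = 2 * N - 3 * i0"

lemma e_le_1: "e \<le> 1" by (simp add: e_def)

lemma N_i0: "2 * i0 = N + e" by (simp add: i0_def e_def mod2_eq_if)

lemma i0_le: "3 * i0 \<le> 2 * N"
proof -
  have "N \<ge> 3 * e" using N_ge_2 unfolding e_def by presburger
  then show ?thesis using N_i0 by linarith
qed

text \<open>The factor \<open>-4/27\<close> makes the variable \<open>- 27 b^2 / (4 a^3)\<close>,
  which equals 1 exactly when the discriminant vanishes; so the singular points are the standard 0
  and 1.\<close>

definition R :: "'a poly" where
  "R = (\<Sum>k\<le>N. monom (of_nat (hc (i0 + k)) * (- 4 / 27) ^ k) k)"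

lemma coeff_R: "coeff R k = of_nat (hc (i0 + k)) * (- 4 / 27) ^ k"
proof -
  have "coeff R k = (\<Sum>j\<le>N. if j = k then of_nat (hc (i0 + j)) * (- 4 / 27) ^ j else 0)"
    unfolding R_def coeff_sum coeff_monom by simp
  also have "\<dots> = of_nat (hc (i0 + k)) * (- 4 / 27) ^ k" by (auto simp: hc_def)
  finally show ?thesis .
qed

lemma degree_R: "degree R \<le> N"
  unfolding R_def by (intro degree_sum_le) (auto intro: order_trans[OF degree_monom_le])

lemma twelve: "(12::'a) \<noteq> 0" "(27::'a) \<noteq> 0" "(4::'a) \<noteq> 0"
proof -
  have "(2::'a) * (2 * 3) \<noteq> 0" "(3::'a) * (3 * 3) \<noteq> 0" "(2::'a) * 2 \<noteq> 0"
    using two three by (simp_all only: mult_eq_0_iff) auto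
  then show "(12::'a) \<noteq> 0" "(27::'a) \<noteq> 0" "(4::'a) \<noteq> 0" by simp_all
qed

text \<open>\<open>hc_rec\<close> at \<open>i = i0 + k\<close>, with \<open>4 i0 = 2 e - 1\<close>
  modulo \<open>p\<close>. As \<open>e^2 = e\<close>, the product \<open>(2k+e+1) (2k+e+2)\<close>
  is \<open>4 (k+1) (k+1/2+e)\<close>; the two factors on the other side become
  \<open>3 (k + (1+6e)/12)\<close> and \<open>3 (k + (5+6e)/12)\<close>.\<close>

lemma R_ode: "hyp_ode ((1 + 6 * of_nat e) / 12) ((5 + 6 * of_nat e) / 12) (1/2 + of_nat e) R"
  unfolding hyp_ode_iff
proof
  fix k
  let ?A = "(1 + 6 * of_nat e) / 12 :: 'a" and ?B = "(5 + 6 * of_nat e) / 12 :: 'a"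
  have J: "2 * (i0 + k) - N = 2 * k + e" using N_i0 by simp
  have r: "(2 * of_nat k + of_nat e + 1) * (2 * of_nat k + of_nat e + 2) * (of_nat (hc (i0 + Suc k)) :: 'a)
      = - 3 * (3 * of_nat (i0 + k) + 1) * (3 * of_nat (i0 + k) + 2) * of_nat (hc (i0 + k))"
    using hc_rec[of "i0 + k"] N_i0 unfolding J by simp
  have "2 * of_nat i0 = (of_nat N + of_nat e :: 'a)"
    using arg_cong[OF N_i0, of "of_nat :: nat \<Rightarrow> 'a"] by simp
  then have i4: "4 * of_nat i0 = (2 * of_nat e - 1 :: 'a)" using of_nat_N by Groebner_Basis.algebra
  define h where "h = (1/2 :: 'a)"
  have h: "2 * h = 1" using two by (simp add: h_def)
  define A where "A = ?A"
  define B where "B = ?B"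
  have A: "12 * A = 1 + 6 * of_nat e" and B: "12 * B = 5 + 6 * of_nat e"
    using twelve by (simp_all add: A_def B_def)
  define q where "q = (- 4 / 27 :: 'a)"
  have q: "27 * q = - 4" using twelve by (simp add: q_def)
  have ee: "(of_nat e :: 'a) * of_nat e = of_nat e" using e_le_1 by (cases e) auto
  define c1 where "c1 = (of_nat (hc (i0 + Suc k)) :: 'a)"
  define c0 where "c0 = (of_nat (hc (i0 + k)) :: 'a)"
  have r': "(2 * of_nat k + of_nat e + 1) * (2 * of_nat k + of_nat e + 2) * c1
      = - 3 * (3 * (of_nat i0 + of_nat k) + 1) * (3 * (of_nat i0 + of_nat k) + 2) * c0"
    using r by (simp add: c1_def c0_def)
  have "2 * 4 * 27 * 4 * ((of_nat k + 1) * (of_nat k + (h + of_nat e)) * (c1 * q)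
      - (of_nat k + A) * (of_nat k + B) * c0) = 0"
  proof -
    define K where "K = (of_nat k :: 'a)"
    define ef where "ef = (of_nat e :: 'a)"
    have 1: "(2 * K + ef + 1) * (2 * K + ef + 2) = 4 * (K + 1) * (K + (h + ef))"
      using h ee[folded ef_def] by Groebner_Basis.algebra
    have 2: "16 * (3 * (of_nat i0 + K) + 1) * (3 * (of_nat i0 + K) + 2) = 144 * ((K + A) * (K + B))"
      using i4[folded ef_def] A[folded ef_def] B[folded ef_def] by Groebner_Basis.algebra
    show ?thesis using r'[folded K_def ef_def] 1 2 q
      unfolding K_def[symmetric] ef_def[symmetric] by Groebner_Basis.algebra
  qed
  moreover have "(2 * 4 * 27 * 4 :: 'a) \<noteq> 0" using two twelve by (simp only: mult_eq_0_iff) auto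
  ultimately have "(of_nat k + 1) * (of_nat k + (h + of_nat e)) * (c1 * q)
      = (of_nat k + A) * (of_nat k + B) * c0" by (metis mult_eq_0_iff eq_iff_diff_eq_0)
  then have "(of_nat k + 1) * (of_nat k + (h + of_nat e)) * (c1 * q) * q ^ k
      = (of_nat k + A) * (of_nat k + B) * c0 * q ^ k" by simp
  then show "of_nat (Suc k) * (of_nat k + (1/2 + of_nat e)) * coeff R (Suc k)
      = (of_nat k + ?A) * (of_nat k + ?B) * coeff R k"
    unfolding coeff_R A_def[symmetric] B_def[symmetric] h_def[symmetric] q_def[symmetric]
      c0_def[symmetric] c1_def[symmetric] by (simp add: ac_simps)
qed

lemma exact_iff_R:
  assumes "a \<noteq> 0"
  shows "(\<exists>g. pderiv g = f ^ N) \<longleftrightarrow> b ^ e * poly R (- 27 * b ^ 2 / (4 * a ^ 3)) = 0"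
proof -
  have "degree (f ^ N) = 3 * N" by (simp add: degree_power_eq f_nz degree_f)
  then have "(\<exists>g. pderiv g = f ^ N) \<longleftrightarrow> coeff (f ^ N) (p - 1) = 0"
    using p_N N_ge_2 by (intro exact_iff_coeff) simp
  also have "coeff (f ^ N) (p - 1) = (\<Sum>i\<in>{i0..i0+N}. of_nat (hc i) * a ^ (2 * N - 3 * i) * b ^ (2 * i - N))"
    unfolding hasse_coeff
  proof (rule sum.mono_neutral_cong)
    fix i assume "i \<in> {..N} - {i0..i0 + N}"
    then have "2 * i < N" using N_i0 e_le_1 by auto
    then have "hc i = 0" by (simp add: hc_def)
    then show "of_nat (hc i) * a ^ (2 * N - 3 * i) * b ^ (2 * i - N) = 0" by simp
  next
    fix i assume "i \<in> {i0..i0 + N} - {..N}"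
    then have "hc i = 0" by (simp add: hc_def)
    then show "of_nat (hc i) * a ^ (2 * N - 3 * i) * b ^ (2 * i - N) = 0" by simp
  qed auto
  also have "\<dots> = (\<Sum>k\<le>N. of_nat (hc (i0 + k)) * a ^ (2 * N - 3 * (i0 + k)) * b ^ (2 * (i0 + k) - N))"
    using sum.shift_bounds_cl_nat_ivl[of "\<lambda>i. of_nat (hc i) * a ^ (2 * N - 3 * i) * b ^ (2 * i - N)" 0 i0 N]
    by (simp add: add.commute atMost_atLeast0)
  also have "\<dots> = (\<Sum>k\<le>N. a ^ M0 * b ^ e * (of_nat (hc (i0 + k)) * (b ^ 2 / a ^ 3) ^ k))"
  proof (intro sum.cong refl)
    fix k
    show "of_nat (hc (i0 + k)) * a ^ (2 * N - 3 * (i0 + k)) * b ^ (2 * (i0 + k) - N)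
       = a ^ M0 * b ^ e * (of_nat (hc (i0 + k)) * (b ^ 2 / a ^ 3) ^ k)"
    proof (cases "3 * (i0 + k) \<le> 2 * N")
      case True
      then have "a ^ (2 * N - 3 * (i0 + k)) * (a ^ 3) ^ k = a ^ M0"
        by (simp add: M0_def flip: power_mult power_add)
      then have "a ^ (2 * N - 3 * (i0 + k)) = a ^ M0 / (a ^ 3) ^ k"
        using assms by (simp add: field_simps)
      moreover have "b ^ (2 * (i0 + k) - N) = b ^ e * (b ^ 2) ^ k"
        using N_i0 by (simp flip: power_mult power_add add: add_mult_distrib2)
      ultimately show ?thesis by (simp add: power_divide)
    qed (simp add: hc_def)
  qed
  also have "\<dots> = a ^ M0 * (b ^ e * poly R (- 27 * b ^ 2 / (4 * a ^ 3)))"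
  proof -
    have "(- 4 / 27) * (- 27 * b ^ 2 / (4 * a ^ 3)) = b ^ 2 / a ^ 3"
    proof -
      have "(- 4 / 27) * (- 27 * b ^ 2 / (4 * a ^ 3)) = (4 * 27) * b ^ 2 / ((4 * 27) * a ^ 3)" by simp
      also have "\<dots> = b ^ 2 / a ^ 3"
        using twelve by (subst mult_divide_mult_cancel_left) (simp_all only: mult_eq_0_iff, auto)
      finally show ?thesis .
    qed
    then have "(- 4 / 27) ^ k * (- 27 * b ^ 2 / (4 * a ^ 3)) ^ k = (b ^ 2 / a ^ 3) ^ k" for k
      by (simp only: power_mult_distrib[symmetric])
    then have "poly R (- 27 * b ^ 2 / (4 * a ^ 3)) = (\<Sum>k\<le>N. of_nat (hc (i0 + k)) * (b ^ 2 / a ^ 3) ^ k)"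
      unfolding R_def poly_sum poly_monom by (simp only: mult.assoc)
    then show ?thesis by (simp add: sum_distrib_left mult.assoc)
  qed
  finally show ?thesis using assms by simp
qed

text \<open>The variable of \<open>R\<close> is undefined for \<open>a = 0\<close>, that is
  \<open>j = 0\<close>. There only the term with \<open>3 i = 2 N\<close> survives, and it exists
  only if 3 divides \<open>N\<close>.\<close>

lemma exact_iff_a_0:
  assumes "a = 0" shows "(\<exists>g. pderiv g = f ^ N) \<longleftrightarrow> \<not> 3 dvd N"
proof -
  have b: "b \<noteq> 0" using disc assms by auto
  have "degree (f ^ N) = 3 * N" by (simp add: degree_power_eq f_nz degree_f)
  then have "(\<exists>g. pderiv g = f ^ N) \<longleftrightarrow> coeff (f ^ N) (p - 1) = 0"
    using p_N N_ge_2 by (intro exact_iff_coeff) simp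
  also have "coeff (f ^ N) (p - 1)
      = (\<Sum>i\<le>N. if 3 * i = 2 * N then of_nat (hc i) * b ^ (2 * i - N) else 0)"
    unfolding hasse_coeff by (intro sum.cong refl) (auto simp: assms power_0_left hc_def)
  also have "\<dots> = (if 3 dvd N then of_nat (hc (2 * (N div 3))) * b ^ (2 * (2 * (N div 3)) - N) else 0)"
  proof (cases "3 dvd N")
    case True
    then have "3 * i = 2 * N \<longleftrightarrow> i = 2 * (N div 3)" for i by auto
    moreover have "2 * (N div 3) \<le> N" by simp
    ultimately show ?thesis using True by simp
  next
    case False
    then have "3 * i \<noteq> 2 * N" for i by presburger
    then show ?thesis using False by simp
  qed
  also have "\<dots> = 0 \<longleftrightarrow> \<not> 3 dvd N"
    using hc_nz[of "2 * (N div 3)"] b by auto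
  finally show ?thesis .
qed

end

section \<open>The supersingular polynomial\<close>

lemma monic_squarefree_eq_prod_roots:
  fixes S :: "'a::alg_closed_field poly"
  assumes "monic S" "\<And>x. poly S x = 0 \<Longrightarrow> poly (pderiv S) x \<noteq> 0"
  shows "S = (\<Prod>x\<in>{x. poly S x = 0}. [:- x, 1:])"
  using assms
proof (induction "degree S" arbitrary: S)
  case 0
  then have "S = 1" using monic_degree_0 by metis
  then show ?case by simp
next
  case (Suc n)
  then obtain x where x: "poly S x = 0" using alg_closed_imp_poly_has_root[of S] by auto
  then obtain T where T: "S = lin x * T" by (metis lin_dvd_iff dvdE)
  have T0: "T \<noteq> 0" using Suc.prems(1) T by auto
  have "lead_coeff T = 1" using Suc.prems(1) unfolding T lead_coeff_mult by (simp add: lin_def)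
  moreover have "n = degree T" using Suc.hyps(2) T0 by (simp add: T degree_mult_eq)
  moreover have pd: "pderiv S = T + lin x * pderiv T"
    unfolding T pderiv_mult by (simp add: lin_def pderiv_pCons algebra_simps)
  have Tx: "poly T x \<noteq> 0" using Suc.prems(2)[OF x] by (simp add: pd)
  moreover have "poly (pderiv T) y \<noteq> 0" if "poly T y = 0" for y
  proof -
    have "poly S y = 0" using that by (simp add: T)
    then show ?thesis using Suc.prems(2)[of y] that by (simp add: pd)
  qed
  ultimately have "T = (\<Prod>x\<in>{x. poly T x = 0}. [:- x, 1:])" using Suc.hyps(1) by metis
  moreover have "{y. poly S y = 0} = insert x {y. poly T y = 0}" by (auto simp: T)
  moreover have "finite {y. poly T y = 0}" using T0 by (rule poly_roots_finite)
  ultimately show ?case using Tx by (simp add: T[unfolded lin_def] del: mult_pCons_left)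
qed

text \<open>For primes \<open>p >= 5\<close>, \<open>hyp12_e\<close> and \<open>hyp12_d\<close>
  agree with \<open>eps\<close> and \<open>delta\<close>; residues are easier to match with
  \<open>p div 12\<close> than Legendre symbols.\<close>

definition hyp12_e :: "nat \<Rightarrow> nat" where "hyp12_e p = (if p mod 12 < 6 then 0 else 1)"

definition hyp12_d :: "nat \<Rightarrow> nat" where "hyp12_d p = (if p mod 3 = 1 then 0 else 1)"

text \<open>
  Of the parameters \<open>1/12, 5/12\<close> or \<open>7/12, 11/12\<close>, the one congruent to \<open>- (p div 12)\<close>
  is called \<open>A\<close>; it makes the series terminate.
\<close>

definition hyp12_A :: "nat \<Rightarrow> 'a::field" where "hyp12_A p = of_nat (p mod 12) / 12"

definition hyp12_B :: "nat \<Rightarrow> 'a::field" where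
  "hyp12_B p = of_nat (6 + 12 * hyp12_e p - p mod 12) / 12"

definition hyp12 :: "nat \<Rightarrow> 'a::field poly" where
  "hyp12 p = hyp_trunc (p div 12) (hyp12_B p)"

text \<open>Deuring's closed form, over an arbitrary field of characteristic
  \<open>p\<close>.\<close>

definition ss_hyp :: "nat \<Rightarrow> 'a::field poly" where
  "ss_hyp p = [:- 1728, 1:] ^ hyp12_e p * homog (p div 12 + hyp12_d p) 1728 (hyp12 p)"

lemma prime_ge_5_not_dvd:
  fixes p :: nat
  assumes "Factorial_Ring.prime p" "p \<ge> 5" shows "\<not> 2 dvd p" "\<not> 3 dvd p"
proof -
  have *: "m = 1 \<or> m = p" if "m dvd p" for m using assms(1) that prime_nat_iff by auto
  show "\<not> 2 dvd p" "\<not> 3 dvd p" using *[of 2] *[of 3] assms(2) by auto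
qed

lemma prime_mod_12:
  fixes p :: nat
  assumes "Factorial_Ring.prime p" "p \<ge> 5"
  shows "p mod 12 = 1 \<or> p mod 12 = 5 \<or> p mod 12 = 7 \<or> p mod 12 = 11"
  using prime_ge_5_not_dvd[OF assms] by presburger

context
  fixes p :: nat
  assumes char: "CHAR('a::field) = p" and pr: "Factorial_Ring.prime p" and ge5: "p \<ge> 5"
begin

lemma of_nat_less_nz: "0 < n \<Longrightarrow> n < p \<Longrightarrow> (of_nat n :: 'a) \<noteq> 0"
  using char by (auto simp: of_nat_eq_0_iff_char_dvd dest: dvd_imp_le)

lemma two_three_nz: "(2::'a) \<noteq> 0" "(3::'a) \<noteq> 0"
  using of_nat_less_nz[of 2] of_nat_less_nz[of 3] ge5 by auto

lemma smooth_nz: "(4::'a) \<noteq> 0" "(12::'a) \<noteq> 0" "(27::'a) \<noteq> 0" "(1728::'a) \<noteq> 0"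
proof -
  have "(2::'a) * 2 \<noteq> 0" "(2::'a) * (2 * 3) \<noteq> 0" "(3::'a) * (3 * 3) \<noteq> 0"
    "(2::'a) * (2 * 3) * ((2 * (2 * 3)) * (2 * (2 * 3))) \<noteq> 0"
    using two_three_nz by (simp_all only: mult_eq_0_iff) auto
  then show "(4::'a) \<noteq> 0" "(12::'a) \<noteq> 0" "(27::'a) \<noteq> 0" "(1728::'a) \<noteq> 0" by simp_all
qed

lemma hyp12_A_eq: "hyp12_A p = - (of_nat (p div 12) :: 'a)"
proof -
  have "of_nat (12 * (p div 12) + p mod 12) = (of_nat CHAR('a) :: 'a)"
    unfolding mult_div_mod_eq by (simp only: char)
  then have "12 * of_nat (p div 12) + of_nat (p mod 12) = (0::'a)"
    by (simp only: of_nat_add of_nat_mult of_nat_numeral of_nat_CHAR)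
  then have "of_nat (p mod 12) = 12 * - (of_nat (p div 12) :: 'a)" by (simp add: eq_neg_iff_add_eq_0 add.commute)
  then show ?thesis using smooth_nz by (simp add: hyp12_A_def)
qed

lemma hyp12_e_le: "hyp12_e p \<le> 1" by (simp add: hyp12_e_def)

lemma hyp12_sum: "hyp12_A p + hyp12_B p = (1/2 + of_nat (hyp12_e p) :: 'a)"
proof -
  have "p mod 12 \<le> 6 + 12 * hyp12_e p" using prime_mod_12[OF pr ge5] by (auto simp: hyp12_e_def)
  then have "hyp12_A p + hyp12_B p = (6 + 12 * of_nat (hyp12_e p)) / (12 :: 'a)"
    unfolding hyp12_A_def hyp12_B_def by (simp add: of_nat_diff add_divide_distrib[symmetric])
  also have "\<dots> = 6 / 12 + of_nat (hyp12_e p)" using smooth_nz by (simp add: add_divide_distrib)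
  also have "(6 / 12 :: 'a) = 1 / 2"
    by (subst frac_eq_eq) (use smooth_nz two_three_nz in auto)
  finally show ?thesis .
qed

lemma hyp12_ode: "hyp_ode (hyp12_A p) (hyp12_B p) 1 (hyp12 p :: 'a poly)"
  unfolding hyp12_A_eq hyp12_def by (rule hyp_trunc_ode) (use char ge5 in simp)

lemma degree_hyp12: "degree (hyp12 p :: 'a poly) \<le> p div 12"
  unfolding hyp12_def by (rule degree_hyp_trunc)

lemma coeff_hyp12_0: "coeff (hyp12 p :: 'a poly) 0 = 1"
  unfolding hyp12_def by (rule coeff_hyp_trunc_0)

text \<open>The numerators of \<open>hyp12_B p + i\<close> are positive and below \<open>p\<close>.
  This coefficient controls the order of \<open>ss_hyp\<close> at \<open>X = 0\<close>.\<close>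

lemma lead_coeff_hyp12: "coeff (hyp12 p :: 'a poly) (p div 12) \<noteq> 0"
  unfolding hyp12_def
proof (rule lead_coeff_hyp_trunc)
  fix i assume i: "i < p div 12"
  define s where "s = 6 + 12 * hyp12_e p - p mod 12"
  have s: "0 < s" "s < 12" using prime_mod_12[OF pr ge5] by (auto simp: s_def hyp12_e_def)
  have "s + 12 * i < p" using s i by (simp add: less_eq_div_iff_mult_less_eq)
  then have "(of_nat (s + 12 * i) :: 'a) \<noteq> 0" using s by (intro of_nat_less_nz) auto
  moreover have "12 * (hyp12_B p + of_nat i) = (of_nat (s + 12 * i) :: 'a)"
    using smooth_nz by (simp add: hyp12_B_def s_def[symmetric] distrib_left)
  ultimately show "hyp12_B p + of_nat i \<noteq> (0::'a)" by (metis mult_zero_right)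
qed (use char pr ge5 in auto)

text \<open>Reflection makes the value at 1 a constant coefficient for the equation with
  \<open>c = 1/2 + e\<close>. Since \<open>2 n + 1 + 2 e < p\<close> in the relevant range, its
  vanishing would kill the whole polynomial.\<close>

lemma hyp12_at_1: "poly (hyp12 p :: 'a poly) 1 \<noteq> 0"
proof
  let ?G = "pcompose (hyp12 p) [:1, -1 :: 'a:]"
  assume "poly (hyp12 p :: 'a poly) 1 = 0"
  then have 0: "coeff ?G 0 = 0" by (simp add: coeff_pcompose_0)
  have "hyp_ode (hyp12_A p) (hyp12_B p) (1/2 + of_nat (hyp12_e p)) ?G"
    using hyp_ode_reflect[OF hyp12_ode] by (simp add: hyp12_sum)
  then have "?G = 0"
  proof (rule hyp_ode_eq_0I[OF _ 0])
    fix n assume "n < degree ?G"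
    then have "n < p div 12" using degree_hyp12 by (simp add: degree_pcompose)
    then have n: "Suc n < p" "2 * n + 1 + 2 * hyp12_e p < p" using hyp12_e_le by auto
    have "(of_nat (Suc n) :: 'a) \<noteq> 0" using n by (intro of_nat_less_nz) auto
    moreover have "2 * (of_nat n + (1/2 + of_nat (hyp12_e p))) = (of_nat (2 * n + 1 + 2 * hyp12_e p) :: 'a)"
      using two_three_nz by (simp add: distrib_left)
    moreover have "(of_nat (2 * n + 1 + 2 * hyp12_e p) :: 'a) \<noteq> 0" using n by (intro of_nat_less_nz) auto
    ultimately show "of_nat (Suc n) * (of_nat n + (1/2 + of_nat (hyp12_e p))) \<noteq> (0 :: 'a)"
      by (metis mult_eq_0_iff)
  qed
  then have "(hyp12 p :: 'a poly) = 0" by (rule pcompose_eq_0) simp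
  then show False using coeff_hyp12_0 by simp
qed

lemma hyp12_simple_root:
  assumes "poly (hyp12 p) z = 0" "z \<noteq> (0::'a)" shows "poly (pderiv (hyp12 p)) z \<noteq> 0"
proof
  assume "poly (pderiv (hyp12 p)) z = 0"
  moreover have "z \<noteq> 1" using assms hyp12_at_1 by auto
  moreover have "(of_nat n :: 'a) \<noteq> 0" if "0 < n" "n \<le> degree (hyp12 p :: 'a poly)" for n
    using that degree_hyp12 ge5 by (intro of_nat_less_nz) auto
  ultimately have "(hyp12 p :: 'a poly) = 0" using assms hyp_ode_simple_root[OF hyp12_ode] by blast
  then show False using coeff_hyp12_0 by simp
qed

lemma monic_ss_hyp: "monic (ss_hyp p :: 'a poly)"
proof -
  let ?k = "p div 12 + hyp12_d p"
  have c: "coeff (homog ?k 1728 (hyp12 p)) ?k = (1::'a)"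
    by (simp add: coeff_homog coeff_hyp12_0)
  then have "degree (homog ?k 1728 (hyp12 p :: 'a poly)) = ?k"
    using degree_homog[of ?k 1728 "hyp12 p :: 'a poly"] by (intro antisym le_degree) auto
  then have "monic (homog ?k 1728 (hyp12 p :: 'a poly))" using c by simp
  then show ?thesis unfolding ss_hyp_def lead_coeff_mult lead_coeff_power by simp
qed

lemma ss_hyp_at_0: "poly (ss_hyp p) (0::'a) = 0 \<longleftrightarrow> hyp12_d p = 1"
proof -
  have "poly (homog k 1728 F) 0 = coeff F k * 1728 ^ k" for k and F :: "'a poly"
    by (simp add: poly_0_coeff_0 coeff_homog)
  moreover have "coeff (hyp12 p :: 'a poly) (Suc (p div 12)) = 0"
    using degree_hyp12 by (intro coeff_eq_0) simp
  ultimately show ?thesis using lead_coeff_hyp12 smooth_nz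
    by (auto simp: ss_hyp_def hyp12_d_def)
qed

lemma poly_ss_hyp:
  assumes "x \<noteq> (0::'a)"
  shows "poly (ss_hyp p) x = (x - 1728) ^ hyp12_e p * (x ^ (p div 12 + hyp12_d p) * poly (hyp12 p) (1728 / x))"
  using assms degree_hyp12 by (simp add: ss_hyp_def poly_power poly_homog)

text \<open>At 0 simplicity rests on the top coefficient of \<open>hyp12\<close>, at 1728 on its
  value at 1, and elsewhere on the differential equation, transferred through
  \<open>z = 1728 / X\<close> by \<open>pderiv_homog\<close>.\<close>

lemma ss_hyp_simple_root:
  assumes "poly (ss_hyp p) x = (0::'a)" shows "poly (pderiv (ss_hyp p)) x \<noteq> 0"
proof
  assume der: "poly (pderiv (ss_hyp p)) x = 0"
  let ?k = "p div 12 + hyp12_d p"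
  let ?T = "homog ?k 1728 (hyp12 p) :: 'a poly" and ?U = "[:- 1728, 1:] ^ hyp12_e p :: 'a poly"
  have S: "ss_hyp p = ?U * ?T" by (simp add: ss_hyp_def)
  consider "x = 0" | "x = 1728" | "x \<noteq> 0" "x \<noteq> 1728" by blast
  then show False
  proof cases
    case 1
    then have d: "hyp12_d p = 1" using assms ss_hyp_at_0 by simp
    then have "?T = homog (p div 12) 1728 (hyp12 p) * [:0, 1:]"
      using homog_add[OF degree_hyp12, of 1 1728] by (simp add: monom_altdef)
    then have "ss_hyp p = [:0, 1:] * (?U * homog (p div 12) 1728 (hyp12 p))" by (simp add: S)
    then have "pderiv (ss_hyp p) = ?U * homog (p div 12) 1728 (hyp12 p)
        + [:0, 1:] * pderiv (?U * homog (p div 12) 1728 (hyp12 p))"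
      by (simp only: pderiv_mult) (simp add: pderiv_pCons)
    then have "poly (pderiv (ss_hyp p)) x
        = (- 1728) ^ hyp12_e p * (coeff (hyp12 p) (p div 12) * 1728 ^ (p div 12))"
    proof -
      have "poly (homog (p div 12) 1728 (hyp12 p :: 'a poly)) 0 = coeff (hyp12 p) (p div 12) * 1728 ^ (p div 12)"
        by (simp add: poly_0_coeff_0 coeff_homog)
      then show ?thesis using 1 \<open>pderiv (ss_hyp p) = _\<close> by (simp add: poly_power)
    qed
    then show False using der lead_coeff_hyp12 smooth_nz by simp
  next
    case 2
    then have T: "poly ?T x \<noteq> 0"
      using smooth_nz hyp12_at_1 degree_hyp12 by (simp add: poly_homog)
    then have "poly ?U x = 0" using assms by (simp add: S)
    then have "hyp12_e p = 1" using hyp12_e_le by (cases "hyp12_e p") auto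
    then have "poly (pderiv (ss_hyp p)) x = poly ?T x"
      unfolding S pderiv_mult using 2 by (simp add: pderiv_pCons)
    then show False using der T by simp
  next
    case 3
    then have U: "poly ?U x \<noteq> 0" by (simp add: poly_power)
    then have T: "poly ?T x = 0" using assms 3 by (simp add: S poly_power)
    have "poly ?U x * poly (pderiv ?T) x = 0" using der T unfolding S pderiv_mult by simp
    then have T': "poly (pderiv ?T) x = 0" using U by (metis mult_eq_0_iff)
    have "poly (homog ?k 1728 ([:0, 1:] * pderiv (hyp12 p))) x = 0"
      using arg_cong[OF pderiv_homog[of "hyp12 p :: 'a poly" ?k 1728], of "\<lambda>G. poly G x"] degree_hyp12 T T'
      by simp
    moreover have "degree ([:0, 1:] * pderiv (hyp12 p :: 'a poly)) \<le> ?k"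
    proof (cases "pderiv (hyp12 p :: 'a poly) = 0")
      case False
      then have "degree (hyp12 p :: 'a poly) \<noteq> 0"
        by (metis degree_eq_zeroE pderiv_0 pderiv_pCons pderiv_singleton)
      then show ?thesis
        using degree_mult_le[of "[:0, 1:]" "pderiv (hyp12 p :: 'a poly)"]
          degree_pderiv_le[of "hyp12 p :: 'a poly"] degree_hyp12 by simp
    qed simp
    ultimately have "poly ([:0, 1:] * pderiv (hyp12 p)) (1728 / x) = 0"
      using 3 poly_homog by fastforce
    then have "poly (pderiv (hyp12 p)) (1728 / x) = 0" using 3 smooth_nz by simp
    moreover have "poly (hyp12 p) (1728 / x) = 0"
      using T 3 degree_hyp12 by (simp add: poly_homog)
    ultimately show False using hyp12_simple_root 3 smooth_nz by simp
  qed
qed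

end

lemma hyp_ode_swap: "hyp_ode A B c F \<longleftrightarrow> hyp_ode B A c F"
  by (simp add: hyp_ode_def ac_simps)

lemma half_mod_12:
  assumes "p mod 12 = 1 \<or> p mod 12 = 5 \<or> p mod 12 = 7 \<or> p mod 12 = 11"
  shows "((p - 1) div 2) mod 2 = hyp12_e p \<and> (3 dvd (p - 1) div 2 \<longleftrightarrow> hyp12_d p = 0)"
proof -
  define q where "q = p div 12"
  have *: "p = 12 * q + r" if "p mod 12 = r" for r by (simp add: q_def flip: that)
  from assms consider "p mod 12 = 1" | "p mod 12 = 5" | "p mod 12 = 7" | "p mod 12 = 11" by blast
  then show ?thesis
  proof cases
    case 1
    have h: "(p - 1) div 2 = 0 + 2 * (3 * q)" "(p - 1) div 2 = 0 + 3 * (2 * q)"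
      "p = 1 + 12 * q" "p = 1 + 3 * (4 * q)" by (simp_all add: *[OF 1])
    have "((p - 1) div 2) mod 2 = 0 mod 2" unfolding h(1) by (rule mod_mult_self2)
    moreover have "((p - 1) div 2) mod 3 = 0 mod 3" unfolding h(2) by (rule mod_mult_self2)
    moreover have "p mod 12 = 1 mod 12" unfolding h(3) by (rule mod_mult_self2)
    moreover have "p mod 3 = 1 mod 3" unfolding h(4) by (rule mod_mult_self2)
    ultimately show ?thesis unfolding hyp12_e_def hyp12_d_def dvd_eq_mod_eq_0 by (simp only:) simp
  next
    case 2
    have h: "(p - 1) div 2 = 2 + 2 * (3 * q)" "(p - 1) div 2 = 2 + 3 * (2 * q)"
      "p = 5 + 12 * q" "p = 5 + 3 * (4 * q)" by (simp_all add: *[OF 2])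
    have "((p - 1) div 2) mod 2 = 2 mod 2" unfolding h(1) by (rule mod_mult_self2)
    moreover have "((p - 1) div 2) mod 3 = 2 mod 3" unfolding h(2) by (rule mod_mult_self2)
    moreover have "p mod 12 = 5 mod 12" unfolding h(3) by (rule mod_mult_self2)
    moreover have "p mod 3 = 5 mod 3" unfolding h(4) by (rule mod_mult_self2)
    ultimately show ?thesis unfolding hyp12_e_def hyp12_d_def dvd_eq_mod_eq_0 by (simp only:) simp
  next
    case 3
    have h: "(p - 1) div 2 = 3 + 2 * (3 * q)" "(p - 1) div 2 = 3 + 3 * (2 * q)"
      "p = 7 + 12 * q" "p = 7 + 3 * (4 * q)" by (simp_all add: *[OF 3])
    have "((p - 1) div 2) mod 2 = 3 mod 2" unfolding h(1) by (rule mod_mult_self2)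
    moreover have "((p - 1) div 2) mod 3 = 3 mod 3" unfolding h(2) by (rule mod_mult_self2)
    moreover have "p mod 12 = 7 mod 12" unfolding h(3) by (rule mod_mult_self2)
    moreover have "p mod 3 = 7 mod 3" unfolding h(4) by (rule mod_mult_self2)
    ultimately show ?thesis unfolding hyp12_e_def hyp12_d_def dvd_eq_mod_eq_0 by (simp only:) simp
  next
    case 4
    have h: "(p - 1) div 2 = 5 + 2 * (3 * q)" "(p - 1) div 2 = 5 + 3 * (2 * q)"
      "p = 11 + 12 * q" "p = 11 + 3 * (4 * q)" by (simp_all add: *[OF 4])
    have "((p - 1) div 2) mod 2 = 5 mod 2" unfolding h(1) by (rule mod_mult_self2)
    moreover have "((p - 1) div 2) mod 3 = 5 mod 3" unfolding h(2) by (rule mod_mult_self2)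
    moreover have "p mod 12 = 11 mod 12" unfolding h(3) by (rule mod_mult_self2)
    moreover have "p mod 3 = 11 mod 3" unfolding h(4) by (rule mod_mult_self2)
    ultimately show ?thesis unfolding hyp12_e_def hyp12_d_def dvd_eq_mod_eq_0 by (simp only:) simp
  qed
qed

section \<open>Supersingularity as a condition on j\<close>

context short_curve
begin

lemma e_eq: "e = hyp12_e p" and three_dvd_N: "3 dvd N \<longleftrightarrow> hyp12_d p = 0"
proof -
  have "e = hyp12_e p \<and> (3 dvd N \<longleftrightarrow> hyp12_d p = 0)"
    unfolding e_def N_def using prime_mod_12[OF p_prime p_ge_5] by (rule half_mod_12)
  then show "e = hyp12_e p" "3 dvd N \<longleftrightarrow> hyp12_d p = 0" by simp_all
qed

text \<open>Both polynomials solve the equation with \<open>c = 1\<close> and have degree at most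
  \<open>N < p\<close>, so the combination without constant term is 0. The factor is nonzero since
  \<open>R\<close> has the nonzero constant coefficient \<open>hc i0\<close>.\<close>

lemma reflected_R: "\<exists>k. k \<noteq> 0 \<and> pcompose R [:1, -1:] = smult k (hyp12 p)"
proof -
  let ?G = "pcompose R [:1, -1:]"
  have G1: "hyp_ode ((1 + 6 * of_nat e) / 12) ((5 + 6 * of_nat e) / 12) 1 ?G"
  proof -
    have "(1 + 6 * of_nat e) / 12 + (5 + 6 * of_nat e) / 12 = (6 + 12 * of_nat e) / (12 :: 'a)"
      by (simp add: add_divide_distrib[symmetric])
    also have "\<dots> = 6 / 12 + of_nat e" using twelve by (simp add: add_divide_distrib)
    also have "(6 / 12 :: 'a) = 1 / 2" by (subst frac_eq_eq) (use twelve two in auto)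
    finally have s: "(1 + 6 * of_nat e) / 12 + (5 + 6 * of_nat e) / 12 = (1 / 2 + of_nat e :: 'a)" .
    show ?thesis using hyp_ode_reflect[OF R_ode] unfolding s by simp
  qed
  have G: "hyp_ode (hyp12_A p) (hyp12_B p) 1 ?G"
  proof -
    \<comment> \<open>Which of the two parameters terminates the series depends on
      \<open>p mod 12\<close>; the equation is symmetric in them.\<close>
    have "(hyp12_A p = ((1 + 6 * of_nat e) / 12 :: 'a) \<and> hyp12_B p = ((5 + 6 * of_nat e) / 12 :: 'a))
        \<or> (hyp12_B p = ((1 + 6 * of_nat e) / 12 :: 'a) \<and> hyp12_A p = ((5 + 6 * of_nat e) / 12 :: 'a))"
      using prime_mod_12[OF p_prime p_ge_5]
      by (auto simp: hyp12_A_def hyp12_B_def e_eq hyp12_e_def)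
    then show ?thesis using G1 hyp_ode_swap by metis
  qed
  let ?D = "smult 1 ?G - smult (coeff ?G 0) (hyp12 p)"
  have "hyp_ode (hyp12_A p) (hyp12_B p) 1 ?D"
    by (intro hyp_ode_diff G hyp12_ode[OF char p_prime p_ge_5])
  then have "?D = 0"
  proof (rule hyp_ode_eq_0I)
    show "coeff ?D 0 = 0" by (simp add: coeff_hyp12_0[OF char p_prime p_ge_5])
    fix n assume n: "n < degree ?D"
    have "degree (hyp12 p :: 'a poly) \<le> N"
      using degree_hyp12[OF char p_prime p_ge_5] p_N by linarith
    then have "degree ?D \<le> N"
      using degree_R by (intro degree_diff_le) (auto simp: degree_pcompose intro: order_trans[OF degree_smult_le])
    then have "(of_nat (Suc n) :: 'a) \<noteq> 0" using n p_N by (intro of_nat_nz) auto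
    then show "of_nat (Suc n) * (of_nat n + 1) \<noteq> (0::'a)" by (simp add: add.commute)
  qed
  then have eq: "?G = smult (coeff ?G 0) (hyp12 p)"
    by (simp only: smult_1_left right_minus_eq)
  moreover have "coeff ?G 0 \<noteq> 0"
  proof
    assume "coeff ?G 0 = 0"
    then have "?G = 0" using eq by (metis smult_0_left)
    then have "R = 0" by (rule pcompose_eq_0) simp
    then have "(of_nat (hc i0) :: 'a) = 0" using coeff_R[of 0] by simp
    then show False using hc_nz[of i0] i0_le N_i0 by simp
  qed
  ultimately show ?thesis by blast
qed

lemma supersingular_iff_ss_hyp:
  "supersingular E \<longleftrightarrow> poly (ss_hyp p) (1728 * (4 * a ^ 3) / (4 * a ^ 3 + 27 * b ^ 2)) = 0"
proof (cases "a = 0")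
  case True
  then show ?thesis
    using ss_hyp_at_0[OF char p_prime p_ge_5] exact_iff_a_0 three_dvd_N supersingular_iff_exact
    by (auto simp: hyp12_d_def)
next
  case False
  let ?D = "4 * a ^ 3 + 27 * b ^ 2"
  define j where "j = 1728 * (4 * a ^ 3) / ?D"
  have c: "(1728::'a) \<noteq> 0" using smooth_nz[OF char p_prime p_ge_5] by simp
  have a4: "4 * a ^ 3 \<noteq> 0" using False twelve by simp
  have j0: "j \<noteq> 0" using a4 c disc unfolding j_def by (metis divide_eq_0_iff mult_eq_0_iff)
  define x where "x = - 27 * b ^ 2 / (4 * a ^ 3)"
  \<comment> \<open>This explains the reflection: \<open>j = 1728 / (1 - x)\<close>.\<close>
  have z: "1728 / j = 1 - x"
  proof -
    have "1728 / j = (1728 * ?D) / (1728 * (4 * a ^ 3))" unfolding j_def by simp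
    also have "\<dots> = ?D / (4 * a ^ 3)" using c by (rule mult_divide_mult_cancel_left)
    also have "\<dots> = 1 - x" using a4 by (simp add: x_def add_divide_distrib)
    finally show ?thesis .
  qed
  \<comment> \<open>\<open>j - 1728\<close> is a nonzero multiple of \<open>b^2\<close>, so the root
    at 1728 corresponds to the factor \<open>b^e\<close>.\<close>
  have j1728: "(j - 1728) ^ hyp12_e p = 0 \<longleftrightarrow> b ^ e = 0"
  proof -
    have "(j - 1728) * ?D = - 1728 * 27 * b ^ 2"
    proof -
      have "j * ?D = 1728 * (4 * a ^ 3)" using disc by (simp add: j_def)
      then show ?thesis by Groebner_Basis.algebra
    qed
    then have "j - 1728 = 0 \<longleftrightarrow> b = 0" using disc c twelve
      by (metis mult_eq_0_iff neg_equal_0_iff_equal power_eq_0_iff zero_less_numeral)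
    then show ?thesis by (simp add: e_eq)
  qed
  obtain k where k: "k \<noteq> 0" "pcompose R [:1, -1:] = smult k (hyp12 p)" using reflected_R by blast
  have "poly R x = poly (pcompose R [:1, -1:]) (1 - x)" by (simp add: poly_pcompose)
  also have "\<dots> = k * poly (hyp12 p) (1728 / j)" by (simp add: k z)
  finally have R: "poly R x = k * poly (hyp12 p) (1728 / j)" .
  have "supersingular E \<longleftrightarrow> b ^ e * poly R x = 0"
    unfolding x_def supersingular_iff_exact by (rule exact_iff_R[OF False])
  also have "\<dots> \<longleftrightarrow> poly (ss_hyp p) j = 0"
    unfolding poly_ss_hyp[OF char p_prime p_ge_5 j0] R mult_eq_0_iff j1728[symmetric]
    using k(1) j0 by auto
  finally show ?thesis unfolding j_def .
qed

end

lemma supersingular_iff_ss_hyp_j: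
  fixes E :: "'a::alg_closed_field wcurve"
  assumes char: "CHAR('a) = p" and p: "Factorial_Ring.prime p" "p \<ge> 5" and E: "elliptic_curve E"
  shows "supersingular E \<longleftrightarrow> poly (ss_hyp p) (j_invariant E) = 0"
proof -
  obtain a b where ab: "supersingular E \<longleftrightarrow> supersingular (WCurve 0 0 0 a b)"
    and d: "wdisc E = - 16 * (4 * a ^ 3 + 27 * b ^ 2)" and c: "wc4 E = - 48 * a"
    using weierstrass_to_short[OF two_three_nz[OF char p], of E] .
  have "4 * a ^ 3 + 27 * b ^ 2 \<noteq> 0"
  proof
    assume "4 * a ^ 3 + 27 * b ^ 2 = 0"
    then have "wdisc E = 0" unfolding d by (simp only: mult_zero_right)
    then show False using E by (simp add: elliptic_curve_def)
  qed
  then interpret short_curve a b p by (rule short_curve.intro[OF char p])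
  have "j_invariant E = (- 16 * (1728 * (4 * a ^ 3))) / (- 16 * (4 * a ^ 3 + 27 * b ^ 2))"
    unfolding j_invariant_def c d by (simp add: power_mult_distrib)
  also have "\<dots> = 1728 * (4 * a ^ 3) / (4 * a ^ 3 + 27 * b ^ 2)"
  proof (rule mult_divide_mult_cancel_left)
    have "(4::'a) * 4 \<noteq> 0" using twelve by (simp only: mult_eq_0_iff) simp
    then show "- 16 \<noteq> (0::'a)" by simp
  qed
  finally show ?thesis using ab supersingular_iff_ss_hyp by (simp add: E_def)
qed

text \<open>Ensures that each root of \<open>ss_hyp\<close> is the j-invariant of some curve, which
  is then supersingular.\<close>

lemma exists_elliptic_curve_j:
  fixes j :: "'a::field"
  assumes char: "CHAR('a) = p" and p: "Factorial_Ring.prime p" "p \<ge> 5"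
  shows "\<exists>E. elliptic_curve E \<and> j_invariant E = j"
proof -
  note nz = smooth_nz[OF char p] two_three_nz[OF char p]
  have sixteen: "(16::'a) \<noteq> 0"
  proof -
    have "(4::'a) * 4 \<noteq> 0" using nz by (simp only: mult_eq_0_iff) simp
    then show ?thesis by simp
  qed
  have E: "elliptic_curve (WCurve 0 0 0 a b) \<and> j_invariant (WCurve 0 0 0 a b) = j"
    if D: "4 * a ^ 3 + 27 * b ^ 2 \<noteq> 0" and j: "1728 * (4 * a ^ 3) = j * (4 * a ^ 3 + 27 * b ^ 2)" for a b :: 'a
  proof -
    have d: "wdisc (WCurve 0 0 0 a b) = - (16 * (4 * a ^ 3 + 27 * b ^ 2))"
      by (simp add: wdisc_def wb2_def wb4_def wb6_def wb8_def power2_eq_square power3_eq_cube)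
    have "wc4 (WCurve 0 0 0 a b) = - (48 * a)" by (simp add: wc4_def wb2_def wb4_def)
    then have "wc4 (WCurve 0 0 0 a b) ^ 3 = j * wdisc (WCurve 0 0 0 a b)"
      unfolding d using j by Groebner_Basis.algebra
    moreover have "wdisc (WCurve 0 0 0 a b) \<noteq> 0" unfolding d using D sixteen
      by (metis mult_eq_0_iff neg_equal_0_iff_equal)
    ultimately show ?thesis by (simp add: elliptic_curve_def j_invariant_def)
  qed
  consider "j = 0" | "j = 1728" | "j \<noteq> 0" "j \<noteq> 1728" by blast
  then show ?thesis
  proof cases
    case 1
    then show ?thesis using E[of 0 1] nz by auto
  next
    case 2
    then show ?thesis using E[of 1 0] nz by auto
  next
    case 3
    \<comment> \<open>On the family \<open>a = b = t\<close> the equation for j becomes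
      \<open>1728 * 4 t = j (4 t + 27)\<close>, that is \<open>t = 27 j / u\<close>.\<close>
    define u where "u = 4 * (1728 - j)"
    have u: "u \<noteq> 0" unfolding u_def using 3 nz by (metis mult_eq_0_iff eq_iff_diff_eq_0)
    define t where "t = 27 * j / u"
    have tu: "t * u = 27 * j" using u by (simp add: t_def)
    have t: "t \<noteq> 0" unfolding t_def using 3 nz u by (metis mult_eq_0_iff divide_eq_0_iff)
    have "(4 * t + 27) * u = 4 * 27 * 1728" using tu unfolding u_def by Groebner_Basis.algebra
    moreover have "(4 * 27 * 1728 :: 'a) \<noteq> 0" using nz by (metis mult_eq_0_iff)
    ultimately have s: "4 * t + 27 \<noteq> 0" by (metis mult_zero_left)
    have "4 * t ^ 3 + 27 * t ^ 2 = t ^ 2 * (4 * t + 27)" by Groebner_Basis.algebra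
    then have "4 * t ^ 3 + 27 * t ^ 2 \<noteq> 0" using s t by (metis mult_eq_0_iff power_eq_0_iff)
    moreover have "1728 * (4 * t ^ 3) = j * (4 * t ^ 3 + 27 * t ^ 2)"
      using tu unfolding u_def by Groebner_Basis.algebra
    ultimately show ?thesis using E by blast
  qed
qed

theorem ss_poly_ac_eq:
  assumes "CARD('p::prime_card) \<ge> 5"
  shows "(ss_poly_ac :: 'p mod_ring alg_closure poly) = ss_hyp CARD('p)"
proof -
  have char: "CHAR('p mod_ring alg_closure) = CARD('p)" by simp
  have pr: "Factorial_Ring.prime CARD('p)" by (rule prime_card)
  have "(supersingular_j :: 'p mod_ring alg_closure set) = {x. poly (ss_hyp CARD('p)) x = 0}"
  proof (rule Set.set_eqI)
    fix x :: "'p mod_ring alg_closure"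
    show "x \<in> supersingular_j \<longleftrightarrow> x \<in> {x. poly (ss_hyp CARD('p)) x = 0}"
      unfolding supersingular_j_def mem_Collect_eq
      using supersingular_iff_ss_hyp_j[OF char pr assms] exists_elliptic_curve_j[OF char pr assms, of x]
      by metis
  qed
  then show ?thesis
    unfolding ss_poly_ac_def
    using monic_squarefree_eq_prod_roots[OF monic_ss_hyp[OF char pr assms] ss_hyp_simple_root[OF char pr assms]]
    by simp
qed

section \<open>Legendre symbols from roots of unity\<close>

text \<open>Euler's criterion says \<open>t^p = (a/p) t\<close> for a square root \<open>t\<close>
  of \<open>a\<close>; both signs being in -1, 0, 1, congruence modulo \<open>p\<close> is equality.
  For \<open>t\<close> built from roots of unity, Frobenius depends only on a residue of
  \<open>p\<close>.\<close>

lemma legendre_by_square_root: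
  fixes t :: "'p::prime_card mod_ring alg_closure"
  assumes p: "CARD('p) \<ge> 5" and t: "t ^ 2 = of_int a" "t \<noteq> 0"
    and s: "frob t = of_int s * t" "s = 1 \<or> s = -1"
  shows "Legendre a (int CARD('p)) = s"
proof -
  let ?p = "CARD('p)"
  have pr: "Factorial_Ring.prime ?p" by (rule prime_card)
  have "odd ?p" using pr p prime_odd_nat[of ?p] by simp
  then obtain n where n: "?p = 2 * n + 1" by (rule oddE)
  have "[Legendre a (int ?p) = a ^ n] (mod int ?p)"
    using euler_criterion[of ?p a] pr p n by simp
  then have "of_int (Legendre a (int ?p)) = (of_int (a ^ n) :: 'p mod_ring alg_closure)"
    unfolding of_int_eq_iff_cong_CHAR by simp
  then have "of_int (Legendre a (int ?p)) = t ^ (2 * n)"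
    by (simp add: power_mult t)
  moreover have "t ^ (2 * n) * t = of_int s * t" using s(1) n by (simp add: frob_def)
  ultimately have "of_int (Legendre a (int ?p)) = (of_int s :: 'p mod_ring alg_closure)"
    using t(2) by simp
  then have "[Legendre a (int ?p) = s] (mod int ?p)"
    unfolding of_int_eq_iff_cong_CHAR by simp
  then have dv: "int ?p dvd Legendre a (int ?p) - s" by (simp add: cong_iff_dvd_diff)
  have L: "Legendre a (int ?p) \<in> {0, 1, -1}" by (auto simp: Legendre_def)
  have "\<bar>Legendre a (int ?p) - s\<bar> < int ?p" using L s(2) p by auto
  then have "Legendre a (int ?p) - s = 0" using dv by (metis abs_of_nat dvd_imp_le_int not_less)
  then show ?thesis by simp
qed

lemma power_mod_eq:
  fixes x :: "'a::monoid_mult"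
  assumes "x ^ n = 1" shows "x ^ k = x ^ (k mod n)"
proof -
  have "x ^ k = x ^ (n * (k div n) + k mod n)" by simp
  also have "\<dots> = x ^ (k mod n)" by (simp only: power_add power_mult assms power_one mult_1_left)
  finally show ?thesis .
qed

lemma eps_eq:
  assumes p: "CARD('p::prime_card) \<ge> 5"
  shows "eps CARD('p) = (if CARD('p) mod 4 = 1 then 0 else 1)"
proof -
  have "\<exists>x :: 'p mod_ring alg_closure. poly [:1, 0, 1:] x = 0"
    by (rule alg_closed_imp_poly_has_root) simp
  then obtain x :: "'p mod_ring alg_closure" where x: "x ^ 2 = - 1"
    by (auto simp: power2_eq_square eq_neg_iff_add_eq_0 add.commute)
  have x0: "x \<noteq> 0" using x by auto
  have "x ^ 4 = (x ^ 2) ^ 2" by (simp flip: power_mult)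
  then have x4: "x ^ 4 = 1" by (simp add: x)
  have "CARD('p) mod 4 = 1 \<or> CARD('p) mod 4 = 3"
    using prime_ge_5_not_dvd[OF prime_card p] by presburger
  then show ?thesis
  proof
    assume m: "CARD('p) mod 4 = 1"
    then have "frob x = of_int 1 * x" using power_mod_eq[OF x4, of "CARD('p)"] by (simp add: frob_def)
    then have "Legendre (- 1) (int CARD('p)) = 1"
      by (intro legendre_by_square_root[OF p _ x0]) (simp_all add: x)
    then show ?thesis using m by (simp add: eps_def)
  next
    assume m: "CARD('p) mod 4 = 3"
    then have "frob x = of_int (- 1) * x"
      using power_mod_eq[OF x4, of "CARD('p)"] x by (simp add: frob_def power3_eq_cube power2_eq_square)
    then have "Legendre (- 1) (int CARD('p)) = - 1"
      by (intro legendre_by_square_root[OF p _ x0]) (simp_all add: x)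
    then show ?thesis using m by (simp add: eps_def)
  qed
qed

lemma delta_eq:
  assumes p: "CARD('p::prime_card) \<ge> 5"
  shows "delta CARD('p) = (if CARD('p) mod 3 = 1 then 0 else 1)"
proof -
  have "\<exists>x :: 'p mod_ring alg_closure. poly [:1, 1, 1:] x = 0"
    by (rule alg_closed_imp_poly_has_root) simp
  then obtain x :: "'p mod_ring alg_closure" where "1 + x * (1 + x) = 0" by auto
  then have x: "1 + x + x ^ 2 = 0" by (simp add: power2_eq_square algebra_simps)
  \<comment> \<open>With \<open>x\<close> a primitive cube root of unity, this is a square root of
    -3; Frobenius fixes or inverts \<open>x\<close>.\<close>
  define t where "t = 2 * x + 1"
  have t2: "t ^ 2 = of_int (- 3)" using x unfolding t_def by (simp, Groebner_Basis.algebra)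
  have "(3 :: 'p mod_ring alg_closure) \<noteq> 0"
    by (rule two_three_nz(2)[of "CARD('p)"]) (use p prime_card in auto)
  then have t0: "t \<noteq> 0" using t2 by auto
  have x3: "x ^ 3 = 1" using x by Groebner_Basis.algebra
  have ft: "frob t = 2 * frob x + 1"
    by (simp add: t_def frob_hom)
  have "CARD('p) mod 3 = 1 \<or> CARD('p) mod 3 = 2"
    using prime_ge_5_not_dvd[OF prime_card p] by presburger
  then show ?thesis
  proof
    assume m: "CARD('p) mod 3 = 1"
    then have "frob x = x" using power_mod_eq[OF x3, of "CARD('p)"] by (simp add: frob_def)
    then have "frob t = of_int 1 * t" unfolding ft by (simp add: t_def)
    then have "Legendre (- 3) (int CARD('p)) = 1"
      by (intro legendre_by_square_root[OF p t2 t0]) simp_all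
    then show ?thesis using m by (simp add: delta_def)
  next
    assume m: "CARD('p) mod 3 = 2"
    then have fx: "frob x = x ^ 2" using power_mod_eq[OF x3, of "CARD('p)"] by (simp add: frob_def)
    have "frob t = - t" using x unfolding ft fx unfolding t_def by Groebner_Basis.algebra
    then have "frob t = of_int (- 1) * t" by simp
    then have "Legendre (- 3) (int CARD('p)) = - 1"
      by (intro legendre_by_square_root[OF p t2 t0]) simp_all
    then show ?thesis using m by (simp add: delta_def)
  qed
qed

lemma nu_eq:
  assumes p: "CARD('p::prime_card) \<ge> 5"
  shows "nu CARD('p) = (if CARD('p) mod 8 = 1 \<or> CARD('p) mod 8 = 3 then 0 else 1)"
proof -
  have "\<exists>x :: 'p mod_ring alg_closure. poly [:1, 0, 0, 0, 1:] x = 0"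
    by (rule alg_closed_imp_poly_has_root) simp
  then obtain x :: "'p mod_ring alg_closure" where "1 + x * (x * (x * x)) = 0" by auto
  then have x: "x ^ 4 = - 1" by (simp add: power4_eq_xxxx eq_neg_iff_add_eq_0 add.commute mult.assoc)
  \<comment> \<open>With \<open>x\<close> a primitive eighth root of unity, this is a square root of
    -2, fixed by \<open>x -> x^3\<close>.\<close>
  define t where "t = x + x ^ 3"
  have t2: "t ^ 2 = of_int (- 2)" using x unfolding t_def by (simp, Groebner_Basis.algebra)
  have "(2 :: 'p mod_ring alg_closure) \<noteq> 0"
    by (rule two_three_nz(1)[of "CARD('p)"]) (use p prime_card in auto)
  then have t0: "t \<noteq> 0" using t2 by auto
  have "x ^ 8 = (x ^ 4) ^ 2" by (simp flip: power_mult)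
  then have x8: "x ^ 8 = 1" by (simp add: x)
  have ft: "frob t = frob x + frob x ^ 3"
    by (simp add: t_def frob_hom)
  have fx: "frob x = x ^ (CARD('p) mod 8)" using power_mod_eq[OF x8, of "CARD('p)"] by (simp add: frob_def)
  have "CARD('p) mod 8 = 1 \<or> CARD('p) mod 8 = 3 \<or> CARD('p) mod 8 = 5 \<or> CARD('p) mod 8 = 7"
    using prime_ge_5_not_dvd[OF prime_card p] by presburger
  then consider "CARD('p) mod 8 = 1 \<or> CARD('p) mod 8 = 3" | "CARD('p) mod 8 = 5 \<or> CARD('p) mod 8 = 7" by blast
  then show ?thesis
  proof cases
    case 1
    have "(x ^ 3) ^ 3 = (x ^ 4) ^ 2 * x" by (simp flip: power_mult power_Suc2)
    then have "x + x ^ 3 = t" "x ^ 3 + (x ^ 3) ^ 3 = t" by (simp_all add: t_def x add.commute)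
    then have "frob t = of_int 1 * t" using 1 unfolding ft fx by auto
    then have "Legendre (- 2) (int CARD('p)) = 1"
      by (intro legendre_by_square_root[OF p t2 t0]) simp_all
    then show ?thesis using 1 by (auto simp: nu_def)
  next
    case 2
    have "x ^ 5 = x ^ 4 * x" "x ^ 7 = x ^ 4 * x ^ 3"
      by (simp_all flip: power_add power_Suc2)
    then have "x ^ 5 = - x" "x ^ 7 = - (x ^ 3)" by (simp_all add: x)
    moreover have "(x ^ 3) ^ 3 = (x ^ 4) ^ 2 * x" by (simp flip: power_mult power_Suc2)
    then have "(x ^ 3) ^ 3 = x" by (simp add: x)
    ultimately have "x ^ 5 + (x ^ 5) ^ 3 = - t" "x ^ 7 + (x ^ 7) ^ 3 = - t"
      by (simp_all add: t_def power3_eq_cube)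
    then have "frob t = of_int (- 1) * t" using 2 unfolding ft fx by auto
    then have "Legendre (- 2) (int CARD('p)) = - 1"
      by (intro legendre_by_square_root[OF p t2 t0]) simp_all
    then show ?thesis using 2 by (auto simp: nu_def)
  qed
qed

section \<open>Products of binomial coefficients\<close>

lemma binomial_fact_product:
  "((k + l) choose k) * (fact k * fact l) = (fact (k + l) :: nat)"
  using binomial_fact_lemma[of k "k + l"] by (simp add: mult.commute)

lemma choose_236_fact:
  "(2 * n choose n) * (3 * n choose n) * (6 * n choose (3 * n)) * (fact n ^ 3 * fact (3 * n)) = (fact (6 * n) :: nat)"
proof -
  have e: "2 * n = n + n" "3 * n = n + 2 * n" "6 * n = 3 * n + 3 * n" by simp_all
  have 1: "(2 * n choose n) * (fact n * fact n) = (fact (2 * n) :: nat)"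
    using binomial_fact_product[of n n] by (simp add: e(1)[symmetric])
  have 2: "(3 * n choose n) * (fact n * fact (2 * n)) = (fact (3 * n) :: nat)"
    using binomial_fact_product[of n "2 * n"] by (simp add: e(2)[symmetric])
  have 3: "(6 * n choose (3 * n)) * (fact (3 * n) * fact (3 * n)) = (fact (6 * n) :: nat)"
    using binomial_fact_product[of "3 * n" "3 * n"] by (simp add: e(3)[symmetric])
  have "(fact (2 * n) * fact (3 * n)) * ((2 * n choose n) * (3 * n choose n) * (6 * n choose (3 * n)) * (fact n ^ 3 * fact (3 * n)))
    = ((2 * n choose n) * (fact n * fact n)) * ((3 * n choose n) * (fact n * fact (2 * n)))
      * ((6 * n choose (3 * n)) * (fact (3 * n) * fact (3 * n)))"
    by (simp only: power3_eq_cube ac_simps)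
  also have "\<dots> = (fact (2 * n) * fact (3 * n)) * fact (6 * n)" unfolding 1 2 3 by (simp only: ac_simps)
  finally show ?thesis by (simp only: mult_cancel1) simp
qed

lemma choose_224_fact: "(2 * n choose n) ^ 2 * (4 * n choose (2 * n)) * fact n ^ 4 = (fact (4 * n) :: nat)"
proof -
  have e: "2 * n = n + n" "4 * n = 2 * n + 2 * n" by simp_all
  have 1: "(2 * n choose n) * (fact n * fact n) = (fact (2 * n) :: nat)"
    using binomial_fact_product[of n n] by (simp add: e(1)[symmetric])
  have 2: "(4 * n choose (2 * n)) * (fact (2 * n) * fact (2 * n)) = (fact (4 * n) :: nat)"
    using binomial_fact_product[of "2 * n" "2 * n"] by (simp add: e(2)[symmetric])
  have "(2 * n choose n) ^ 2 * (4 * n choose (2 * n)) * fact n ^ 4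
    = (4 * n choose (2 * n)) * (((2 * n choose n) * (fact n * fact n)) * ((2 * n choose n) * (fact n * fact n)))"
    by (simp only: power2_eq_square power4_eq_xxxx ac_simps)
  then show ?thesis unfolding 1 2 .
qed

lemma choose_223_fact:
  "(2 * n choose n) ^ 2 * (3 * n choose n) * fact n ^ 5 = (fact (2 * n) * fact (3 * n) :: nat)"
proof -
  have e: "2 * n = n + n" "3 * n = n + 2 * n" by simp_all
  have 1: "(2 * n choose n) * (fact n * fact n) = (fact (2 * n) :: nat)"
    using binomial_fact_product[of n n] by (simp add: e(1)[symmetric])
  have 2: "(3 * n choose n) * (fact n * fact (2 * n)) = (fact (3 * n) :: nat)"
    using binomial_fact_product[of n "2 * n"] by (simp add: e(2)[symmetric])
  have "fact n ^ 5 = (fact n * fact n * (fact n * fact n) * fact n :: nat)"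
    by (simp add: numeral_eq_Suc ac_simps)
  then have "fact (2 * n) * ((2 * n choose n) ^ 2 * (3 * n choose n) * fact n ^ 5)
    = ((2 * n choose n) * (fact n * fact n)) * ((2 * n choose n) * (fact n * fact n))
      * ((3 * n choose n) * (fact n * fact (2 * n)))"
    by (simp only: power2_eq_square ac_simps)
  also have "\<dots> = fact (2 * n) * (fact (2 * n) * fact (3 * n))" unfolding 1 2 by (simp only: ac_simps)
  finally show ?thesis by (simp only: mult_cancel1) simp
qed

lemma choose_236_rec:
  fixes T :: "nat \<Rightarrow> nat"
  defines "T \<equiv> \<lambda>n. (2 * n choose n) * (3 * n choose n) * (6 * n choose (3 * n))"
  shows "Suc n ^ 3 * T (Suc n) = 8 * (6 * n + 1) * (6 * n + 3) * (6 * n + 5) * T n"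
proof -
  let ?q = "(3 * n + 1) * (3 * n + 2) * (3 * n + 3)"
  have f3: "fact (3 * Suc n) = ?q * (fact (3 * n) :: nat)"
  proof -
    have "fact (3 * n + 3) = (3 * n + 3) * (fact (3 * n + 2) :: nat)"
      "fact (3 * n + 2) = (3 * n + 2) * (fact (3 * n + 1) :: nat)"
      "fact (3 * n + 1) = (3 * n + 1) * (fact (3 * n) :: nat)"
      by (subst fact_reduce; simp)+
    moreover have "3 * Suc n = 3 * n + 3" by simp
    ultimately show ?thesis by (simp only: ac_simps)
  qed
  have f6: "fact (6 * Suc n) = (6 * n + 6) * (6 * n + 5) * (6 * n + 4) * (6 * n + 3) * (6 * n + 2) * (6 * n + 1) * (fact (6 * n) :: nat)"
  proof -
    have "fact (6 * n + 6) = (6 * n + 6) * (fact (6 * n + 5) :: nat)"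
      "fact (6 * n + 5) = (6 * n + 5) * (fact (6 * n + 4) :: nat)"
      "fact (6 * n + 4) = (6 * n + 4) * (fact (6 * n + 3) :: nat)"
      "fact (6 * n + 3) = (6 * n + 3) * (fact (6 * n + 2) :: nat)"
      "fact (6 * n + 2) = (6 * n + 2) * (fact (6 * n + 1) :: nat)"
      "fact (6 * n + 1) = (6 * n + 1) * (fact (6 * n) :: nat)"
      by (subst fact_reduce; simp)+
    moreover have "6 * Suc n = 6 * n + 6" by simp
    ultimately show ?thesis by (simp only: mult.assoc)
  qed
  have "(fact n ^ 3 * fact (3 * n) * ?q) * (Suc n ^ 3 * T (Suc n)) = T (Suc n) * (fact (Suc n) ^ 3 * fact (3 * Suc n))"
    unfolding f3 fact_Suc of_nat_id power_mult_distrib by (simp only: ac_simps)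
  also have "\<dots> = fact (6 * Suc n)" unfolding T_def by (rule choose_236_fact)
  also have "\<dots> = 8 * (6 * n + 1) * (6 * n + 3) * (6 * n + 5) * ?q * fact (6 * n)"
  proof -
    \<comment> \<open>The three even factors cancel against those of \<open>(3n+3)!\<close>, leaving
      the 8.\<close>
    have "6 * n + 6 = 2 * (3 * n + 3)" "6 * n + 4 = 2 * (3 * n + 2)" "6 * n + 2 = 2 * (3 * n + 1)" by simp_all
    then have "fact (6 * Suc n) = (2 * 2 * 2) * (6 * n + 1) * (6 * n + 3) * (6 * n + 5) * ?q * (fact (6 * n) :: nat)"
      unfolding f6 by (simp only: ac_simps)
    then show ?thesis by simp
  qed
  also have "fact (6 * n) = T n * (fact n ^ 3 * fact (3 * n))"
    unfolding T_def by (rule choose_236_fact[symmetric])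
  also have "8 * (6 * n + 1) * (6 * n + 3) * (6 * n + 5) * ?q * (T n * (fact n ^ 3 * fact (3 * n)))
      = (fact n ^ 3 * fact (3 * n) * ?q) * (8 * (6 * n + 1) * (6 * n + 3) * (6 * n + 5) * T n)"
    by (simp only: ac_simps)
  finally show ?thesis by (simp only: mult_cancel1) simp
qed

lemma choose_224_rec:
  fixes T :: "nat \<Rightarrow> nat"
  defines "T \<equiv> \<lambda>n. (2 * n choose n) ^ 2 * (4 * n choose (2 * n))"
  shows "Suc n ^ 3 * T (Suc n) = 4 * (4 * n + 1) * (4 * n + 2) * (4 * n + 3) * T n"
proof -
  have f4: "fact (4 * Suc n) = (4 * Suc n) * (4 * n + 3) * (4 * n + 2) * (4 * n + 1) * (fact (4 * n) :: nat)"
  proof -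
    have "fact (4 * n + 4) = (4 * n + 4) * (fact (4 * n + 3) :: nat)"
      "fact (4 * n + 3) = (4 * n + 3) * (fact (4 * n + 2) :: nat)"
      "fact (4 * n + 2) = (4 * n + 2) * (fact (4 * n + 1) :: nat)"
      "fact (4 * n + 1) = (4 * n + 1) * (fact (4 * n) :: nat)"
      by (subst fact_reduce; simp)+
    moreover have "4 * Suc n = 4 * n + 4" by simp
    ultimately show ?thesis by (simp only: mult.assoc)
  qed
  have "x ^ 4 = x * x ^ 3" for x :: nat by (simp add: power4_eq_xxxx power3_eq_cube)
  from this[of "Suc n"] have "Suc n ^ 4 = Suc n * Suc n ^ 3" .
  then have "(fact n ^ 4 * Suc n) * (Suc n ^ 3 * T (Suc n)) = T (Suc n) * fact (Suc n) ^ 4"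
    unfolding fact_Suc of_nat_id power_mult_distrib by (simp only: ac_simps)
  also have "\<dots> = fact (4 * Suc n)" unfolding T_def by (rule choose_224_fact)
  also have "\<dots> = (4 * Suc n) * (4 * n + 3) * (4 * n + 2) * (4 * n + 1) * (T n * fact n ^ 4)"
    unfolding f4 T_def by (simp only: choose_224_fact)
  also have "\<dots> = (fact n ^ 4 * Suc n) * (4 * (4 * n + 1) * (4 * n + 2) * (4 * n + 3) * T n)"
    by (simp only: ac_simps)
  finally show ?thesis by (simp only: mult_cancel1) simp
qed

lemma choose_223_rec:
  fixes T :: "nat \<Rightarrow> nat"
  defines "T \<equiv> \<lambda>n. (2 * n choose n) ^ 2 * (3 * n choose n)"
  shows "Suc n ^ 3 * T (Suc n) = 6 * (2 * n + 1) * (3 * n + 1) * (3 * n + 2) * T n"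
proof -
  have f2: "fact (2 * Suc n) = (2 * Suc n) * (2 * n + 1) * (fact (2 * n) :: nat)"
  proof -
    have "fact (2 * n + 2) = (2 * n + 2) * (fact (2 * n + 1) :: nat)"
      "fact (2 * n + 1) = (2 * n + 1) * (fact (2 * n) :: nat)"
      by (subst fact_reduce; simp)+
    moreover have "2 * Suc n = 2 * n + 2" by simp
    ultimately show ?thesis by (simp only: mult.assoc)
  qed
  have f3: "fact (3 * Suc n) = (3 * Suc n) * (3 * n + 2) * (3 * n + 1) * (fact (3 * n) :: nat)"
  proof -
    have "fact (3 * n + 3) = (3 * n + 3) * (fact (3 * n + 2) :: nat)"
      "fact (3 * n + 2) = (3 * n + 2) * (fact (3 * n + 1) :: nat)"
      "fact (3 * n + 1) = (3 * n + 1) * (fact (3 * n) :: nat)"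
      by (subst fact_reduce; simp)+
    moreover have "3 * Suc n = 3 * n + 3" by simp
    ultimately show ?thesis by (simp only: mult.assoc)
  qed
  have pow: "x ^ 5 = x * x * x ^ 3" for x :: nat by (simp add: numeral_eq_Suc)
  have "Suc n ^ 5 = Suc n * Suc n * Suc n ^ 3"
    using pow[of "Suc n"] by blast
  then have "(fact n ^ 5 * (Suc n * Suc n)) * (Suc n ^ 3 * T (Suc n)) = T (Suc n) * fact (Suc n) ^ 5"
    unfolding fact_Suc of_nat_id power_mult_distrib by (simp only: ac_simps)
  also have "\<dots> = fact (2 * Suc n) * fact (3 * Suc n)" unfolding T_def by (rule choose_223_fact)
  also have "\<dots> = (2 * Suc n) * (2 * n + 1) * ((3 * Suc n) * (3 * n + 2) * (3 * n + 1)) * (fact (2 * n) * fact (3 * n))"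
    unfolding f2 f3 by (simp only: ac_simps)
  also have "fact (2 * n) * fact (3 * n) = T n * fact n ^ 5"
    unfolding T_def by (rule choose_223_fact[symmetric])
  also have "(2 * Suc n) * (2 * n + 1) * ((3 * Suc n) * (3 * n + 2) * (3 * n + 1)) * (T n * fact n ^ 5)
      = (fact n ^ 5 * (Suc n * Suc n)) * ((2 * 3) * (2 * n + 1) * (3 * n + 1) * (3 * n + 2) * T n)"
    by (simp only: ac_simps)
  finally show ?thesis by (simp only: mult_cancel1) simp
qed

section \<open>Reduction modulo p and the three identities\<close>

text \<open>A relation allowing any denominator prime to \<open>p\<close> passes through sums and
  products directly, whereas \<open>rat_mod\<close> refers to lowest terms.\<close>

definition reduces_to :: "rat \<Rightarrow> 'p::prime_card mod_ring \<Rightarrow> bool" where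
  "reduces_to r x \<longleftrightarrow>
     (\<exists>a b. \<not> int CARD('p) dvd b \<and> r = of_int a / of_int b \<and> x = of_int a / of_int b)"

lemma reduces_toI:
  "\<not> int CARD('p) dvd b \<Longrightarrow> reduces_to (of_int a / of_int b) (of_int a / of_int b :: 'p::prime_card mod_ring)"
  by (auto simp: reduces_to_def)

lemma reduces_to_imp_rat_mod: "reduces_to r x \<Longrightarrow> rat_mod r = x"
  by (auto simp: reduces_to_def rat_mod_divide)

lemma reduces_to_of_int: "reduces_to (of_int a) (of_int a :: 'p::prime_card mod_ring)"
proof -
  have "\<not> int CARD('p) dvd 1" using prime_card[where ?'a = 'p] by auto
  from reduces_toI[OF this, of a] show ?thesis by simp
qed

lemma reduces_to_of_nat: "reduces_to (of_nat n) (of_nat n)"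
  using reduces_to_of_int[of "int n"] by simp

lemma reduces_to_0: "reduces_to 0 0" and reduces_to_1: "reduces_to 1 1"
  using reduces_to_of_int[of 0] reduces_to_of_int[of 1] by simp_all

lemma
  fixes x y :: "'p::prime_card mod_ring"
  assumes "reduces_to r x" "reduces_to s y"
  shows reduces_to_add: "reduces_to (r + s) (x + y)"
    and reduces_to_mult: "reduces_to (r * s) (x * y)"
proof -
  obtain a b where 1: "r = of_int a / of_int b" "x = of_int a / of_int b" "\<not> int CARD('p) dvd b"
    using assms(1) by (auto simp: reduces_to_def)
  obtain c d where 2: "s = of_int c / of_int d" "y = of_int c / of_int d" "\<not> int CARD('p) dvd d"
    using assms(2) by (auto simp: reduces_to_def)
  have nz: "(of_int b :: 'p mod_ring) \<noteq> 0" "(of_int d :: 'p mod_ring) \<noteq> 0"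
    using 1(3) 2(3) by (simp_all add: of_int_eq_0_iff_char_dvd)
  then have "(of_int (b * d) :: 'p mod_ring) \<noteq> 0" by simp
  then have bd: "\<not> int CARD('p) dvd b * d" unfolding of_int_eq_0_iff_char_dvd by simp
  have "b \<noteq> 0" "d \<noteq> 0" using 1(3) 2(3) by auto
  then have nzq: "(of_int b :: rat) \<noteq> 0" "(of_int d :: rat) \<noteq> 0" by simp_all
  have "r + s = of_int (a * d + c * b) / of_int (b * d)"
    unfolding 1(1) 2(1) of_int_add of_int_mult by (rule add_frac_eq[OF nzq])
  moreover have "x + y = of_int (a * d + c * b) / of_int (b * d)"
    unfolding 1(2) 2(2) of_int_add of_int_mult by (rule add_frac_eq[OF nz])
  moreover have "r * s = of_int (a * c) / of_int (b * d)" "x * y = of_int (a * c) / of_int (b * d)"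
    unfolding 1(1,2) 2(1,2) of_int_mult by (rule times_divide_times_eq)+
  ultimately show "reduces_to (r + s) (x + y)" "reduces_to (r * s) (x * y)"
    by (simp_all only: reduces_toI[OF bd])
qed

lemma reduces_to_sum:
  "(\<And>i. i \<in> S \<Longrightarrow> reduces_to (g i) (h i)) \<Longrightarrow> reduces_to (sum g S) (sum h S)"
  by (induction S rule: infinite_finite_induct) (simp_all add: reduces_to_0 reduces_to_add)

lemma reduces_to_power: "reduces_to r x \<Longrightarrow> reduces_to (r ^ n) (x ^ n)"
  by (induction n) (simp_all add: reduces_to_1 reduces_to_mult)

lemma reduces_to_pochhammer: "reduces_to r x \<Longrightarrow> reduces_to (pochhammer r n) (pochhammer x n)"
  by (induction n)
     (simp_all add: reduces_to_1 pochhammer_Suc reduces_to_mult reduces_to_add reduces_to_of_nat)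

lemma reduces_to_divide:
  assumes "reduces_to r (x :: 'p::prime_card mod_ring)" "\<not> CARD('p) dvd k"
  shows "reduces_to (r / of_nat k) (x / of_nat k)"
proof -
  have "\<not> int CARD('p) dvd int k" using assms(2) by simp
  from reduces_to_mult[OF assms(1) reduces_toI[OF this, of 1]] show ?thesis by simp
qed

definition poly_reduces_to :: "rat poly \<Rightarrow> 'p::prime_card mod_ring poly \<Rightarrow> bool" where
  "poly_reduces_to F G \<longleftrightarrow> (\<forall>n. reduces_to (coeff F n) (coeff G n))"

lemma poly_reduces_to_imp_map_poly:
  fixes G :: "'p::prime_card mod_ring poly"
  assumes "poly_reduces_to F G" shows "map_poly rat_mod F = G"
proof (rule poly_eqI)
  fix n
  have "rat_mod 0 = (0 :: 'p mod_ring)" by (rule reduces_to_imp_rat_mod[OF reduces_to_0])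
  then show "coeff (map_poly rat_mod F) n = coeff G n"
    using assms by (simp add: coeff_map_poly poly_reduces_to_def reduces_to_imp_rat_mod)
qed

lemma poly_reduces_to_mult:
  "poly_reduces_to F F' \<Longrightarrow> poly_reduces_to G G' \<Longrightarrow> poly_reduces_to (F * G) (F' * G')"
  by (auto simp: poly_reduces_to_def coeff_mult intro!: reduces_to_sum reduces_to_mult)

lemma poly_reduces_to_lin_power:
  "poly_reduces_to ([:- of_nat c, 1:] ^ e) ([:- of_nat c, 1:] ^ e)"
proof (induction e)
  case 0
  then show ?case by (auto simp: poly_reduces_to_def reduces_to_1 reduces_to_0)
next
  case (Suc e)
  have "poly_reduces_to [:- of_nat c, 1:] [:- of_nat c, 1 :: 'a mod_ring:]"
    using reduces_to_of_int[of "- int c"]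
    by (auto simp: poly_reduces_to_def reduces_to_1 reduces_to_0 coeff_pCons split: nat.splits)
  then show ?case unfolding power_Suc using Suc by (rule poly_reduces_to_mult)
qed

text \<open>\<open>m < CARD('p)\<close> keeps the factorials in the denominators prime to
  \<open>p\<close>; \<open>m <= k\<close> keeps the exponents \<open>k - n\<close> distinct.\<close>

lemma poly_reduces_to_hyp_poly:
  fixes x :: "'p::prime_card mod_ring"
  assumes m: "m < CARD('p)" "m \<le> k" and b: "reduces_to b x"
  shows "poly_reduces_to (hyp_poly k m b (of_nat c)) (homog k (of_nat c) (hyp_trunc m x))"
  unfolding poly_reduces_to_def
proof
  fix i
  have t: "reduces_to (pochhammer (- of_nat m) n * pochhammer b n / (fact n)^2 * of_nat c ^ n)
      (coeff (hyp_trunc m x) n * of_nat c ^ n)" if n: "n \<le> m" for n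
  proof -
    have "\<not> CARD('p) dvd fact n"
      using n m prime_dvd_fact_iff[OF prime_card[where ?'a = 'p], of n] by auto
    then have "\<not> CARD('p) dvd fact n ^ 2" using prime_dvd_power[OF prime_card[where ?'a = 'p]] by blast
    note d = reduces_to_divide[OF _ this]
    have "reduces_to (- of_nat m) (- of_nat m :: 'p mod_ring)"
      using reduces_to_of_int[of "- int m"] by simp
    then have "reduces_to (pochhammer (- of_nat m) n * pochhammer b n / of_nat (fact n ^ 2) * of_nat c ^ n)
        (pochhammer (- of_nat m) n * pochhammer x n / of_nat (fact n ^ 2) * of_nat c ^ n)"
      by (intro reduces_to_mult d reduces_to_pochhammer reduces_to_power reduces_to_of_nat b)
    then show ?thesis using n by (simp add: coeff_hyp_trunc)
  qed
  show "reduces_to (coeff (hyp_poly k m b (of_nat c)) i) (coeff (homog k (of_nat c) (hyp_trunc m x)) i)"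
  proof (cases "i \<le> k \<and> k - i \<le> m")
    case True
    have "coeff (hyp_poly k m b (of_nat c)) i
        = (\<Sum>n=0..m. if n = k - i then pochhammer (- of_nat m) n * pochhammer b n / (fact n)^2 * of_nat c ^ n else 0)"
      unfolding hyp_poly_def coeff_sum coeff_monom using m(2) True by (intro sum.cong) auto
    then show ?thesis using True t[of "k - i"] by (simp add: coeff_homog)
  next
    case False
    then have "coeff (hyp_poly k m b (of_nat c)) i = 0"
      unfolding hyp_poly_def coeff_sum coeff_monom using m(2) by (intro sum.neutral) auto
    moreover have "coeff (homog k (of_nat c) (hyp_trunc m x)) i = 0"
    proof (cases "i \<le> k")
      case True
      then show ?thesis using False by (simp add: coeff_homog coeff_hyp_trunc)
    next
      case False
      then show ?thesis using degree_homog[of k "of_nat c" "hyp_trunc m x"] by (simp add: coeff_eq_0)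
    qed
    ultimately show ?thesis by (simp add: reduces_to_0)
  qed
qed

lemma map_poly_rat_mod_ss:
  fixes x :: "'p::prime_card mod_ring"
  assumes "m < CARD('p)" "m \<le> k" "reduces_to b x"
  shows "map_poly rat_mod ([:- of_nat c, 1:] ^ e * hyp_poly k m b (of_nat c))
       = [:- of_nat c, 1:] ^ e * homog k (of_nat c) (hyp_trunc m x)"
  by (intro poly_reduces_to_imp_map_poly poly_reduces_to_mult poly_reduces_to_lin_power
      poly_reduces_to_hyp_poly assms)

section \<open>Descent from the closure and the three squares\<close>

lemma map_poly_to_ac_mult:
  "map_poly to_ac (F * G) = map_poly to_ac F * map_poly to_ac (G :: 'a::field poly)"
  by (rule poly_eqI) (simp add: coeff_map_poly coeff_mult to_ac_sum)

lemma map_poly_to_ac_power: "map_poly to_ac (F ^ n) = map_poly to_ac (F :: 'a::field poly) ^ n"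
  by (induction n) (simp_all add: map_poly_to_ac_mult map_poly_1')

lemma map_poly_to_ac_sum: "map_poly to_ac (sum F S) = (\<Sum>i\<in>S. map_poly to_ac (F i :: 'a::field poly))"
  by (rule poly_eqI) (simp add: coeff_map_poly coeff_sum to_ac_sum)

lemma map_poly_to_ac_eq_iff: "map_poly to_ac F = map_poly to_ac G \<longleftrightarrow> F = (G :: 'a::field poly)"
  by (auto simp: poly_eq_iff coeff_map_poly)

text \<open>The identity is proved in the algebraic closure and pulled back along the injection
  \<open>to_ac\<close>. The constant fits because
  \<open>8 (6n+1) (6n+3) (6n+5) = 864 (n^2 + n + 5/36) (2n+1)\<close>, half of 1728.\<close>

lemma ss_poly_square:
  fixes p :: nat
  assumes pc: "p = CARD('p::prime_card)" and p5: "p \<ge> 5"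
  shows "(ss_poly :: 'p mod_ring poly) ^ 2 =
       [:- 1728, 1:] ^ eps p *
       (\<Sum>n=0..(p - 1 + 8 * delta p) div 6.
          monom (of_nat ((2 * n choose n) * (3 * n choose n) * (6 * n choose (3 * n))))
            ((p - 1 + 8 * delta p) div 6 - n))"
proof -
  have char: "CHAR('p mod_ring alg_closure) = p" by (simp add: pc)
  have pr: "Factorial_Ring.prime p" unfolding pc by (rule prime_card)
  note r = prime_mod_12[OF pr p5]
  have p5': "CARD('p) \<ge> 5" using pc p5 by simp
  have e: "eps p = hyp12_e p"
  proof -
    have "p mod 4 = (p mod 12) mod 4" by (simp add: mod_mod_cancel)
    then show ?thesis using eps_eq[OF p5'] r unfolding pc hyp12_e_def by auto
  qed
  have d: "delta p = hyp12_d p" using delta_eq[OF p5'] by (simp add: pc hyp12_d_def)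
  define T where "T n = (2 * n choose n) * (3 * n choose n) * (6 * n choose (3 * n))" for n :: nat
  define D where "D = (p - 1 + 8 * delta p) div 6"
  have D: "D = 2 * (p div 12 + hyp12_d p) + hyp12_e p"
  proof -
    have p: "p = 12 * (p div 12) + p mod 12" by simp
    define q where "q = p div 12"
    have "p mod 3 = (p mod 12) mod 3" by (simp add: mod_mod_cancel)
    then have dd: "hyp12_d p = (if p mod 12 = 1 \<or> p mod 12 = 7 then 0 else 1)"
      using r unfolding hyp12_d_def by auto
    consider "p mod 12 = 1" | "p mod 12 = 5" | "p mod 12 = 7" | "p mod 12 = 11" using r by blast
    then show ?thesis
    proof cases
      case 1
      then have "p - 1 = 12 * q" using p q_def by linarith
      then show ?thesis unfolding D_def d dd hyp12_e_def using 1 by (simp flip: q_def)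
    next
      case 2
      then have "p - 1 = 12 * q + 4" using p q_def by linarith
      then show ?thesis unfolding D_def d dd hyp12_e_def using 2 by (simp flip: q_def)
    next
      case 3
      then have "p - 1 = 12 * q + 6" using p q_def by linarith
      then show ?thesis unfolding D_def d dd hyp12_e_def using 3 by (simp flip: q_def)
    next
      case 4
      then have "p - 1 = 12 * q + 10" using p q_def by linarith
      then show ?thesis unfolding D_def d dd hyp12_e_def using 4 by (simp flip: q_def)
    qed
  qed
  have "(ss_hyp p :: 'p mod_ring alg_closure poly) ^ 2
      = [:- 1728, 1:] ^ hyp12_e p * (monom 1 0 * (\<Sum>n=0..D. monom (of_nat (T n)) (D - n)))"
    unfolding ss_hyp_def
  proof (rule clausen_square[OF char p5 hyp12_ode[OF char pr p5] coeff_hyp12_0[OF char pr p5]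
        hyp12_sum[OF char pr p5]])
    show "hyp12_e p \<le> 1" by (simp add: hyp12_e_def)
    show "degree (hyp12 p :: 'p mod_ring alg_closure poly) \<le> p div 12 + hyp12_d p"
      "2 * degree (hyp12 p :: 'p mod_ring alg_closure poly) + hyp12_e p \<le> D"
      using degree_hyp12[OF char pr p5] D by simp_all
    have "hyp12_d p \<le> 1" "hyp12_e p \<le> 1" by (simp_all add: hyp12_d_def hyp12_e_def)
    show "D < p"
    proof (cases "p = 5")
      case True
      then show ?thesis unfolding D by (simp add: hyp12_d_def hyp12_e_def)
    next
      case False
      then have "p \<ge> 6" using p5 by simp
      moreover have "12 * (p div 12) \<le> p" by simp
      moreover have "2 * (x + d) + e < p" if "6 \<le> p" "12 * x \<le> p" "d \<le> 1" "e \<le> 1" for x d e :: nat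
        using that by simp
      ultimately show ?thesis unfolding D using \<open>hyp12_d p \<le> 1\<close> \<open>hyp12_e p \<le> 1\<close> by blast
    qed
    show "D + 0 = 2 * (p div 12 + hyp12_d p) + hyp12_e p" using D by simp
    show "of_nat (T 0) = (1 :: 'p mod_ring alg_closure)" by (simp add: T_def)
    fix n
    have rec: "Suc n ^ 3 * T (Suc n) = 8 * (6 * n + 1) * (6 * n + 3) * (6 * n + 5) * T n"
      unfolding T_def by (rule choose_236_rec)
    let ?k = "(2 * hyp12_A p - of_nat (hyp12_e p)) * (2 * hyp12_B p - of_nat (hyp12_e p))
      :: 'p mod_ring alg_closure"
    \<comment> \<open>\<open>12 A - 6 e\<close> and \<open>12 B - 6 e\<close> are 1 and 5 in some
      order for every residue of \<open>p\<close>.\<close>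
    have k: "36 * ?k = 5"
    proof -
      define A where "A = (hyp12_A p :: 'p mod_ring alg_closure)"
      define B where "B = (hyp12_B p :: 'p mod_ring alg_closure)"
      have "12 * A = of_nat (p mod 12)" "12 * B = of_nat (6 + 12 * hyp12_e p - p mod 12)"
        using smooth_nz[OF char pr p5] by (simp_all add: A_def B_def hyp12_A_def hyp12_B_def)
      moreover have "36 * ((2 * A - of_nat (hyp12_e p)) * (2 * B - of_nat (hyp12_e p)))
          = (12 * A - 6 * of_nat (hyp12_e p)) * (12 * B - 6 * of_nat (hyp12_e p))"
        by Groebner_Basis.algebra
      ultimately have "36 * ((2 * A - of_nat (hyp12_e p)) * (2 * B - of_nat (hyp12_e p)))
          = (of_nat (p mod 12) - 6 * of_nat (hyp12_e p))
            * (of_nat (6 + 12 * hyp12_e p - p mod 12) - 6 * of_nat (hyp12_e p))" by simp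
      also have "\<dots> = 5" using r by (auto simp: hyp12_e_def)
      finally show ?thesis by (simp only: A_def B_def)
    qed
    define N where "N = (of_nat n :: 'p mod_ring alg_closure)"
    define S where "S = (of_nat (Suc n) :: 'p mod_ring alg_closure)"
    define u where "u = (of_nat (T n) :: 'p mod_ring alg_closure)"
    define v where "v = (of_nat (T (Suc n)) :: 'p mod_ring alg_closure)"
    have "S ^ 3 * v = 8 * (6 * N + 1) * (6 * N + 3) * (6 * N + 5) * u"
      using arg_cong[OF rec, of "of_nat :: nat \<Rightarrow> 'p mod_ring alg_closure"]
      unfolding S_def N_def u_def v_def
      by (simp only: of_nat_mult of_nat_add of_nat_power of_nat_numeral of_nat_1)
    then show "2 * of_nat (Suc n) ^ 3 * of_nat (T (Suc n)) =
        1728 * (of_nat n ^ 2 + of_nat n + ?k) * (2 * of_nat n + 1) * (of_nat (T n) :: 'p mod_ring alg_closure)"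
      unfolding S_def[symmetric] N_def[symmetric] u_def[symmetric] v_def[symmetric]
      using k by Groebner_Basis.algebra
  qed
  then have "map_poly to_ac ((ss_poly :: 'p mod_ring poly) ^ 2)
      = map_poly to_ac ([:- 1728, 1:] ^ eps p * (\<Sum>n=0..D. monom (of_nat (T n)) (D - n)))"
    unfolding map_poly_to_ac_power ss_poly_descends ss_poly_ac_eq[OF p5'] pc[symmetric]
    by (simp add: map_poly_to_ac_mult map_poly_to_ac_power map_poly_to_ac_sum map_poly_monom
        map_poly_pCons e)
  then show ?thesis unfolding map_poly_to_ac_eq_iff D_def T_def .
qed

text \<open>Here \<open>4 (4n+1) (4n+2) (4n+3) = 128 (n^2 + n + 3/16) (2n+1)\<close>, so Clausen's
  constant must be \<open>k = 3/16\<close> with scaling 256.\<close>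

lemma ss2_poly_square:
  fixes p :: nat
  assumes pc: "p = CARD('p::prime_card)" and p5: "p \<ge> 5"
  shows "(ss2_poly :: 'p mod_ring poly) ^ 2 =
       [:- 256, 1:] ^ nu p *
       (\<Sum>n=0..(p - 1 + 6 * eps p) div 4.
          monom (of_nat ((2 * n choose n) ^ 2 * (4 * n choose (2 * n))))
            ((p - 1 + 6 * eps p) div 4 - n))"
proof -
  have char: "CHAR('p mod_ring) = p" by (simp add: pc)
  have pr: "Factorial_Ring.prime p" unfolding pc by (rule prime_card)
  have p5': "CARD('p) \<ge> 5" using pc p5 by simp
  note nz = two_three_nz[OF char pr p5]
  have eight: "(8 :: 'p mod_ring) \<noteq> 0"
  proof -
    have "(2 :: 'p mod_ring) * (2 * 2) \<noteq> 0" using nz by (simp only: mult_eq_0_iff) simp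
    then show ?thesis by simp
  qed
  define m where "m = p div 8"
  define \<epsilon> where "\<epsilon> = eps p"
  define \<nu> where "\<nu> = nu p"
  define D where "D = (p - 1 + 6 * \<epsilon>) div 4"
  \<comment> \<open>Eight times the second parameter; as \<open>\<epsilon>\<close> is at most 1, the
    subtraction of naturals is exact.\<close>
  define s where "s = 3 + 4 * \<nu> - 2 * \<epsilon>"
  define T where "T n = (2 * n choose n) ^ 2 * (4 * n choose (2 * n))" for n :: nat
  define A where "A = (- of_nat m :: 'p mod_ring)"
  define B where "B = (of_nat s / 8 :: 'p mod_ring)"
  have p: "p = 8 * m + p mod 8" by (simp add: m_def)
  have p4: "p mod 4 = (p mod 8) mod 4" by (simp add: mod_mod_cancel)
  have r: "p mod 8 = 1 \<or> p mod 8 = 3 \<or> p mod 8 = 5 \<or> p mod 8 = 7"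
    using prime_ge_5_not_dvd[OF pr p5] by presburger
  have "D = 2 * (m + \<epsilon>) + \<nu> \<and> 8 * (A + B) = 4 + 8 * of_nat \<nu>
      \<and> (8 * A - 4 * of_nat \<nu>) * (8 * B - 4 * of_nat \<nu>) = 3 \<and> \<epsilon> \<le> 1 \<and> \<nu> \<le> 1 \<and> D < p"
  proof -
    have p0: "(of_nat p :: 'p mod_ring) = 0" using char by (simp add: of_nat_eq_0_iff_char_dvd)
    have "of_nat (8 * m + p mod 8) = (0 :: 'p mod_ring)"
      by (rule trans[OF arg_cong[OF p, of "of_nat :: nat \<Rightarrow> 'p mod_ring", symmetric] p0])
    then have "8 * of_nat m + of_nat (p mod 8) = (0 :: 'p mod_ring)"
      by (simp only: of_nat_add of_nat_mult of_nat_numeral)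
    \<comment> \<open>Since \<open>p = 0\<close> in the field, \<open>- [p/8]\<close> is
      \<open>(p mod 8) / 8\<close>. Over the four residues \<open>8 A\<close> and \<open>8 B\<close>
      are 1, 3 or 3, 1 for \<open>\<nu> = 0\<close>, and 5, 7 or 7, 5 for
      \<open>\<nu> = 1\<close>.\<close>
    then have A: "8 * A = of_nat (p mod 8)" unfolding A_def mult_minus_right by (rule minus_unique)
    have B: "8 * B = of_nat s" using eight by (simp add: B_def)
    have en: "\<epsilon> = (if p mod 8 = 1 \<or> p mod 8 = 5 then 0 else 1)" "\<nu> = (if p mod 8 = 1 \<or> p mod 8 = 3 then 0 else 1)"
      using eps_eq[OF p5'] nu_eq[OF p5'] p4 r unfolding \<epsilon>_def \<nu>_def pc by auto
    have AB: "8 * (A + B) = of_nat (p mod 8) + of_nat s" by (simp only: distrib_left A B)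
    consider "p mod 8 = 1" | "p mod 8 = 3" | "p mod 8 = 5" | "p mod 8 = 7" using r by blast
    then show ?thesis
    proof cases
      case 1
      then have "p - 1 = 8 * m" using p by linarith
      then show ?thesis unfolding AB A B s_def using 1 p5 by (simp add: en D_def)
    next
      case 2
      then have "p - 1 = 8 * m + 2" using p by linarith
      then show ?thesis unfolding AB A B s_def using 2 p5 by (simp add: en D_def)
    next
      case 3
      then have "p - 1 = 8 * m + 4" using p by linarith
      then show ?thesis unfolding AB A B s_def using 3 p5 by (simp add: en D_def)
    next
      case 4
      then have "p - 1 = 8 * m + 6" using p by linarith
      then show ?thesis unfolding AB A B s_def using 4 p5 by (simp add: en D_def)
    qed
  qed
  then have D: "D = 2 * (m + \<epsilon>) + \<nu>" and AB: "8 * (A + B) = 4 + 8 * of_nat \<nu>"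
    and k: "(8 * A - 4 * of_nat \<nu>) * (8 * B - 4 * of_nat \<nu>) = 3" and en: "\<epsilon> \<le> 1" "\<nu> \<le> 1" and Dp: "D < p"
    by blast+
  have mp: "m < CARD('p)" using p5 unfolding m_def pc by simp
  have b: "3 / 8 - (of_nat \<epsilon> - 2 * of_nat \<nu>) / 4 = (of_nat s / of_nat 8 :: rat)"
    using en by (simp add: s_def of_nat_diff field_simps)
  have "\<not> CARD('p) dvd 8"
    using eight char by (metis of_nat_eq_0_iff_char_dvd of_nat_numeral pc)
  note q = reduces_to_divide[OF reduces_to_of_nat this, of s]
  have "(ss2_poly :: 'p mod_ring poly) = [:- 256, 1:] ^ \<nu> * homog (m + \<epsilon>) 256 (hyp_trunc m B)"
    using map_poly_rat_mod_ss[OF mp _ q, of "m + \<epsilon>" 256 \<nu>]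
    unfolding ss2_poly_def Let_def pc[symmetric] \<epsilon>_def[symmetric] \<nu>_def[symmetric] m_def[symmetric] b
    by (simp add: B_def)
  also have "\<dots> ^ 2 = [:- 256, 1:] ^ \<nu> * (monom 1 0 * (\<Sum>n=0..D. monom (of_nat (T n)) (D - n)))"
  proof (rule clausen_square[OF char p5])
    show "hyp_ode A B 1 (hyp_trunc m B)" unfolding A_def by (rule hyp_trunc_ode) (use mp in simp)
    show "coeff (hyp_trunc m B) 0 = 1" by (rule coeff_hyp_trunc_0)
    have "8 * (A + B) = 8 * (1 / 2 + of_nat \<nu>)" using nz unfolding AB by (simp add: distrib_left)
    then show "A + B = 1 / 2 + of_nat \<nu>" using eight by (metis mult_left_cancel)
    show "\<nu> \<le> 1" "D < p" by (fact en Dp)+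
    show "degree (hyp_trunc m B) \<le> m + \<epsilon>" "2 * degree (hyp_trunc m B) + \<nu> \<le> D"
      using degree_hyp_trunc[of m B] D by simp_all
    show "D + 0 = 2 * (m + \<epsilon>) + \<nu>" using D by simp
    show "of_nat (T 0) = (1 :: 'p mod_ring)" by (simp add: T_def)
    fix n
    have rec: "Suc n ^ 3 * T (Suc n) = 4 * (4 * n + 1) * (4 * n + 2) * (4 * n + 3) * T n"
      unfolding T_def by (rule choose_224_rec)
    define N where "N = (of_nat n :: 'p mod_ring)"
    define S where "S = (of_nat (Suc n) :: 'p mod_ring)"
    define u where "u = (of_nat (T n) :: 'p mod_ring)"
    define v where "v = (of_nat (T (Suc n)) :: 'p mod_ring)"
    have "S ^ 3 * v = 4 * (4 * N + 1) * (4 * N + 2) * (4 * N + 3) * u"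
      using arg_cong[OF rec, of "of_nat :: nat \<Rightarrow> 'p mod_ring"]
      unfolding S_def N_def u_def v_def
      by (simp only: of_nat_mult of_nat_add of_nat_power of_nat_numeral of_nat_1)
    then show "2 * of_nat (Suc n) ^ 3 * of_nat (T (Suc n)) =
        256 * (of_nat n ^ 2 + of_nat n + (2 * A - of_nat \<nu>) * (2 * B - of_nat \<nu>))
          * (2 * of_nat n + 1) * (of_nat (T n) :: 'p mod_ring)"
      unfolding S_def[symmetric] N_def[symmetric] u_def[symmetric] v_def[symmetric]
      using k by Groebner_Basis.algebra
  qed
  finally show ?thesis unfolding D_def T_def \<nu>_def \<epsilon>_def by simp
qed

text \<open>Here \<open>6 (2n+1) (3n+1) (3n+2) = 54 (n^2 + n + 2/9) (2n+1)\<close>, which gives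
  \<open>k = 2/9\<close> and the scaling 108.\<close>

lemma ss3_poly_square:
  fixes p :: nat
  assumes pc: "p = CARD('p::prime_card)" and p5: "p \<ge> 5"
  shows "(ss3_poly :: 'p mod_ring poly) ^ 2 =
       monom 1 (delta p) * [:- 108, 1:] ^ delta p *
       (\<Sum>n=0..(p - 1 + 2 * delta p) div 3.
          monom (of_nat ((2 * n choose n) ^ 2 * (3 * n choose n)))
            ((p - 1 + 2 * delta p) div 3 - n))"
proof -
  have char: "CHAR('p mod_ring) = p" by (simp add: pc)
  have pr: "Factorial_Ring.prime p" unfolding pc by (rule prime_card)
  have p5': "CARD('p) \<ge> 5" using pc p5 by simp
  note nz = two_three_nz[OF char pr p5]
  have six: "(6 :: 'p mod_ring) \<noteq> 0"
  proof -
    have "(2 :: 'p mod_ring) * 3 \<noteq> 0" using nz by (simp only: mult_eq_0_iff) simp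
    then show ?thesis by simp
  qed
  define m where "m = p div 6"
  define \<delta> where "\<delta> = delta p"
  define D where "D = (p - 1 + 2 * \<delta>) div 3"
  define T where "T n = (2 * n choose n) ^ 2 * (3 * n choose n)" for n :: nat
  define A where "A = (- of_nat m :: 'p mod_ring)"
  define B where "B = (of_nat (1 + \<delta>) / 3 :: 'p mod_ring)"
  have p: "p = 6 * m + p mod 6" by (simp add: m_def)
  have p3: "p mod 3 = (p mod 6) mod 3" by (simp add: mod_mod_cancel)
  have r: "p mod 6 = 1 \<or> p mod 6 = 5"
    using prime_ge_5_not_dvd[OF pr p5] by presburger
  have "D = 2 * m + 2 * \<delta> \<and> 6 * (A + B) = 3 + 6 * of_nat \<delta>
      \<and> (6 * A - 3 * of_nat \<delta>) * (3 * (2 * B - of_nat \<delta>)) = 2 \<and> \<delta> \<le> 1 \<and> D < p"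
  proof -
    have p0: "(of_nat p :: 'p mod_ring) = 0" using char by (simp add: of_nat_eq_0_iff_char_dvd)
    have "of_nat (6 * m + p mod 6) = (0 :: 'p mod_ring)"
      by (rule trans[OF arg_cong[OF p, of "of_nat :: nat \<Rightarrow> 'p mod_ring", symmetric] p0])
    then have "6 * of_nat m + of_nat (p mod 6) = (0 :: 'p mod_ring)"
      by (simp only: of_nat_add of_nat_mult of_nat_numeral)
    then have A: "6 * A = of_nat (p mod 6)" unfolding A_def mult_minus_right by (rule minus_unique)
    have B: "3 * B = of_nat (1 + \<delta>)" using nz by (simp add: B_def)
    have dl: "\<delta> = (if p mod 6 = 1 then 0 else 1)"
      using delta_eq[OF p5'] p3 r unfolding \<delta>_def pc by auto
    have "6 * (A + B) = 6 * A + 2 * (3 * B)" by simp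
    then have AB: "6 * (A + B) = of_nat (p mod 6) + 2 * of_nat (1 + \<delta>)" by (simp only: A B)
    have "3 * (2 * B - of_nat \<delta>) = 2 * (3 * B) - 3 * of_nat \<delta>" by (simp add: algebra_simps)
    then have B2: "3 * (2 * B - of_nat \<delta>) = 2 * of_nat (1 + \<delta>) - 3 * of_nat \<delta>" by (simp only: B)
    from r show ?thesis
    proof
      assume 1: "p mod 6 = 1"
      then have "p - 1 = 6 * m" using p by linarith
      then show ?thesis unfolding AB A B2 using 1 p5 by (simp add: dl D_def)
    next
      assume 1: "p mod 6 = 5"
      then have "p - 1 = 6 * m + 4" using p by linarith
      then show ?thesis unfolding AB A B2 using 1 p5 by (simp add: dl D_def)
    qed
  qed
  then have D: "D = 2 * m + 2 * \<delta>" and AB: "6 * (A + B) = 3 + 6 * of_nat \<delta>"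
    and k: "(6 * A - 3 * of_nat \<delta>) * (3 * (2 * B - of_nat \<delta>)) = 2" and dl: "\<delta> \<le> 1" and Dp: "D < p"
    by blast+
  have mp: "m < CARD('p)" using p5 unfolding m_def pc by simp
  have b: "1 / 3 + of_nat \<delta> / 3 = (of_nat (1 + \<delta>) / of_nat 3 :: rat)"
    by (simp add: add_divide_distrib)
  have "\<not> CARD('p) dvd 3"
    using nz(2) char by (metis of_nat_eq_0_iff_char_dvd of_nat_numeral pc)
  note q = reduces_to_divide[OF reduces_to_of_nat this, of "1 + \<delta>"]
  have "(ss3_poly :: 'p mod_ring poly) = [:- 108, 1:] ^ \<delta> * homog (m + \<delta>) 108 (hyp_trunc m B)"
    using map_poly_rat_mod_ss[OF mp _ q, of "m + \<delta>" 108 \<delta>]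
    unfolding ss3_poly_def Let_def pc[symmetric] \<delta>_def[symmetric] m_def[symmetric] b
    by (simp add: B_def del: of_nat_add)
  also have "\<dots> ^ 2 = [:- 108, 1:] ^ \<delta> * (monom 1 \<delta> * (\<Sum>n=0..D. monom (of_nat (T n)) (D - n)))"
  proof (rule clausen_square[OF char p5])
    show "hyp_ode A B 1 (hyp_trunc m B)" unfolding A_def by (rule hyp_trunc_ode) (use mp in simp)
    show "coeff (hyp_trunc m B) 0 = 1" by (rule coeff_hyp_trunc_0)
    have "6 * (A + B) = 6 * (1 / 2 + of_nat \<delta>)" using nz unfolding AB by (simp add: distrib_left)
    then show "A + B = 1 / 2 + of_nat \<delta>" using six by (metis mult_left_cancel)
    show "\<delta> \<le> 1" "D < p" by (fact dl Dp)+
    show "degree (hyp_trunc m B) \<le> m + \<delta>" "2 * degree (hyp_trunc m B) + \<delta> \<le> D"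
      using degree_hyp_trunc[of m B] D by simp_all
    \<comment> \<open>The surplus exponent is \<open>\<delta>\<close> here and 0 in the other two
      identities: this is the extra factor \<open>X^\<delta>\<close>.\<close>
    show "D + \<delta> = 2 * (m + \<delta>) + \<delta>" using D by simp
    show "of_nat (T 0) = (1 :: 'p mod_ring)" by (simp add: T_def)
    fix n
    have rec: "Suc n ^ 3 * T (Suc n) = 6 * (2 * n + 1) * (3 * n + 1) * (3 * n + 2) * T n"
      unfolding T_def by (rule choose_223_rec)
    define N where "N = (of_nat n :: 'p mod_ring)"
    define S where "S = (of_nat (Suc n) :: 'p mod_ring)"
    define u where "u = (of_nat (T n) :: 'p mod_ring)"
    define v where "v = (of_nat (T (Suc n)) :: 'p mod_ring)"
    have "S ^ 3 * v = 6 * (2 * N + 1) * (3 * N + 1) * (3 * N + 2) * u"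
      using arg_cong[OF rec, of "of_nat :: nat \<Rightarrow> 'p mod_ring"]
      unfolding S_def N_def u_def v_def
      by (simp only: of_nat_mult of_nat_add of_nat_power of_nat_numeral of_nat_1)
    then show "2 * of_nat (Suc n) ^ 3 * of_nat (T (Suc n)) =
        108 * (of_nat n ^ 2 + of_nat n + (2 * A - of_nat \<delta>) * (2 * B - of_nat \<delta>))
          * (2 * of_nat n + 1) * (of_nat (T n) :: 'p mod_ring)"
      unfolding S_def[symmetric] N_def[symmetric] u_def[symmetric] v_def[symmetric]
      using k by Groebner_Basis.algebra
  qed
  finally show ?thesis unfolding D_def T_def \<delta>_def by (simp add: ac_simps)
qed

theorem theorem2p6:
  fixes p :: nat and \<nu> \<delta> \<epsilon> :: nat
  assumes "p = CARD('p::prime_card)" and "p \<ge> 5"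
    and "\<nu> = nu p" and "\<delta> = delta p" and "\<epsilon> = eps p"
  shows
    "(ss_poly :: 'p mod_ring poly) ^ 2 =
       [:- 1728, 1:] ^ \<epsilon> *
       (\<Sum>n=0..(p - 1 + 8 * \<delta>) div 6.
          monom (of_nat ((2 * n choose n) * (3 * n choose n) * (6 * n choose (3 * n))))
            ((p - 1 + 8 * \<delta>) div 6 - n))
     \<and> (ss2_poly :: 'p mod_ring poly) ^ 2 =
       [:- 256, 1:] ^ \<nu> *
       (\<Sum>n=0..(p - 1 + 6 * \<epsilon>) div 4.
          monom (of_nat ((2 * n choose n) ^ 2 * (4 * n choose (2 * n))))
            ((p - 1 + 6 * \<epsilon>) div 4 - n))
     \<and> (ss3_poly :: 'p mod_ring poly) ^ 2 =
       monom 1 \<delta> * [:- 108, 1:] ^ \<delta> *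
       (\<Sum>n=0..(p - 1 + 2 * \<delta>) div 3.
          monom (of_nat ((2 * n choose n) ^ 2 * (3 * n choose n)))
            ((p - 1 + 2 * \<delta>) div 3 - n))"
  unfolding assms(3-5)
  using ss_poly_square[OF assms(1,2)] ss2_poly_square[OF assms(1,2)] ss3_poly_square[OF assms(1,2)]
  by blast

end
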